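(* Let $c>0$ be a constant and suppose $\gamma=c\cdot n^{-1/2}$. Let $\mathcal{P}$ (with signal parameter $\gamma$) and $\mathcal{Q}$ be the planted and null models of random tournament matrices $T$ of size $n\times n$, and let $\mathbf{i}$ denote the imaginary unit, so that $\mathbf{i}T$ is Hermitian with largest eigenvalue $\lambda_{\max}(\mathbf{i}T)$. Then, as $n\to\infty$: 1. If $T\sim\mathcal{Q}$, then $\frac{1}{\sqrt n}\lambda_{\max}(\mathbf{i}T)\to 2$ in probability. 2. If $T\sim\mathcal{P}$ and $c\le\pi/4$, then $\frac{1}{\sqrt n}\lambda_{\max}(\mathbf{i}T)\to 2$ in probability. 3. If $T\sim\mathcal{P}$ and $c>\pi/4$, then $\frac{1}{\sqrt n}\lambda_{\max}(\mathbf{i}T)\ge 2+f(c)$ with high probability, for some $f(c)>0$ depending only on $c$. (Here $\pi=3.14159\ldots$)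
   Context: A tournament on $n$ vertices is identified with its tournament matrix $T\in\{-1,0,1\}^{n\times n}$, which is skew-symmetric with zero diagonal and off-diagonal entries $T_{i,j}=-T_{j,i}\in\{\pm1\}$. Planted model $\mathcal{P}$ with signal parameter $\gamma\in[0,\frac12]$: draw a hidden permutation $\sigma$ uniformly from the symmetric group $S_n$; conditionally on $\sigma$, independently for each pair $i,j$ with $\sigma(i)<\sigma(j)$, set $T_{i,j}=-T_{j,i}=+1$ with probability $\frac12+\gamma$ and $-1$ with probability $\frac12-\gamma$. Null model $\mathcal{Q}$: the case $\gamma=0$, i.e. $T$ is a uniformly random tournament matrix. "With high probability" means with probability $1-o(1)$ as $n\to\infty$. Only $n$ large enough that $\gamma\le\frac12$ is considered. *)

theory Defs
  imports "HOL-Probability.Probability" "Jordan_Normal_Form.Char_Poly"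
begin

hide_const (open) Determinants.det Finite_Cartesian_Product.mat

definition tournament_matrices :: "nat \<Rightarrow> int mat set" where
  "tournament_matrices n =
     {T \<in> carrier_mat n n.
        (\<forall>i<n. T $$ (i, i) = 0) \<and>
        (\<forall>i<n. \<forall>j<n. i \<noteq> j \<longrightarrow> T $$ (i, j) \<in> {-1, 1} \<and> T $$ (i, j) = - T $$ (j, i))}"

text \<open>Vertices are numbered from 0 to n - 1.\<close>

definition ranked_pairs :: "nat \<Rightarrow> (nat \<Rightarrow> nat) \<Rightarrow> (nat \<times> nat) set" where
  "ranked_pairs n \<sigma> = {(i, j). i < n \<and> j < n \<and> \<sigma> i < \<sigma> j}"

definition tournament_of :: "nat \<Rightarrow> (nat \<Rightarrow> nat) \<Rightarrow> (nat \<times> nat \<Rightarrow> int) \<Rightarrow> int mat" where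
  "tournament_of n \<sigma> X =
     mat n n (\<lambda>(i, j). if \<sigma> i < \<sigma> j then X (i, j)
                       else if \<sigma> j < \<sigma> i then - X (j, i)
                       else 0)"

definition sign_pmf :: "real \<Rightarrow> int pmf" where
  "sign_pmf p = map_pmf (\<lambda>b. if b then 1 else - 1) (bernoulli_pmf p)"

text \<open>
  The model is only meaningful for \<open>0 \<le> \<gamma> \<le> 1 / 2\<close>; outside this range \<^const>\<open>bernoulli_pmf\<close>
  silently clips its parameter to the unit interval.
\<close>

definition planted_model :: "nat \<Rightarrow> real \<Rightarrow> int mat pmf" where
  "planted_model n \<gamma> = do {
     \<sigma> \<leftarrow> pmf_of_set {\<sigma>. \<sigma> permutes {..<n}};
     X \<leftarrow> Pi_pmf (ranked_pairs n \<sigma>) 0 (\<lambda>_. sign_pmf (1 / 2 + \<gamma>));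
     return_pmf (tournament_of n \<sigma> X)
   }"

definition null_model :: "nat \<Rightarrow> int mat pmf" where
  "null_model n = planted_model n 0"

definition i_times :: "int mat \<Rightarrow> complex mat" where
  "i_times T = \<i> \<cdot>\<^sub>m map_mat of_int T"

text \<open>
  Meant for Hermitian matrices of positive dimension, all of whose eigenvalues are real;
  the value for the empty matrix is unspecified.
\<close>

definition lambda_max :: "complex mat \<Rightarrow> real" where
  "lambda_max A = Max {x. eigenvalue A (complex_of_real x)}"

text \<open>
  The random variables may live on a different probability space for each index, so that
  convergence in probability only makes sense for a constant limit.
\<close>

definition tendsto_in_prob :: "(nat \<Rightarrow> 'a pmf) \<Rightarrow> (nat \<Rightarrow> 'a \<Rightarrow> real) \<Rightarrow> real \<Rightarrow> bool" where
  "tendsto_in_prob M Y l \<longleftrightarrow>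
     (\<forall>\<epsilon>>0. (\<lambda>n. measure_pmf.prob (M n) {x. \<bar>Y n x - l\<bar> > \<epsilon>}) \<longlonglongrightarrow> 0)"

definition with_high_prob :: "(nat \<Rightarrow> 'a pmf) \<Rightarrow> (nat \<Rightarrow> 'a \<Rightarrow> bool) \<Rightarrow> bool" where
  "with_high_prob M P \<longleftrightarrow> (\<lambda>n. measure_pmf.prob (M n) {x. P n x}) \<longlonglongrightarrow> 1"


lemma finite_ranked_pairs: "finite (ranked_pairs n \<sigma>)"
  by (rule finite_subset[of _ "{..<n} \<times> {..<n}"]) (auto simp: ranked_pairs_def)

lemma sign_pmf_half: "sign_pmf (1 / 2) = pmf_of_set {-1, 1}"
proof -
  have "sign_pmf (1 / 2) = pmf_of_set ((\<lambda>b. if b then 1 else - 1 :: int) ` UNIV)"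
    unfolding sign_pmf_def bernoulli_pmf_half_conv_pmf_of_set
    by (rule map_pmf_of_set_inj) (auto simp: inj_on_def split: if_splits)
  also have "(\<lambda>b. if b then 1 else - 1 :: int) ` UNIV = {-1, 1}"
    by (auto simp: UNIV_bool)
  finally show ?thesis .
qed

lemma bij_betw_tournament_of:
  assumes "\<sigma> permutes {..<n}"
  shows "bij_betw (tournament_of n \<sigma>)
           (PiE_dflt (ranked_pairs n \<sigma>) 0 (\<lambda>_. {-1, 1})) (tournament_matrices n)"
proof (rule bij_betwI[where g = "\<lambda>T p. if p \<in> ranked_pairs n \<sigma> then T $$ p else 0"])
  have inj: "\<sigma> i = \<sigma> j \<longleftrightarrow> i = j" for i j
    using permutes_inj[OF assms] by (auto dest: injD)
  show "tournament_of n \<sigma> \<in> PiE_dflt (ranked_pairs n \<sigma>) 0 (\<lambda>_. {-1, 1}) \<rightarrow> tournament_matrices n"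
  proof
    fix X :: "nat \<times> nat \<Rightarrow> int"
    assume X: "X \<in> PiE_dflt (ranked_pairs n \<sigma>) 0 (\<lambda>_. {-1, 1})"
    then have *: "X (i, j) = -1 \<or> X (i, j) = 1" if "i < n" "j < n" "\<sigma> i < \<sigma> j" for i j
      using that by (auto simp: PiE_dflt_def ranked_pairs_def)
    show "tournament_of n \<sigma> X \<in> tournament_matrices n"
      unfolding tournament_matrices_def tournament_of_def
      using * by (auto simp: not_less inj le_less)
  qed
  show "(\<lambda>T p. if p \<in> ranked_pairs n \<sigma> then T $$ p else 0)
          \<in> tournament_matrices n \<rightarrow> PiE_dflt (ranked_pairs n \<sigma>) 0 (\<lambda>_. {-1, 1})"
  proof
    fix T assume T: "T \<in> tournament_matrices n"
    then have "\<forall>i<n. \<forall>j<n. i \<noteq> j \<longrightarrow> T $$ (i, j) \<in> {-1, 1}"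
      unfolding tournament_matrices_def by blast
    then have "T $$ (i, j) \<in> {-1, 1}" if "i < n" "j < n" "\<sigma> i < \<sigma> j" for i j
      using that less_irrefl by metis
    then show "(\<lambda>p. if p \<in> ranked_pairs n \<sigma> then T $$ p else 0)
                 \<in> PiE_dflt (ranked_pairs n \<sigma>) 0 (\<lambda>_. {-1, 1})"
      by (auto simp: PiE_dflt_def ranked_pairs_def)
  qed
  show "(\<lambda>p. if p \<in> ranked_pairs n \<sigma> then tournament_of n \<sigma> X $$ p else 0) = X"
    if "X \<in> PiE_dflt (ranked_pairs n \<sigma>) 0 (\<lambda>_. {-1, 1})" for X
    using that by (auto simp: PiE_dflt_def ranked_pairs_def tournament_of_def fun_eq_iff)
  show "tournament_of n \<sigma> (\<lambda>p. if p \<in> ranked_pairs n \<sigma> then T $$ p else 0) = T"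
    if T: "T \<in> tournament_matrices n" for T
  proof (rule eq_matI)
    have dims: "dim_row T = n" "dim_col T = n"
      using T unfolding tournament_matrices_def carrier_mat_def by blast+
    have diag: "\<And>i. i < n \<Longrightarrow> T $$ (i, i) = 0"
      and skew: "\<And>i j. i < n \<Longrightarrow> j < n \<Longrightarrow> i \<noteq> j \<Longrightarrow> T $$ (i, j) = - T $$ (j, i)"
      using T unfolding tournament_matrices_def by blast+
    show "tournament_of n \<sigma> (\<lambda>p. if p \<in> ranked_pairs n \<sigma> then T $$ p else 0) $$ (i, j) = T $$ (i, j)"
      if "i < dim_row T" "j < dim_col T" for i j
    proof (cases "i = j")
      case True
      with that dims diag[of i] show ?thesis
        by (simp add: tournament_of_def)
    next
      case False
      with that dims inj[of i j] skew[of i j] show ?thesis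
        by (auto simp: tournament_of_def ranked_pairs_def)
    qed
    show "dim_row (tournament_of n \<sigma> (\<lambda>p. if p \<in> ranked_pairs n \<sigma> then T $$ p else 0)) = dim_row T"
      and "dim_col (tournament_of n \<sigma> (\<lambda>p. if p \<in> ranked_pairs n \<sigma> then T $$ p else 0)) = dim_col T"
      by (simp_all add: tournament_of_def dims)
  qed
qed

lemma null_model_eq_uniform: "null_model n = pmf_of_set (tournament_matrices n)"
proof -
  let ?P = "{\<sigma>. \<sigma> permutes {..<n}}"
  have "id \<in> ?P"
    by (simp add: permutes_id)
  then have P_ne: "?P \<noteq> {}"
    by (rule ex_in_conv[THEN iffD1, OF exI])
  have P_fin: "finite ?P"
    by (rule finite_permutations) simp
  have "map_pmf (tournament_of n \<sigma>) (Pi_pmf (ranked_pairs n \<sigma>) 0 (\<lambda>_. sign_pmf (1 / 2)))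
          = pmf_of_set (tournament_matrices n)" if "\<sigma> permutes {..<n}" for \<sigma>
  proof -
    let ?B = "PiE_dflt (ranked_pairs n \<sigma>) 0 (\<lambda>_. {-1, 1 :: int})"
    have "Pi_pmf (ranked_pairs n \<sigma>) 0 (\<lambda>_. sign_pmf (1 / 2)) = pmf_of_set ?B"
      unfolding sign_pmf_half by (rule Pi_pmf_of_set) (auto simp: finite_ranked_pairs)
    moreover have "finite ?B"
      by (intro finite_PiE_dflt finite_ranked_pairs) auto
    moreover have "?B \<noteq> {}"
      by (simp add: PiE_dflt_empty_iff)
    ultimately show ?thesis
      using map_pmf_of_set_bij_betw[OF bij_betw_tournament_of[OF that]] by simp
  qed
  then have "null_model n = pmf_of_set ?P \<bind> (\<lambda>_. pmf_of_set (tournament_matrices n))"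
    unfolding null_model_def planted_model_def
    by (intro bind_pmf_cong) (use P_ne P_fin in \<open>auto simp: map_pmf_def\<close>)
  then show ?thesis
    by simp
qed

end

theory Submission
  imports Defs "HOL-Real_Asymp.Real_Asymp"
begin

text \<open>
  Resampling a \<open>\<gamma>\<close>-fraction of the pairs couples \<open>T\<close> with a uniform tournament \<open>R\<close> such that
  \<open>T = R + 2 \<gamma> S + D\<close>, where \<open>S\<close> is the transitive tournament and \<open>D\<close> is centred and sparse, so of
  norm \<open>o(\<surd>n)\<close>. The eigenvectors of \<open>\<i> S\<close> are Fourier modes with eigenvalues
  \<open>cot ((2 k + 1) \<pi> / (2 n))\<close>; after scaling, the largest eigenvalue of \<open>2 \<gamma> \<i> S\<close> tends to
  \<open>\<theta> = 4 c / \<pi>\<close>.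

  Put \<open>H = \<i> R / \<surd>n\<close>. Two facts about \<open>R\<close> suffice. First, \<open>\<lambda>\<^sub>m\<^sub>a\<^sub>x(H) \<le> 2 + o(1)\<close>, by counting
  closed walks that use every edge an even number of times. Secondly, for delocalised orthonormal \<open>u\<^sub>k\<close> the
  vectors \<open>U\<^sub>m(H) u\<^sub>k\<close>, with \<open>U\<^sub>m\<close> the Chebyshev polynomials, are asymptotically orthonormal: they are sums
  over non-backtracking walks, for which a second moment bound is easy. On their span \<open>H\<close> acts as the
  free Jacobi matrix and the signal adds \<open>\<theta>\<close> to its corner entry, which creates an outlier
  exactly if \<open>\<theta> > 1\<close>: the trial vectors \<open>\<Sum> \<theta>\<^sup>-\<^sup>m U\<^sub>m(H) u\<^sub>0\<close> give \<open>\<theta> + 1 / \<theta> > 2\<close>, while for \<open>\<theta> \<le> 1\<close>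
  the approximate resolvent \<open>\<Sum> t\<^sup>m\<^sup>+\<^sup>1 U\<^sub>m(H)\<close> at \<open>t + 1 / t\<close>, with \<open>t < 1\<close> near \<open>1\<close>, certifies that the
  signal does not push the form beyond \<open>2 + o(1)\<close>.
\<close>

section \<open>Expectations along walks\<close>

text \<open>The planted matrix is compared with an exactly uniform \<open>R\<close>, and not with
  its own centred part, because the entries of \<open>R\<close> are exact signs:
  \<open>R_uv R_vu = - 1\<close> gives the non-backtracking sums an exact three-term recursion,
  whose coefficients \<open>(n - 1) / n\<close> and \<open>(n - 2) / n\<close> tend to 1. Asymptotic
  orthonormality thereby reduces to inner products with finitely many fixed vectors
  \<open>u_k\<close>, where a second moment is enough. The price is the error \<open>D\<close>. It
  only has to be of smaller order, so a crude count of closed walks of length 8 controls it. For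
  \<open>R\<close> the constant 2 must be sharp; this requires walks longer than any multiple of
  \<open>log n\<close>, and hence a careful account of the ways in which such a walk can close its
  edges. For fixed \<open>k \<ge> 0\<close> the signal eigenvalues are about
  \<open>\<theta> / (2 k + 1)\<close>, so only finitely many of the positive ones are not small. If
  \<open>\<theta> \<le> 1\<close>, these are dominated by plain projections onto the
  \<open>u_k\<close>. In the lower bounds the negative eigenvalues do no harm: the trial vector is
  asymptotically orthogonal to the finitely many modes where they are not small.\<close>

definition edges :: "nat \<Rightarrow> nat set set" where
  "edges n = {{u, v} | u v. u < n \<and> v < n \<and> u \<noteq> v}"

lemma edgesI: "u < n \<Longrightarrow> v < n \<Longrightarrow> u \<noteq> v \<Longrightarrow> {u, v} \<in> edges n"
  unfolding edges_def by blast

lemma finite_edges: "finite (edges n)"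
  by (rule finite_subset[of _ "Pow {..<n}"]) (auto simp: edges_def)

lemma finite_edge_subset: "H \<subseteq> edges n \<Longrightarrow> finite H"
  by (rule finite_subset[OF _ finite_edges])

definition deg :: "nat set set \<Rightarrow> nat \<Rightarrow> nat" where
  "deg H v = card {e \<in> H. v \<in> e}"

lemma deg_le_card: "finite H \<Longrightarrow> deg H v \<le> card H"
  unfolding deg_def by (rule card_mono) auto

lemma deg_insert:
  assumes "finite H" "e \<notin> H"
  shows "deg (insert e H) w = deg H w + (if w \<in> e then 1 else 0)"
proof -
  have "{e' \<in> insert e H. w \<in> e'} = (if w \<in> e then insert e {e' \<in> H. w \<in> e'} else {e' \<in> H. w \<in> e'})"
    by auto
  with assms show ?thesis by (simp add: deg_def)
qed

lemma deg_remove: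
  assumes "finite H" "e \<in> H"
  shows "deg H w = deg (H - {e}) w + (if w \<in> e then 1 else 0)"
  using deg_insert[of "H - {e}" e w] assms by (simp add: insert_absorb)

lemma card_neighbours:
  assumes "finite H"
  shows "card {u. {v, u} \<in> H} \<le> deg H v" and "finite {u. {v, u} \<in> H}"
proof -
  have inj: "inj_on (\<lambda>u. {v, u}) {u. {v, u} \<in> H}"
    by (auto simp: inj_on_def doubleton_eq_iff)
  have sub: "(\<lambda>u. {v, u}) ` {u. {v, u} \<in> H} \<subseteq> {e \<in> H. v \<in> e}" by auto
  have fin: "finite {e \<in> H. v \<in> e}" using assms by simp
  show "card {u. {v, u} \<in> H} \<le> deg H v"
    unfolding deg_def using card_inj_on_le[OF inj sub fin] .
  show "finite {u. {v, u} \<in> H}"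
    using inj_on_finite[OF inj sub fin] .
qed

lemma card_endpoints:
  assumes "H \<subseteq> edges n"
  shows "card {u. u < n \<and> deg H u > 0} \<le> 2 * card H"
proof -
  have fin: "finite H" using finite_edge_subset[OF assms] .
  have card2: "finite e \<and> card e \<le> 2" if "e \<in> H" for e
  proof -
    obtain u v where e: "e = {u, v}" using \<open>e \<in> H\<close> assms by (auto simp: edges_def)
    show ?thesis unfolding e using card_insert_le_m1[of 2 "{v}" u] by simp
  qed
  have "{u. u < n \<and> deg H u > 0} \<subseteq> \<Union> H"
    by (auto simp: deg_def card_gt_0_iff)
  moreover have "finite (\<Union> H)" using fin card2 by auto
  ultimately have "card {u. u < n \<and> deg H u > 0} \<le> card (\<Union> H)" by (rule card_mono[rotated])
  also have "\<dots> \<le> (\<Sum>e\<in>H. card e)"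
    using card_UN_le[OF fin, of "\<lambda>e. e"] by simp
  also have "\<dots> \<le> (\<Sum>e\<in>H. 2)" using card2 by (intro sum_mono) auto
  also have "\<dots> = 2 * card H" by simp
  finally show ?thesis .
qed

section \<open>Mixed moments of edge variables along a walk\<close>

primrec mpow :: "nat \<Rightarrow> (nat \<Rightarrow> nat \<Rightarrow> 'a::comm_ring_1) \<Rightarrow> nat \<Rightarrow> nat \<Rightarrow> nat \<Rightarrow> 'a" where
  "mpow n A 0 v t = (if v = t then 1 else 0)"
| "mpow n A (Suc l) v t = (\<Sum>u<n. A v u * mpow n A l u t)"

text \<open>One interface for two families: fair signs, with \<open>\<alpha> = 1\<close> and
  \<open>\<beta> = 0\<close>, and centred Bernoulli variables of variance \<open>\<alpha>\<close>.
  \<open>mean_zero\<close> condenses independence and centring, and \<open>square\<close> removes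
  repeated factors; together they determine every mixed moment. The deterministic sign
  \<open>s\<close> carries the orientation of a pair.\<close>

locale edge_chaos =
  fixes n :: nat and M :: "'a pmf" and g :: "nat set \<Rightarrow> 'a \<Rightarrow> real"
    and s :: "nat \<Rightarrow> nat \<Rightarrow> real" and \<alpha> \<beta> :: real
  assumes finite_support: "finite (set_pmf M)"
    and mean_zero: "H \<subseteq> edges n \<Longrightarrow> H \<noteq> {} \<Longrightarrow> measure_pmf.expectation M (\<lambda>x. \<Prod>e\<in>H. g e x) = 0"
    and square: "x \<in> set_pmf M \<Longrightarrow> e \<in> edges n \<Longrightarrow> g e x * g e x = \<alpha> + \<beta> * g e x"
    and sign: "\<bar>s u v\<bar> = 1"
    and alpha_nonneg: "\<alpha> \<ge> 0" and beta_nonneg: "\<beta> \<ge> 0"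
begin

definition W :: "'a \<Rightarrow> nat \<Rightarrow> nat \<Rightarrow> real" where
  "W x v u = (if u = v then 0 else s v u * g {v, u} x)"

text \<open>A walk is unfolded from its first step onward: \<open>H\<close> holds the edges whose
  factors are still pending, \<open>f\<close> is the rest of the product. For
  \<open>\<beta> = 0\<close> the pending edges are those used an odd number of times so far.\<close>

definition ev :: "nat set set \<Rightarrow> ('a \<Rightarrow> complex) \<Rightarrow> complex" where
  "ev H f = measure_pmf.expectation M (\<lambda>x. complex_of_real (\<Prod>e\<in>H. g e x) * f x)"

lemma integrable_M: "integrable (measure_pmf M) (f :: 'a \<Rightarrow> 'b :: {banach, second_countable_topology})"
  by (rule integrable_measure_pmf_finite[OF finite_support])

lemma ev_sum: "ev H (\<lambda>x. \<Sum>u\<in>S. f u x) = (\<Sum>u\<in>S. ev H (f u))"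
  unfolding ev_def sum_distrib_left by (rule Bochner_Integration.integral_sum) (rule integrable_M)

lemma ev_cmult: "ev H (\<lambda>x. c * f x) = c * ev H f"
proof -
  have "ev H (\<lambda>x. c * f x) = measure_pmf.expectation M (\<lambda>x. c * (complex_of_real (\<Prod>e\<in>H. g e x) * f x))"
    unfolding ev_def by (simp add: mult_ac)
  then show ?thesis unfolding ev_def by simp
qed

lemma ev_const: "H \<subseteq> edges n \<Longrightarrow> ev H (\<lambda>x. c) = (if H = {} then c else 0)"
  using mean_zero[of H] unfolding ev_def by (simp add: integral_complex_of_real flip: of_real_prod)

abbreviation step :: "nat set set \<Rightarrow> nat \<Rightarrow> nat \<Rightarrow> ('a \<Rightarrow> complex) \<Rightarrow> real" where
  "step H v u f \<equiv> (if {v, u} \<notin> H then norm (ev (insert {v, u} H) f)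
     else \<alpha> * norm (ev (H - {{v, u}}) f) + \<beta> * norm (ev H f))"

lemma norm_ev_W:
  assumes "H \<subseteq> edges n" "v < n" "u < n" "u \<noteq> v"
  shows "norm (ev H (\<lambda>x. complex_of_real (W x v u) * f x)) \<le>
    (step H v u f)"
proof -
  let ?e = "{v, u}"
  have fin: "finite H" using finite_edge_subset[OF assms(1)] .
  have "ev H (\<lambda>x. complex_of_real (W x v u) * f x) =
      ev H (\<lambda>x. complex_of_real (s v u) * (complex_of_real (g ?e x) * f x))"
    using assms by (simp add: W_def mult.assoc)
  also have "\<dots> = complex_of_real (s v u) * ev H (\<lambda>x. complex_of_real (g ?e x) * f x)"
    by (rule ev_cmult)
  finally have *: "norm (ev H (\<lambda>x. complex_of_real (W x v u) * f x)) =
      norm (ev H (\<lambda>x. complex_of_real (g ?e x) * f x))"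
    by (simp add: norm_mult sign)
  show ?thesis
  proof (cases "?e \<in> H")
    case False
    then have "ev H (\<lambda>x. complex_of_real (g ?e x) * f x) = ev (insert ?e H) f"
      unfolding ev_def using fin by (simp add: mult_ac)
    with False * show ?thesis by simp
  next
    case True
    have P: "(\<Prod>e\<in>H. g e x) = g ?e x * (\<Prod>e\<in>H - {?e}. g e x)" for x
      using prod.remove[OF fin True] .
    have "ev H (\<lambda>x. complex_of_real (g ?e x) * f x) =
       measure_pmf.expectation M (\<lambda>x. complex_of_real \<alpha> * (complex_of_real (\<Prod>e\<in>H - {?e}. g e x) * f x)
          + complex_of_real \<beta> * (complex_of_real (\<Prod>e\<in>H. g e x) * f x))"
      unfolding ev_def
    proof (intro integral_cong_AE)
      show "AE x in measure_pmf M. complex_of_real (\<Prod>e\<in>H. g e x) * (complex_of_real (g ?e x) * f x) =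
        complex_of_real \<alpha> * (complex_of_real (\<Prod>e\<in>H - {?e}. g e x) * f x) +
        complex_of_real \<beta> * (complex_of_real (\<Prod>e\<in>H. g e x) * f x)"
        unfolding AE_measure_pmf_iff
      proof
        fix x assume x: "x \<in> set_pmf M"
        have sq: "complex_of_real (g ?e x) * complex_of_real (g ?e x) =
            complex_of_real \<alpha> + complex_of_real \<beta> * complex_of_real (g ?e x)"
          using square[OF x edgesI[OF assms(2,3)]] assms(4) by (metis of_real_add of_real_mult)
        have alg: "(c * q) * (c * h) = a * (q * h) + b * ((c * q) * h)"
          if "c * c = a + b * c" for a b c q h :: complex
        proof -
          have "(c * q) * (c * h) = (c * c) * (q * h)" by (simp only: mult_ac)
          then show ?thesis by (simp only: that distrib_right) (simp only: mult_ac)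
        qed
        show "complex_of_real (\<Prod>e\<in>H. g e x) * (complex_of_real (g ?e x) * f x) =
          complex_of_real \<alpha> * (complex_of_real (\<Prod>e\<in>H - {?e}. g e x) * f x) +
          complex_of_real \<beta> * (complex_of_real (\<Prod>e\<in>H. g e x) * f x)"
          unfolding P of_real_mult by (rule alg[OF sq])
      qed
    qed auto
    also have "\<dots> = complex_of_real \<alpha> * ev (H - {?e}) f + complex_of_real \<beta> * ev H f"
      unfolding ev_def by (subst Bochner_Integration.integral_add) (auto intro: integrable_M)
    finally have "norm (ev H (\<lambda>x. complex_of_real (g ?e x) * f x)) \<le>
        norm (complex_of_real \<alpha> * ev (H - {?e}) f) + norm (complex_of_real \<beta> * ev H f)"
      using norm_triangle_ineq by metis
    with True * show ?thesis
      using alpha_nonneg beta_nonneg by (simp add: norm_mult)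
  qed
qed

lemma norm_ev_step:
  assumes "H \<subseteq> edges n" "v < n" "S \<subseteq> {..<n} - {v}"
  shows "norm (ev H (\<lambda>x. \<Sum>u\<in>S. complex_of_real (W x v u) * f u x)) \<le>
    (\<Sum>u\<in>S. step H v u (f u))"
  unfolding ev_sum
  by (rule order_trans[OF norm_sum], rule sum_mono, rule norm_ev_W) (use assms in auto)

text \<open>Each pending edge is charged a factor \<open>y\<close>. A step that opens an edge has at
  most \<open>n\<close> targets, of weight \<open>y\<close>; a step along a pending edge has at most
  \<open>K\<close> targets, of weight \<open>\<alpha> / y\<close> if the edge is removed and
  \<open>\<beta>\<close> if it stays. The invariant \<open>card H + l \<le> K\<close> bounds the
  degrees at all later times. The set \<open>S p v\<close> of admissible targets is left open, so
  that free and non-backtracking walks are both covered.\<close>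

lemma crude_bound:
  fixes f :: "nat \<Rightarrow> nat \<Rightarrow> nat \<Rightarrow> 'a \<Rightarrow> complex"
  assumes rec: "\<And>l p v x. f (Suc l) p v x = (\<Sum>u\<in>S p v. complex_of_real (W x v u) * f l v u x)"
    and S: "\<And>p v. S p v \<subseteq> {..<n} - {v}"
    and base: "\<And>H p v. H \<subseteq> edges n \<Longrightarrow> v < n \<Longrightarrow> card H \<le> K \<Longrightarrow> norm (ev H (f 0 p v)) \<le> b * y ^ card H"
    and x: "X \<ge> real n * y + real K * (\<alpha> / y + \<beta>)" and y: "y > 0" and b: "b \<ge> 0"
  shows "H \<subseteq> edges n \<Longrightarrow> v < n \<Longrightarrow> card H + l \<le> K \<Longrightarrow> norm (ev H (f l p v)) \<le> b * X ^ l * y ^ card H"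
proof (induction l arbitrary: H p v)
  case 0
  then show ?case using base by simp
next
  case (Suc l)
  have fin: "finite H" using finite_edge_subset[OF Suc.prems(1)] .
  have "0 \<le> real n * y + real K * (\<alpha> / y + \<beta>)"
    using y alpha_nonneg beta_nonneg by (intro add_nonneg_nonneg mult_nonneg_nonneg) auto
  then have X0: "X \<ge> 0" using x by linarith
  let ?B = "b * X ^ l * y ^ card H"
  have B0: "?B \<ge> 0" using X0 y b by simp
  have finS: "finite (S p v)" using S[of p v] finite_subset by blast
  have cardS: "card (S p v) \<le> n"
    using card_mono[of "{..<n}" "S p v"] S[of p v] by auto
  have "norm (ev H (f (Suc l) p v)) = norm (ev H (\<lambda>x. \<Sum>u\<in>S p v. complex_of_real (W x v u) * f l v u x))"
    using rec[of l p v] by presburger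
  also have "\<dots> \<le> (\<Sum>u\<in>S p v. step H v u (f l v u))"
    by (rule norm_ev_step[OF Suc.prems(1,2) S])
  also have "\<dots> \<le> (\<Sum>u\<in>S p v. ?B * (y + (if {v, u} \<in> H then \<alpha> / y + \<beta> else 0)))"
  proof (rule sum_mono)
    fix u assume "u \<in> S p v"
    with S[of p v] have u: "u < n" "u \<noteq> v" by auto
    have e: "{v, u} \<in> edges n" using u Suc.prems(2) by (intro edgesI) auto
    show "(step H v u (f l v u)) \<le>
       ?B * (y + (if {v, u} \<in> H then \<alpha> / y + \<beta> else 0))"
    proof (cases "{v, u} \<in> H")
      case False
      with Suc.IH[of "insert {v, u} H" u v] Suc.prems e fin u
      show ?thesis by (simp add: mult_ac)
    next
      case True
      have c: "card H = Suc (card (H - {{v, u}}))"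
        using True fin card_Suc_Diff1 by metis
      have 1: "norm (ev (H - {{v, u}}) (f l v u)) \<le> b * X ^ l * y ^ card (H - {{v, u}})"
        using Suc.IH[of "H - {{v, u}}" u v] Suc.prems c u by auto
      have 2: "norm (ev H (f l v u)) \<le> ?B"
        using Suc.IH[of H u v] Suc.prems u by auto
      have "\<alpha> * norm (ev (H - {{v, u}}) (f l v u)) + \<beta> * norm (ev H (f l v u))
          \<le> \<alpha> * (b * X ^ l * y ^ card (H - {{v, u}})) + \<beta> * ?B"
        using 1 2 alpha_nonneg beta_nonneg by (intro add_mono mult_left_mono) auto
      also have "\<dots> = ?B * (\<alpha> / y + \<beta>)"
        using y by (simp add: c field_simps)
      also have "\<dots> \<le> ?B * (y + (\<alpha> / y + \<beta>))"
        using B0 y by (intro mult_left_mono) auto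
      finally show ?thesis using True by simp
    qed
  qed
  also have "\<dots> = ?B * (real (card (S p v)) * y + real (card {u \<in> S p v. {v, u} \<in> H}) * (\<alpha> / y + \<beta>))"
  proof -
    have "(\<Sum>u\<in>S p v. if {v, u} \<in> H then \<alpha> / y + \<beta> else 0) = real (card {u \<in> S p v. {v, u} \<in> H}) * (\<alpha> / y + \<beta>)"
      using finS by (simp add: sum.If_cases Int_def)
    then show ?thesis
      by (simp add: sum.distrib flip: sum_distrib_left)
  qed
  also have "\<dots> \<le> ?B * (real n * y + real K * (\<alpha> / y + \<beta>))"
  proof -
    have "card {u \<in> S p v. {v, u} \<in> H} \<le> card {u. {v, u} \<in> H}"
      using card_neighbours(2)[OF fin, of v] by (intro card_mono) auto
    also have "\<dots> \<le> K"
      using card_neighbours(1)[OF fin, of v] deg_le_card[OF fin, of v] Suc.prems(3) by linarith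
    finally show ?thesis
      using cardS alpha_nonneg beta_nonneg y B0
      by (intro mult_left_mono add_mono mult_right_mono) auto
  qed
  also have "\<dots> \<le> ?B * X" using x B0 by (intro mult_left_mono)
  finally show ?case by (simp add: mult_ac)
qed

lemma mpow_W_rec:
  "complex_of_real (mpow n (W x) (Suc l) v t) =
    (\<Sum>u\<in>{..<n} - {v}. complex_of_real (W x v u) * complex_of_real (mpow n (W x) l u t))"
proof -
  have "(\<Sum>u<n. W x v u * mpow n (W x) l u t) = (\<Sum>u\<in>{..<n} - {v}. W x v u * mpow n (W x) l u t)"
    by (intro sum.mono_neutral_right) (auto simp: W_def)
  then show ?thesis by simp
qed

end

text \<open>
  Non-backtracking walks: the first step must not return to \<open>p\<close>; taking \<open>p = v\<close>
  imposes no restriction, since no step stays in place.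
\<close>

primrec nb :: "nat \<Rightarrow> (nat \<Rightarrow> nat \<Rightarrow> real) \<Rightarrow> (nat \<Rightarrow> complex) \<Rightarrow> nat \<Rightarrow> nat \<Rightarrow> nat \<Rightarrow> complex" where
  "nb n A w 0 p v = w v"
| "nb n A w (Suc l) p v = (\<Sum>u\<in>{..<n} - {v, p}. complex_of_real (A v u) * nb n A w l v u)"

abbreviation nb_const :: "nat \<Rightarrow> real" where
  "nb_const m \<equiv> 2 * real m * (1 + 2 * real m) ^ (2 * m) * (real m + 1)"

lemma cnj_nb: "cnj (nb n A w l p v) = nb n A (\<lambda>v. cnj (w v)) l p v"
  by (induction l arbitrary: p v) simp_all

context edge_chaos
begin

text \<open>
  A closing step along an odd edge is a real choice only where several odd edges meet, and
  such an excess of odd edges is created only by opening an edge towards a vertex that already has one.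
  The excess \<open>phi\<close> pays for these choices; the parity of degrees along a walk is what the
  slack accounts for.
\<close>

definition slack :: "nat \<Rightarrow> nat \<Rightarrow> nat \<Rightarrow> nat" where
  "slack t v u = (if u = t then 0 else 1) + (if u = v then 0 else 1)"

definition phi :: "nat set set \<Rightarrow> nat \<Rightarrow> nat \<Rightarrow> nat" where
  "phi H t v = (\<Sum>u<n. deg H u - slack t v u)"

text \<open>A step changes degree and slack only at its two ends, so the change of
  \<open>phi\<close> is decided there. The additive form with \<open>a\<close> and \<open>b\<close>
  copes with truncated subtraction.\<close>

lemma phi_mono:
  assumes "u < n" "v < n" "u \<noteq> v"
    and other: "\<And>w. w \<noteq> u \<Longrightarrow> w \<noteq> v \<Longrightarrow> deg H' w = deg H w"
    and le: "(deg H' v - slack t u v) + (deg H' u - slack t u u) + a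
           \<le> (deg H v - slack t v v) + (deg H u - slack t v u) + b"
  shows "phi H' t u + a \<le> phi H t v + b"
proof -
  have split: "(\<Sum>w<n. f w) = f v + (f u + (\<Sum>w\<in>{..<n} - {v} - {u}. f w))" for f :: "nat \<Rightarrow> nat"
    using assms by (subst sum.remove[of _ v], simp, simp, subst sum.remove[of _ u]) auto
  have rest: "(\<Sum>w\<in>{..<n} - {v} - {u}. deg H' w - slack t u w) = (\<Sum>w\<in>{..<n} - {v} - {u}. deg H w - slack t v w)"
    using other by (intro sum.cong) (auto simp: slack_def)
  show ?thesis
    unfolding phi_def split[of "\<lambda>w. deg H' w - slack t u w"] split[of "\<lambda>w. deg H w - slack t v w"] rest
    using le by linarith
qed

text \<open>\<open>q\<close> is charged per pending edge and \<open>Y\<close> per unit of excess.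
  The four terms of \<open>X\<close> are the four kinds of step: opening towards a fresh vertex;
  closing the only pending edge at \<open>v \<noteq> t\<close>, which is forced; opening towards one
  of at most \<open>2 * K + 1\<close> old vertices, which raises the excess by at most 2; and any
  other closing, which has up to \<open>K\<close> choices but lowers the excess. With
  \<open>q = 1 / sqrt n\<close> the first two kinds give the sharp
  \<open>2 * sqrt n\<close>.\<close>

lemma sharp_bound:
  assumes \<alpha>: "\<alpha> = 1" and \<beta>: "\<beta> = 0" and q: "q > 0" and Y: "Y \<ge> 1" and t: "t < n"
    and X: "X \<ge> real n * q + 1 / q + (2 * real K + 1) * (q * Y\<^sup>2) + real K / (q * Y)"
  shows "H \<subseteq> edges n \<Longrightarrow> v < n \<Longrightarrow> card H + l \<le> K \<Longrightarrow>
    norm (ev H (\<lambda>x. complex_of_real (mpow n (W x) l v t))) \<le> X ^ l * q ^ card H * Y ^ phi H t v"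
proof (induction l arbitrary: H v)
  case 0
  have "phi {} t t = 0" by (simp add: phi_def deg_def)
  then show ?case using ev_const[OF 0(1)] q Y by auto
next
  case (Suc l)
  let ?S = "{..<n} - {v}"
  let ?f = "\<lambda>u x. complex_of_real (mpow n (W x) l u t)"
  let ?B = "X ^ l * q ^ card H * Y ^ phi H t v"
  let ?old = "\<lambda>u. deg H u > 0 \<or> u = t"
  let ?cl = "if v \<noteq> t \<and> deg H v = 1 then 1 / q else 1 / (q * Y)"
  have fin: "finite H" using finite_edge_subset[OF Suc.prems(1)] .
  have "0 \<le> real n * q + 1 / q + (2 * real K + 1) * (q * Y\<^sup>2) + real K / (q * Y)"
    using q Y by (intro add_nonneg_nonneg mult_nonneg_nonneg divide_nonneg_nonneg) auto
  then have X0: "X \<ge> 0" using X by linarith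
  have B0: "?B \<ge> 0" using X0 q Y by simp
  have "norm (ev H (\<lambda>x. complex_of_real (mpow n (W x) (Suc l) v t))) =
     norm (ev H (\<lambda>x. \<Sum>u\<in>?S. complex_of_real (W x v u) * ?f u x))"
    unfolding mpow_W_rec ..
  also have "\<dots> \<le> (\<Sum>u\<in>?S. step H v u (?f u))"
    by (rule norm_ev_step[OF Suc.prems(1,2)]) simp
  also have "\<dots> \<le> (\<Sum>u\<in>?S. ?B * (q + (if ?old u then q * Y\<^sup>2 else 0) + (if {v, u} \<in> H then ?cl else 0)))"
  proof (rule sum_mono)
    fix u assume "u \<in> ?S"
    then have u: "u < n" "u \<noteq> v" by auto
    have e: "{v, u} \<in> edges n" using u Suc.prems(2) by (intro edgesI) auto
    show "(step H v u (?f u)) \<le>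
       ?B * (q + (if ?old u then q * Y\<^sup>2 else 0) + (if {v, u} \<in> H then ?cl else 0))"
    proof (cases "{v, u} \<in> H")
      case False
      let ?H = "insert {v, u} H"
      have d: "deg ?H w = deg H w + (if w = v \<or> w = u then 1 else 0)" for w
        using deg_insert[OF fin False, of w] by auto
      have IH: "norm (ev ?H (?f u)) \<le> X ^ l * q ^ card ?H * Y ^ phi ?H t u"
        using Suc.prems e fin u False by (intro Suc.IH) auto
      show ?thesis
      proof (cases "?old u")
        case True
        \<comment> \<open>At \<open>v\<close> the new edge is offset by one more unit of slack. At
          \<open>u\<close> the degree grows by one and the slack shrinks by one, hence the
          2.\<close>
        have "phi ?H t u + 0 \<le> phi H t v + 2"
          using Suc.prems(2) u by (intro phi_mono) (auto simp: d slack_def)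
        then have "Y ^ phi ?H t u \<le> Y ^ (phi H t v + 2)" using Y by (intro power_increasing) auto
        then have "X ^ l * q ^ card ?H * Y ^ phi ?H t u \<le> X ^ l * q ^ card ?H * Y ^ (phi H t v + 2)"
          using X0 q by (intro mult_left_mono) auto
        also have "\<dots> = ?B * (q * Y\<^sup>2)" using fin False by (simp add: power_add power2_eq_square mult_ac)
        also have "\<dots> \<le> ?B * (q + q * Y\<^sup>2)" using B0 q by (intro mult_left_mono) auto
        finally show ?thesis using IH True False by simp
      next
        case new: False
        \<comment> \<open>A fresh \<open>u \<noteq> t\<close> had degree 0, and its single new edge
          fits into the slack.\<close>
        have "phi ?H t u + 0 \<le> phi H t v + 0"
          using Suc.prems(2) u new by (intro phi_mono) (auto simp: d slack_def)
        then have "Y ^ phi ?H t u \<le> Y ^ phi H t v" using Y by (intro power_increasing) auto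
        then have "X ^ l * q ^ card ?H * Y ^ phi ?H t u \<le> X ^ l * q ^ card ?H * Y ^ phi H t v"
          using X0 q by (intro mult_left_mono) auto
        also have "\<dots> = ?B * q" using fin False by (simp add: mult_ac)
        finally show ?thesis using IH new False by simp
      qed
    next
      case True
      let ?H = "H - {{v, u}}"
      have d: "deg H w = deg ?H w + (if w = v \<or> w = u then 1 else 0)" for w
        using deg_remove[OF fin True, of w] by auto
      have c: "card H = Suc (card ?H)"
        using True fin card_Suc_Diff1 by metis
      have IH: "norm (ev ?H (?f u)) \<le> X ^ l * q ^ card ?H * Y ^ phi ?H t u"
        using Suc.prems c fin u by (intro Suc.IH) auto
      have "X ^ l * q ^ card ?H * Y ^ phi ?H t u \<le> ?B * ?cl"
      proof (cases "v \<noteq> t \<and> deg H v = 1")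
        case triv: True
        have "phi ?H t u + 0 \<le> phi H t v + 0"
          using Suc.prems(2) u triv by (intro phi_mono) (auto simp: d slack_def)
        then have "Y ^ phi ?H t u \<le> Y ^ phi H t v" using Y by (intro power_increasing) auto
        then have "X ^ l * q ^ card ?H * Y ^ phi ?H t u \<le> X ^ l * q ^ card ?H * Y ^ phi H t v"
          using X0 q by (intro mult_left_mono) auto
        also have "\<dots> = ?B * (1 / q)" using q by (simp add: c)
        finally show ?thesis using triv by simp
      next
        case crit: False
        have "deg H v = deg ?H v + 1" "deg H u = deg ?H u + 1" using d[of v] d[of u] by auto
        \<comment> \<open>Here \<open>v\<close> has positive excess: degree at least 1 and slack 0
          if \<open>v = t\<close>, degree at least 2 and slack 1 otherwise. Leaving along a pending
          edge lowers the degree and raises the slack at \<open>v\<close>; at \<open>u\<close> both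
          fall together.\<close>
        then have "phi ?H t u + 1 \<le> phi H t v + 0"
          using Suc.prems(2) u crit by (intro phi_mono) (auto simp: d slack_def)
        then have "Y ^ (phi ?H t u + 1) \<le> Y ^ phi H t v" using Y by (intro power_increasing) auto
        then have "X ^ l * q ^ card ?H * Y ^ phi ?H t u * Y \<le> X ^ l * q ^ card ?H * Y ^ phi H t v"
          using X0 q by (simp add: mult.assoc) (intro mult_left_mono, auto simp: mult_ac)
        then have "X ^ l * q ^ card ?H * Y ^ phi ?H t u \<le> ?B * (1 / (q * Y))"
          using q Y by (simp add: c field_simps)
        then show ?thesis using crit by auto
      qed
      also have "\<dots> \<le> ?B * (q + (if ?old u then q * Y\<^sup>2 else 0) + ?cl)"
        using B0 q Y by (intro mult_left_mono) auto
      finally show ?thesis using IH True \<alpha> \<beta> by simp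
    qed
  qed
  also have "\<dots> = ?B * (\<Sum>u\<in>?S. q + (if ?old u then q * Y\<^sup>2 else 0) + (if {v, u} \<in> H then ?cl else 0))"
    by (rule sum_distrib_left[symmetric])
  also have "\<dots> \<le> ?B * X"
  proof (rule mult_left_mono[OF _ B0])
    have old: "real (card {u \<in> ?S. ?old u}) \<le> 2 * real K + 1"
    proof -
      have "card {u \<in> ?S. ?old u} \<le> card (insert t {u. u < n \<and> deg H u > 0})"
        by (rule card_mono) auto
      also have "\<dots> \<le> Suc (card {u. u < n \<and> deg H u > 0})" by (rule card_insert_le_m1) auto
      also have "\<dots> \<le> Suc (2 * card H)" using card_endpoints[OF Suc.prems(1)] by simp
      also have "\<dots> \<le> 2 * K + 1" using Suc.prems(3) by simp
      finally show ?thesis by linarith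
    qed
    have nbd: "card {u \<in> ?S. {v, u} \<in> H} \<le> deg H v"
    proof -
      have "card {u \<in> ?S. {v, u} \<in> H} \<le> card {u. {v, u} \<in> H}"
        by (rule card_mono[OF card_neighbours(2)[OF fin]]) auto
      then show ?thesis using card_neighbours(1)[OF fin, of v] by linarith
    qed
    have cl: "real (card {u \<in> ?S. {v, u} \<in> H}) * ?cl \<le> 1 / q + real K / (q * Y)"
    proof (cases "v \<noteq> t \<and> deg H v = 1")
      case True
      then have "real (card {u \<in> ?S. {v, u} \<in> H}) \<le> 1" using nbd by simp
      then have "real (card {u \<in> ?S. {v, u} \<in> H}) * ?cl \<le> 1 * ?cl"
        using q Y by (intro mult_right_mono) auto
      also have "\<dots> \<le> 1 / q + real K / (q * Y)" using True q Y by simp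
      finally show ?thesis .
    next
      case False
      have "real (card {u \<in> ?S. {v, u} \<in> H}) \<le> real K"
        using nbd deg_le_card[OF fin, of v] Suc.prems(3) by linarith
      then have 1: "real (card {u \<in> ?S. {v, u} \<in> H}) * (1 / (q * Y)) \<le> real K * (1 / (q * Y))"
        using q Y by (intro mult_right_mono) auto
      have eq: "?cl = 1 / (q * Y)" using False by auto
      have 2: "real K / (q * Y) = real K * (1 / (q * Y))" by simp
      have 3: "1 / q \<ge> 0" using q by simp
      show ?thesis unfolding eq 2 using 1 3 by linarith
    qed
    have "(\<Sum>u\<in>?S. q + (if ?old u then q * Y\<^sup>2 else 0) + (if {v, u} \<in> H then ?cl else 0))
       = real (card ?S) * q + real (card {u \<in> ?S. ?old u}) * (q * Y\<^sup>2) + real (card {u \<in> ?S. {v, u} \<in> H}) * ?cl"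
      unfolding sum.distrib by (simp add: sum.If_cases Int_def)
    also have "\<dots> \<le> real n * q + (2 * real K + 1) * (q * Y\<^sup>2) + (1 / q + real K / (q * Y))"
    proof (intro add_mono mult_right_mono cl old)
      show "real (card ?S) \<le> real n" using card_mono[of "{..<n}" ?S] by auto
    qed (use q in auto)
    finally show "(\<Sum>u\<in>?S. q + (if ?old u then q * Y\<^sup>2 else 0) + (if {v, u} \<in> H then ?cl else 0)) \<le> X"
      using X by linarith
  qed
  finally show ?case by (simp add: mult_ac)
qed

text \<open>For \<open>\<beta> = 0\<close> a step toggles one edge, so \<open>l\<close> further
  steps cannot close more than \<open>l\<close> pending edges.\<close>

lemma ev_nb_eq_0:
  assumes \<beta>: "\<beta> = 0"
  shows "H \<subseteq> edges n \<Longrightarrow> v < n \<Longrightarrow> card H > l \<Longrightarrow> ev H (\<lambda>x. nb n (W x) w l p v) = 0"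
proof (induction l arbitrary: H v p)
  case 0
  then have "H \<noteq> {}" by auto
  with 0 show ?case by (simp add: ev_const)
next
  case (Suc l)
  have fin: "finite H" using finite_edge_subset[OF Suc.prems(1)] .
  have "norm (ev H (\<lambda>x. nb n (W x) w (Suc l) p v)) \<le>
    (\<Sum>u\<in>{..<n} - {v, p}. step H v u (\<lambda>x. nb n (W x) w l v u))"
    unfolding nb.simps by (rule norm_ev_step[OF Suc.prems(1,2)]) auto
  also have "\<dots> = (\<Sum>u\<in>{..<n} - {v, p}. 0)"
  proof (rule sum.cong[OF refl])
    fix u assume u: "u \<in> {..<n} - {v, p}"
    have e: "{v, u} \<in> edges n" using u Suc.prems(2) by (intro edgesI) auto
    show "(step H v u (\<lambda>x. nb n (W x) w l v u)) = 0"
    proof (cases "{v, u} \<in> H")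
      case True
      then have "ev (H - {{v, u}}) (\<lambda>x. nb n (W x) w l v u) = 0"
        using Suc.prems u fin by (intro Suc.IH) (auto simp: card_Diff_singleton)
      with True \<beta> show ?thesis by simp
    next
      case False
      then have "ev (insert {v, u} H) (\<lambda>x. nb n (W x) w l v u) = 0"
        using Suc.prems e u fin by (intro Suc.IH) auto
      with False show ?thesis by simp
    qed
  qed
  finally show ?case by simp
qed

text \<open>Equality leaves no step to spare: already the first one has to close an edge at
  \<open>v\<close>.\<close>

lemma ev_nb_eq_0':
  assumes \<beta>: "\<beta> = 0" and H: "H \<subseteq> edges n" "v < n" "card H = l" "l \<ge> 1" "deg H v = 0"
  shows "ev H (\<lambda>x. nb n (W x) w l p v) = 0"
proof -
  obtain k where l: "l = Suc k" using H(4) by (cases l) auto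
  have fin: "finite H" using finite_edge_subset[OF H(1)] .
  have out: "{v, u} \<notin> H" for u
    using H(5) fin by (auto simp: deg_def)
  have "norm (ev H (\<lambda>x. nb n (W x) w (Suc k) p v)) \<le>
    (\<Sum>u\<in>{..<n} - {v, p}. step H v u (\<lambda>x. nb n (W x) w k v u))"
    unfolding nb.simps by (rule norm_ev_step[OF H(1,2)]) auto
  also have "\<dots> = (\<Sum>u\<in>{..<n} - {v, p}. 0)"
  proof (rule sum.cong[OF refl])
    fix u assume u: "u \<in> {..<n} - {v, p}"
    have e: "{v, u} \<in> edges n" using u H(2) by (intro edgesI) auto
    have "ev (insert {v, u} H) (\<lambda>x. nb n (W x) w k v u) = 0"
      using H e u fin out[of u] l by (intro ev_nb_eq_0[OF \<beta>]) auto
    then show "(step H v u (\<lambda>x. nb n (W x) w k v u)) = 0"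
      using out by simp
  qed
  finally show ?thesis by (simp add: l)
qed

end

context edge_chaos
begin

text \<open>Two walks of length \<open>m\<close> together have to use every edge an even number of
  times. Crude counting gives order \<open>n^m\<close>. The additional \<open>1 / n\<close> has two
  sources: either the first walk has \<open>m\<close> distinct edges, and the second must start at
  one of their at most \<open>2 * m\<close> endpoints; or the first walk meets its own vertices, and
  some step has at most \<open>2 * m\<close> targets instead of \<open>n\<close>.\<close>

lemma nb_second_moment:
  fixes w z :: "nat \<Rightarrow> complex"
  assumes \<alpha>: "\<alpha> = 1" and \<beta>: "\<beta> = 0" and n: "n > 0" and m: "m \<ge> 1"
    and w: "\<And>v. v < n \<Longrightarrow> norm (w v) \<le> 1 / sqrt (real n)"
    and z: "\<And>v. v < n \<Longrightarrow> norm (z v) \<le> 1 / sqrt (real n)"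
  shows "measure_pmf.expectation M (\<lambda>x. (norm (\<Sum>a<n. cnj (z a) * nb n (W x) w m a a))\<^sup>2)
    \<le> nb_const m * real n ^ m / real n"
proof -
  define r where "r = sqrt (real n)"
  define X where "X = (1 + 2 * real m) * r"
  \<comment> \<open>The cost of meeting an old vertex in \<open>B3\<close>: \<open>2 * m\<close>
    targets times the crude constant. Each step of the induction there adds one such term, which
    accounts for the factor \<open>l + 1\<close>.\<close>
  define D where "D = 2 * real m * (1 + 2 * real m) ^ (2 * m)"
  have r: "r > 0" "r * r = real n" "r \<noteq> 0" using n by (auto simp: r_def)
  have n_div: "real n / r = r" using r by (simp flip: r(2))
  have qq: "(1 / r) * (1 / r) = 1 / real n" by (simp add: r(2))
  have Xq: "X * (1 / r) = 1 + 2 * real m" using r by (simp add: X_def)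
  have X_pos: "X > 0" using r by (simp add: X_def)
  have D0: "D \<ge> 0" by (simp add: D_def)
  let ?q = "1 / r"
  define F where "F = (\<lambda>x. \<Sum>a<n. cnj (z a) * nb n (W x) w m a a)"
  have cnj_F: "cnj (F x) = (\<Sum>a<n. z a * nb n (W x) (\<lambda>v. cnj (w v)) m a a)" for x
    by (simp add: F_def cnj_nb)
  have ev_F: "ev H (\<lambda>x. cnj (F x)) = (\<Sum>a<n. z a * ev H (\<lambda>x. nb n (W x) (\<lambda>v. cnj (w v)) m a a))" for H
    unfolding cnj_F ev_sum by (simp add: ev_cmult)
  have bound: "norm (ev H (\<lambda>x. nb n (W x) (\<lambda>v. cnj (w v)) m a a)) \<le> ?q * X ^ m * ?q ^ card H"
    if "H \<subseteq> edges n" "a < n" "card H \<le> m" for H a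
  proof (rule crude_bound[where K = "2 * m" and S = "\<lambda>p v. {..<n} - {v, p}" and p = a
        and f = "\<lambda>l p v x. nb n (W x) (\<lambda>v. cnj (w v)) l p v"])
    show "norm (ev H' (\<lambda>x. nb n (W x) (\<lambda>v. cnj (w v)) 0 p v)) \<le> ?q * ?q ^ card H'"
      if "H' \<subseteq> edges n" "v < n" for H' p v
      using w[OF that(2)] r by (auto simp: ev_const[OF that(1)] r_def)
    show "real n * ?q + real (2 * m) * (\<alpha> / ?q + \<beta>) \<le> X"
      using n_div by (simp add: \<alpha> \<beta> X_def algebra_simps)
  qed (use that r in auto)
  have zmul: "norm (z a * c) \<le> ?q * b" "norm (cnj (z a) * c) \<le> ?q * b" if "a < n" "norm c \<le> b" for a c b
  proof -
    have "norm (z a) * norm c \<le> ?q * b"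
    proof (rule mult_mono)
      show "norm (z a) \<le> ?q" using z[OF that(1)] by (simp add: r_def)
    qed (use that(2) r in auto)
    then show "norm (z a * c) \<le> ?q * b" "norm (cnj (z a) * c) \<le> ?q * b"
      by (simp_all only: norm_mult complex_mod_cnj)
  qed
  have J: "norm (ev H (\<lambda>x. cnj (F x))) \<le> X ^ m * ?q ^ card H" if "H \<subseteq> edges n" "card H \<le> m" for H
  proof -
    have "norm (ev H (\<lambda>x. cnj (F x))) \<le> (\<Sum>a<n. ?q * (?q * X ^ m * ?q ^ card H))"
      unfolding ev_F by (rule sum_norm_le, rule zmul(1)) (use bound[OF that(1) _ that(2)] in auto)
    also have "\<dots> = X ^ m * ?q ^ card H * (real n / (r * r))" by simp
    also have "\<dots> = X ^ m * ?q ^ card H" using r n by simp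
    finally show ?thesis .
  qed
  have J': "norm (ev H (\<lambda>x. cnj (F x))) \<le> D / real n" if H: "H \<subseteq> edges n" "card H = m" for H
  proof -
    let ?E = "{a. a < n \<and> deg H a > 0}"
    \<comment> \<open>With \<open>card H = m\<close> every step must close an edge, so only starting
      points on \<open>H\<close> contribute, \<open>2 * m\<close> of them instead of
      \<open>n\<close>.\<close>
    have eq: "ev H (\<lambda>x. cnj (F x)) = (\<Sum>a\<in>?E. z a * ev H (\<lambda>x. nb n (W x) (\<lambda>v. cnj (w v)) m a a))"
      unfolding ev_F using m H by (intro sum.mono_neutral_right) (auto simp: ev_nb_eq_0'[OF \<beta>])
    have "norm (ev H (\<lambda>x. cnj (F x))) \<le> (\<Sum>a\<in>?E. ?q * (?q * X ^ m * ?q ^ m))"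
      unfolding eq
    proof (rule sum_norm_le, rule zmul(1))
      fix a assume a: "a \<in> ?E"
      then show "a < n" by simp
      have "card H \<le> m" using H(2) by simp
      from bound[OF H(1) \<open>a < n\<close> this]
      show "norm (ev H (\<lambda>x. nb n (W x) (\<lambda>v. cnj (w v)) m a a)) \<le> ?q * X ^ m * ?q ^ m"
        unfolding H(2) .
    qed
    also have "\<dots> = real (card ?E) * ((X * ?q) ^ m * (?q * ?q))"
      by (simp only: sum_constant power_mult_distrib mult_ac)
    also have "\<dots> = real (card ?E) * (1 + 2 * real m) ^ m / real n"
      unfolding qq Xq by simp
    also have "\<dots> \<le> (2 * real m) * (1 + 2 * real m) ^ (2 * m) / real n"
    proof (intro divide_right_mono mult_mono)
      show "real (card ?E) \<le> 2 * real m" using card_endpoints[OF H(1)] H(2) by simp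
      show "(1 + 2 * real m) ^ m \<le> (1 + 2 * real m) ^ (2 * m)" by (intro power_increasing) auto
    qed auto
    finally show ?thesis by (simp add: D_def)
  qed
  have rec: "nb n (W x) w (Suc l) p v * cnj (F x) =
      (\<Sum>u\<in>{..<n} - {v, p}. complex_of_real (W x v u) * (nb n (W x) w l v u * cnj (F x)))" for l p v x
    by (simp add: sum_distrib_right mult.assoc)
  have base: "norm (ev H (\<lambda>x. nb n (W x) w 0 p v * cnj (F x))) \<le> ?q * b"
    if "v < n" "norm (ev H (\<lambda>x. cnj (F x))) \<le> b" for H p v b
    unfolding nb.simps ev_cmult norm_mult
    using w[OF that(1)] that(2) r by (intro mult_mono) (auto simp: r_def)
  \<comment> \<open>Concatenation of the walks: the base case for the first one is the bound
    \<open>J\<close> for the second.\<close>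
  have B2: "norm (ev H (\<lambda>x. nb n (W x) w l p v * cnj (F x))) \<le> (?q * X ^ m) * X ^ l * ?q ^ card H"
    if "H \<subseteq> edges n" "v < n" "card H + l \<le> m" for H l p v
  proof (rule crude_bound[where K = m and S = "\<lambda>p v. {..<n} - {v, p}" and p = p
        and f = "\<lambda>l p v x. nb n (W x) w l p v * cnj (F x)"])
    show "norm (ev H' (\<lambda>x. nb n (W x) w 0 p v * cnj (F x))) \<le> ?q * X ^ m * ?q ^ card H'"
      if "H' \<subseteq> edges n" "v < n" "card H' \<le> m" for H' p v
      using base[OF that(2) J[OF that(1,3)]] by simp
    show "real n * ?q + real m * (\<alpha> / ?q + \<beta>) \<le> X"
      using n_div r by (simp add: \<alpha> \<beta> X_def algebra_simps)
    show "\<And>l p v x. nb n (W x) w (Suc l) p v * cnj (F x) =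
      (\<Sum>u\<in>{..<n} - {v, p}. complex_of_real (W x v u) * (nb n (W x) w l v u * cnj (F x)))"
      by (rule rec)
  qed (use that r X_pos in auto)
  \<comment> \<open>Until the first walk meets one of its own vertices it cannot traverse an edge twice,
    because the only odd edge at its current vertex is the one it must not backtrack along.\<close>
  have B3: "norm (ev H (\<lambda>x. nb n (W x) w l p v * cnj (F x))) \<le> ?q * (D * (real l + 1) * real n ^ l / real n)"
    if "H \<subseteq> edges n" "v < n" "card H + l = m" "\<And>e. e \<in> H \<Longrightarrow> v \<in> e \<Longrightarrow> e = {v, p}" for H l p v
    using that
  proof (induction l arbitrary: H p v)
    case 0
    then show ?case using base[OF 0(2) J'[OF 0(1)]] by simp
  next
    case (Suc l)
    have fin: "finite H" using finite_edge_subset[OF Suc.prems(1)] .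
    let ?S = "{..<n} - {v, p}"
    let ?old = "{u. u < n \<and> deg H u > 0}"
    let ?a = "?q * (D * (real l + 1) * real n ^ l / real n)"
    let ?b = "?q * ((1 + 2 * real m) ^ (2 * m) * real n ^ l)"
    have "norm (ev H (\<lambda>x. nb n (W x) w (Suc l) p v * cnj (F x))) \<le>
      (\<Sum>u\<in>?S. step H v u (\<lambda>x. nb n (W x) w l v u * cnj (F x)))"
      unfolding rec by (rule norm_ev_step[OF Suc.prems(1,2)]) auto
    also have "\<dots> \<le> (\<Sum>u\<in>?S. ?a + (if u \<in> ?old then ?b else 0))"
    proof (rule sum_mono)
      fix u assume u: "u \<in> ?S"
      have e: "{v, u} \<in> edges n" using u Suc.prems(2) by (intro edgesI) auto
      have notin: "{v, u} \<notin> H"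
        using Suc.prems(4)[of "{v, u}"] u by (auto simp: doubleton_eq_iff)
      have c: "card (insert {v, u} H) = Suc (card H)" using notin fin by simp
      have sub: "insert {v, u} H \<subseteq> edges n" using e Suc.prems(1) by simp
      have "norm (ev (insert {v, u} H) (\<lambda>x. nb n (W x) w l v u * cnj (F x))) \<le> ?a + (if u \<in> ?old then ?b else 0)"
      proof (cases "u \<in> ?old")
        case False
        then have "\<And>e. e \<in> H \<Longrightarrow> u \<notin> e" using u fin by (auto simp: deg_def)
        then have "norm (ev (insert {v, u} H) (\<lambda>x. nb n (W x) w l v u * cnj (F x))) \<le> ?a"
          using Suc.prems(3) c u by (intro Suc.IH[OF sub]) auto
        then show ?thesis unfolding if_not_P[OF False] by simp
      next
        case True
        have l: "l = m - Suc (card H)" "Suc (card H) \<le> m" using Suc.prems(3) by auto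
        have "norm (ev (insert {v, u} H) (\<lambda>x. nb n (W x) w l v u * cnj (F x)))
            \<le> (?q * X ^ m) * X ^ l * ?q ^ card (insert {v, u} H)"
          using Suc.prems(3) c u by (intro B2[OF sub]) auto
        also have "\<dots> = ?q * ((1 + 2 * real m) ^ (m + l) * (r ^ (m + l) * ?q ^ (Suc (card H))))"
          by (simp add: c X_def power_mult_distrib power_add mult_ac)
        also have "r ^ (m + l) * ?q ^ (Suc (card H)) = r ^ (2 * l)"
        proof -
          have "m + l = 2 * l + Suc (card H)" using l by simp
          then have "r ^ (m + l) = r ^ (2 * l) * r ^ Suc (card H)" by (simp only: power_add)
          then show ?thesis using r by (simp add: power_one_over)
        qed
        also have "r ^ (2 * l) = real n ^ l"
          by (simp add: power_mult power2_eq_square r(2))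
        also have "?q * ((1 + 2 * real m) ^ (m + l) * real n ^ l) \<le> ?b"
          using r l by (intro mult_left_mono mult_right_mono power_increasing) auto
        also have "\<dots> \<le> ?a + ?b" using r D0 by simp
        finally show ?thesis unfolding if_P[OF True] .
      qed
      then show "(step H v u (\<lambda>x. nb n (W x) w l v u * cnj (F x))) \<le> ?a + (if u \<in> ?old then ?b else 0)"
        using notin by simp
    qed
    also have "\<dots> = real (card ?S) * ?a + real (card (?S \<inter> ?old)) * ?b"
    proof -
      have "(\<Sum>u\<in>?S. if u \<in> ?old then ?b else 0) = real (card (?S \<inter> ?old)) * ?b"
        by (subst sum.inter_restrict[symmetric]) simp_all
      then show ?thesis unfolding sum.distrib sum_constant by (simp only:)
    qed
    also have "\<dots> \<le> real n * ?a + (2 * real m) * ?b"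
    proof (intro add_mono mult_right_mono)
      show "real (card ?S) \<le> real n" using card_mono[of "{..<n}" ?S] by auto
      have "card (?S \<inter> ?old) \<le> card ?old" by (rule card_mono) auto
      also have "\<dots> \<le> 2 * m" using card_endpoints[OF Suc.prems(1)] Suc.prems(3) by simp
      finally show "real (card (?S \<inter> ?old)) \<le> 2 * real m" by linarith
    qed (use r D0 in auto)
    also have "\<dots> = ?q * (D * (real (Suc l) + 1) * real n ^ Suc l / real n)"
      using n r by (simp add: D_def field_simps)
    finally show ?case .
  qed
  have "complex_of_real (measure_pmf.expectation M (\<lambda>x. (norm (F x))\<^sup>2)) = ev {} (\<lambda>x. F x * cnj (F x))"
    unfolding ev_def by (simp only: prod.empty of_real_1 mult_1_left complex_norm_square[symmetric] integral_complex_of_real)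
  also have "\<dots> = (\<Sum>a<n. cnj (z a) * ev {} (\<lambda>x. nb n (W x) w m a a * cnj (F x)))"
  proof -
    have "ev {} (\<lambda>x. F x * cnj (F x)) = ev {} (\<lambda>x. \<Sum>a<n. cnj (z a) * (nb n (W x) w m a a * cnj (F x)))"
      by (subst F_def) (simp add: sum_distrib_right mult.assoc)
    then show ?thesis by (simp add: ev_sum ev_cmult)
  qed
  finally have eq: "complex_of_real (measure_pmf.expectation M (\<lambda>x. (norm (F x))\<^sup>2)) =
      (\<Sum>a<n. cnj (z a) * ev {} (\<lambda>x. nb n (W x) w m a a * cnj (F x)))" .
  have "norm (complex_of_real (measure_pmf.expectation M (\<lambda>x. (norm (F x))\<^sup>2)))
      \<le> (\<Sum>a<n. ?q * (?q * (D * (real m + 1) * real n ^ m / real n)))"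
    unfolding eq by (rule sum_norm_le, rule zmul(2)) (use B3[of "{}" _ m] in auto)
  also have "\<dots> = (real n / (r * r)) * (D * (real m + 1) * real n ^ m / real n)"
    by simp
  also have "\<dots> = D * (real m + 1) * real n ^ m / real n" using r n by simp
  finally have "measure_pmf.expectation M (\<lambda>x. (norm (F x))\<^sup>2) \<le> D * (real m + 1) * real n ^ m / real n"
    by simp
  then show ?thesis by (simp only: F_def D_def)
qed

end

section \<open>Quadratic forms\<close>

definition ip :: "nat \<Rightarrow> (nat \<Rightarrow> complex) \<Rightarrow> (nat \<Rightarrow> complex) \<Rightarrow> complex" where
  "ip n x y = (\<Sum>i<n. cnj (x i) * y i)"

definition mv :: "nat \<Rightarrow> (nat \<Rightarrow> nat \<Rightarrow> complex) \<Rightarrow> (nat \<Rightarrow> complex) \<Rightarrow> nat \<Rightarrow> complex" where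
  "mv n A x i = (\<Sum>j<n. A i j * x j)"

definition qn :: "nat \<Rightarrow> (nat \<Rightarrow> complex) \<Rightarrow> real" where
  "qn n x = (\<Sum>i<n. (cmod (x i))\<^sup>2)"

definition form :: "nat \<Rightarrow> (nat \<Rightarrow> nat \<Rightarrow> complex) \<Rightarrow> (nat \<Rightarrow> complex) \<Rightarrow> real" where
  "form n A x = Re (ip n x (mv n A x))"

definition herm :: "nat \<Rightarrow> (nat \<Rightarrow> nat \<Rightarrow> complex) \<Rightarrow> bool" where
  "herm n A \<longleftrightarrow> (\<forall>i<n. \<forall>j<n. A i j = cnj (A j i))"

lemma hermD: "herm n A \<Longrightarrow> i < n \<Longrightarrow> j < n \<Longrightarrow> A i j = cnj (A j i)"
  unfolding herm_def by blast

lemma ip_add_right: "ip n x (\<lambda>i. y i + z i) = ip n x y + ip n x z"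
  by (simp add: ip_def sum.distrib distrib_left)

lemma ip_add_left: "ip n (\<lambda>i. x i + y i) z = ip n x z + ip n y z"
  by (simp add: ip_def sum.distrib distrib_right)

lemma ip_diff_right: "ip n x (\<lambda>i. y i - z i) = ip n x y - ip n x z"
  by (simp add: ip_def sum_subtractf right_diff_distrib)

lemma ip_diff_left: "ip n (\<lambda>i. x i - y i) z = ip n x z - ip n y z"
  by (simp add: ip_def sum_subtractf left_diff_distrib)

lemma ip_scale_right: "ip n x (\<lambda>i. c * y i) = c * ip n x y"
  by (simp add: ip_def sum_distrib_left mult_ac)

lemma ip_scale_left: "ip n (\<lambda>i. c * x i) y = cnj c * ip n x y"
  by (simp add: ip_def sum_distrib_left mult_ac)

lemma ip_sum_right: "ip n x (\<lambda>i. \<Sum>k\<in>S. y k i) = (\<Sum>k\<in>S. ip n x (y k))"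
  unfolding ip_def sum_distrib_left by (rule sum.swap)

lemma ip_sum_left: "ip n (\<lambda>i. \<Sum>k\<in>S. x k i) y = (\<Sum>k\<in>S. ip n (x k) y)"
  unfolding ip_def cnj_sum sum_distrib_right by (rule sum.swap)

lemma ip_commute: "ip n y x = cnj (ip n x y)"
  by (simp add: ip_def mult.commute)

lemma ip_self: "ip n x x = complex_of_real (qn n x)"
  by (simp only: ip_def qn_def of_real_sum complex_norm_square mult.commute)

lemma qn_nonneg: "qn n x \<ge> 0"
  by (simp add: qn_def sum_nonneg)

lemma ip_cong: "(\<And>i. i < n \<Longrightarrow> x i = x' i) \<Longrightarrow> (\<And>i. i < n \<Longrightarrow> y i = y' i) \<Longrightarrow> ip n x y = ip n x' y'"
  unfolding ip_def by (intro sum.cong) auto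

lemma cauchy_schwarz: "(cmod (ip n x y))\<^sup>2 \<le> qn n x * qn n y"
proof -
  have "cmod (ip n x y) \<le> (\<Sum>i<n. cmod (x i) * cmod (y i))"
    unfolding ip_def by (rule sum_norm_le) (simp add: norm_mult)
  then have "(cmod (ip n x y))\<^sup>2 \<le> (\<Sum>i<n. cmod (x i) * cmod (y i))\<^sup>2"
    by (intro power_mono) auto
  also have "\<dots> \<le> qn n x * qn n y"
    unfolding qn_def by (rule Cauchy_Schwarz_ineq_sum)
  finally show ?thesis .
qed

lemma mv_diff: "mv n A (\<lambda>i. x i - y i) = (\<lambda>i. mv n A x i - mv n A y i)"
  by (simp add: fun_eq_iff mv_def sum_subtractf right_diff_distrib)

lemma mv_scale: "mv n A (\<lambda>i. c * x i) = (\<lambda>i. c * mv n A x i)"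
  by (simp add: fun_eq_iff mv_def sum_distrib_left mult_ac)

lemma mv_sum: "mv n A (\<lambda>i. \<Sum>k\<in>S. x k i) = (\<lambda>i. \<Sum>k\<in>S. mv n A (x k) i)"
  unfolding mv_def sum_distrib_left by (rule ext, rule sum.swap)

lemma herm_ip:
  assumes "herm n A"
  shows "ip n x (mv n A y) = ip n (mv n A x) y"
proof -
  have "ip n x (mv n A y) = (\<Sum>i<n. \<Sum>j<n. cnj (x i) * A i j * y j)"
    by (simp add: ip_def mv_def sum_distrib_left mult.assoc)
  also have "\<dots> = (\<Sum>j<n. \<Sum>i<n. cnj (x i) * A i j * y j)"
    by (rule sum.swap)
  also have "\<dots> = (\<Sum>j<n. \<Sum>i<n. cnj (A j i * x i) * y j)"
  proof (intro sum.cong refl)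
    fix j i assume "j \<in> {..<n}" "i \<in> {..<n}"
    then have "i < n" "j < n" by simp_all
    then have "cnj (A j i) = A i j" by (rule hermD[OF assms, symmetric])
    then show "cnj (x i) * A i j * y j = cnj (A j i * x i) * y j" by (simp add: mult_ac)
  qed
  also have "\<dots> = ip n (mv n A x) y"
    by (simp add: ip_def mv_def sum_distrib_right)
  finally show ?thesis .
qed

lemma form_add: "form n (\<lambda>i j. A i j + B i j) x = form n A x + form n B x"
proof -
  have "mv n (\<lambda>i j. A i j + B i j) x = (\<lambda>i. mv n A x i + mv n B x i)"
    by (simp add: fun_eq_iff mv_def sum.distrib distrib_right)
  then show ?thesis by (simp add: form_def ip_add_right)
qed

lemma form_scale_mat: "form n (\<lambda>i j. complex_of_real c * A i j) x = c * form n A x"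
proof -
  have "mv n (\<lambda>i j. complex_of_real c * A i j) x = (\<lambda>i. complex_of_real c * mv n A x i)"
    by (simp add: fun_eq_iff mv_def sum_distrib_left mult_ac)
  then show ?thesis by (simp add: form_def ip_scale_right)
qed

lemma form_scale: "form n A (\<lambda>i. c * x i) = (cmod c)\<^sup>2 * form n A x"
proof -
  have 1: "cnj c * (c * z) = complex_of_real ((cmod c)\<^sup>2) * z" for z
    by (simp only: complex_norm_square) (simp add: mult_ac)
  have 2: "Re (complex_of_real a * z) = a * Re z" for a z by simp
  show ?thesis
    by (simp only: form_def mv_scale ip_scale_left ip_scale_right 1 2)
qed

lemma qn_scale: "qn n (\<lambda>i. c * x i) = (cmod c)\<^sup>2 * qn n x"
  by (simp add: qn_def norm_mult power_mult_distrib sum_distrib_left)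

lemma form_cong: "(\<And>i j. i < n \<Longrightarrow> j < n \<Longrightarrow> A i j = B i j) \<Longrightarrow> (\<And>i. i < n \<Longrightarrow> x i = y i) \<Longrightarrow> form n A x = form n B y"
  unfolding form_def by (intro arg_cong[where f = Re] ip_cong) (auto simp: mv_def)

lemma qn_cong: "(\<And>i. i < n \<Longrightarrow> x i = y i) \<Longrightarrow> qn n x = qn n y"
  unfolding qn_def by (intro sum.cong) auto

lemma form_eigenvector:
  assumes "\<And>i. i < n \<Longrightarrow> mv n A v i = complex_of_real l * v i"
  shows "form n A v = l * qn n v"
proof -
  have "ip n v (mv n A v) = ip n v (\<lambda>i. complex_of_real l * v i)"
    using assms by (intro ip_cong) auto
  then show ?thesis by (simp add: form_def ip_scale_right ip_self)
qed

text \<open>Vectors are functions on all naturals; pinning the entries from \<open>n\<close> on to 0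
  places the sphere inside a product of compact sets, and Tychonoff's theorem applies.\<close>

lemma compact_unit_sphere:
  "compact {v. (\<forall>i\<ge>n. v i = 0) \<and> qn n v = 1}"
proof -
  let ?B = "\<lambda>i. if i < n then cball 0 1 else {0 :: complex}"
  have coord: "continuous_on UNIV (\<lambda>v :: nat \<Rightarrow> complex. v i)" for i
    by (rule continuous_on_product_coordinates)
  have "compactin (product_topology (\<lambda>i. euclidean) UNIV) (PiE UNIV ?B)"
    unfolding compactin_PiE by auto
  then have K: "compact (PiE UNIV ?B)"
    by (simp add: euclidean_product_topology)
  have "continuous_on UNIV (qn n)"
    unfolding qn_def by (intro continuous_intros coord)
  then have "closed {v. qn n v = 1}"
    by (rule closed_Collect_eq) (rule continuous_on_const)
  with K have "compact (PiE UNIV ?B \<inter> {v. qn n v = 1})"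
    by (rule compact_Int_closed)
  also have "PiE UNIV ?B \<inter> {v. qn n v = 1} = {v. (\<forall>i\<ge>n. v i = 0) \<and> qn n v = 1}"
  proof -
    have "cmod (v i) \<le> 1" if "qn n v = 1" "i < n" for v i
    proof -
      have "(cmod (v i))\<^sup>2 \<le> qn n v"
        unfolding qn_def using that(2) by (intro member_le_sum) auto
      with that(1) show ?thesis using power2_le_imp_le[of "cmod (v i)" 1] by simp
    qed
    then show ?thesis by (auto simp: PiE_iff not_less split: if_splits)
  qed
  finally show ?thesis .
qed

text \<open>Rayleigh's principle: a maximiser of the form on the unit sphere exists by compactness,
  and it is an eigenvector because the first variation vanishes there.\<close>

lemma max_eigenvector:
  assumes A: "herm n A" and n: "n > 0"
  obtains l v where "qn n v = 1" "\<And>i. i < n \<Longrightarrow> mv n A v i = complex_of_real l * v i"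
    "\<And>x. form n A x \<le> l * qn n x"
proof -
  define S where "S = {v. (\<forall>i\<ge>n. v i = 0) \<and> qn n v = 1}"
  have S_iff: "v \<in> S \<longleftrightarrow> (\<forall>i\<ge>n. v i = 0) \<and> qn n v = 1" for v by (simp add: S_def)
  define e where "e i = (if i = 0 then 1 else 0 :: complex)" for i :: nat
  have "qn n e = (\<Sum>i<n. if i = 0 then 1 else 0)"
    unfolding qn_def e_def by (intro sum.cong) auto
  also have "\<dots> = 1" using n by (subst sum.delta) auto
  finally have "e \<in> S"
    using n by (auto simp: S_iff e_def)
  then have ne: "S \<noteq> {}" by blast
  have coord: "continuous_on UNIV (\<lambda>v :: nat \<Rightarrow> complex. v i)" for i
    by (rule continuous_on_product_coordinates)
  have "continuous_on UNIV (\<lambda>v. form n A v)"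
    unfolding form_def ip_def mv_def
    by (intro continuous_on_Re continuous_on_sum continuous_on_mult continuous_on_cnj continuous_on_const coord)
  then have "continuous_on S (form n A)"
    by (rule continuous_on_subset) simp
  from continuous_attains_sup[OF compact_unit_sphere[of n, folded S_def] ne this]
  obtain v where v: "v \<in> S" and max': "\<forall>x\<in>S. form n A x \<le> form n A v" ..
  note max = bspec[OF max']
  define l where "l = form n A v"
  have le: "form n A x \<le> l * qn n x" for x
  proof (cases "qn n x = 0")
    case True
    then have "\<forall>i<n. x i = 0" by (auto simp: qn_def sum_nonneg_eq_0_iff)
    then have "form n A x = form n A (\<lambda>i. 0)" by (intro form_cong) auto
    with True show ?thesis by (simp add: form_def ip_def)
  next
    case False
    then have pos: "qn n x > 0" using qn_nonneg[of n x] by linarith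
    define c where "c = complex_of_real (1 / sqrt (qn n x))"
    define y where "y i = (if i < n then c * x i else 0)" for i
    have c: "(cmod c)\<^sup>2 = 1 / qn n x" using pos by (simp add: c_def norm_divide power_divide)
    have "qn n y = qn n (\<lambda>i. c * x i)" by (rule qn_cong) (simp add: y_def)
    then have "y \<in> S" using pos by (simp add: qn_scale c S_iff y_def)
    from max[OF this] have "form n A y \<le> l" by (simp add: l_def)
    also have "form n A y = form n A (\<lambda>i. c * x i)" by (rule form_cong) (auto simp: y_def)
    finally have "form n A x / qn n x \<le> l" by (simp add: form_scale c)
    with pos show ?thesis by (simp add: pos_divide_le_eq)
  qed
  define g where "g i = complex_of_real l * v i - mv n A v i" for i
  define q where "q x = l * qn n x - form n A x" for x
  have q0: "q x \<ge> 0" for x using le[of x] by (simp add: q_def)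
  have q_eq: "q x = Re (ip n x (\<lambda>i. complex_of_real l * x i - mv n A x i))" for x
    by (simp add: q_def form_def ip_diff_right ip_scale_right ip_self)
  \<comment> \<open>The nonnegative form \<open>q\<close> vanishes at \<open>v\<close>; its first variation there is \<open>-2 |g|^2\<close>.\<close>
  have var: "2 * qn n g \<le> t * q g" if t: "t > 0" for t
  proof -
    define x where "x i = v i - complex_of_real t * g i" for i
    define h where "h i = complex_of_real l * g i - mv n A g i" for i
    have "mv n A x = (\<lambda>i. mv n A v i - complex_of_real t * mv n A g i)"
      unfolding x_def[abs_def] by (simp only: mv_diff mv_scale)
    then have "(\<lambda>i. complex_of_real l * x i - mv n A x i) = (\<lambda>i. g i - complex_of_real t * h i)"
      by (simp add: fun_eq_iff x_def g_def h_def algebra_simps)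
    then have qx: "q x = Re (ip n x (\<lambda>i. g i - complex_of_real t * h i))"
      by (simp only: q_eq)
    have x_eq: "ip n x y = ip n v y - complex_of_real t * ip n g y" for y
      unfolding x_def[abs_def] by (simp only: ip_diff_left ip_scale_left complex_cnj_complex_of_real)
    have "ip n v h = complex_of_real l * ip n v g - ip n (mv n A v) g"
      unfolding h_def[abs_def] by (simp only: ip_diff_right ip_scale_right herm_ip[OF A])
    also have "\<dots> = ip n g g"
      by (subst (3) g_def[abs_def]) (simp only: ip_diff_left ip_scale_left complex_cnj_complex_of_real)
    finally have vh: "ip n v h = complex_of_real (qn n g)" by (simp only: ip_self)
    have "q x = Re (ip n v g) - 2 * t * qn n g + t * t * Re (ip n g h)"
      unfolding qx by (simp add: ip_diff_right ip_scale_right x_eq vh ip_self algebra_simps)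
    moreover have "Re (ip n v g) = q v" by (simp only: q_eq g_def[abs_def])
    moreover have "Re (ip n g h) = q g" by (simp only: q_eq h_def[abs_def])
    moreover have "q v = 0" using v by (simp add: q_def l_def S_iff)
    ultimately have "t * (2 * qn n g) \<le> t * (t * q g)" using q0[of x] by (simp add: algebra_simps)
    with t show ?thesis by (simp add: mult_le_cancel_left_pos)
  qed
  \<comment> \<open>The inequality \<open>var\<close> for small \<open>t\<close>; the denominator
    \<open>1 + q g\<close> avoids a case distinction on \<open>q g = 0\<close>.\<close>
  have "2 * qn n g \<le> 0 + e" if "e > 0" for e
  proof -
    have "2 * qn n g \<le> (e / (1 + q g)) * q g"
      using q0[of g] that by (intro var) simp
    also have "\<dots> \<le> e" using that q0[of g] by (simp add: field_simps)
    finally show ?thesis by simp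
  qed
  then have "2 * qn n g \<le> 0" by (rule field_le_epsilon)
  then have "qn n g = 0" using qn_nonneg[of n g] by linarith
  then have "\<forall>i<n. g i = 0" by (auto simp: qn_def sum_nonneg_eq_0_iff)
  then have evv: "mv n A v i = complex_of_real l * v i" if "i < n" for i
    using that by (simp add: g_def)
  have "qn n v = 1" using v by (simp add: S_iff)
  from that[OF this evv le] show ?thesis .
qed

lemma mpow_eigenvector:
  assumes "\<And>i. i < n \<Longrightarrow> mv n A v i = complex_of_real l * v i" "i < n"
  shows "mv n (mpow n A k) v i = complex_of_real l ^ k * v i"
  using assms(2)
proof (induction k arbitrary: i)
  case 0
  then show ?case by (simp add: mv_def if_distrib if_distribR cong: if_cong)
next
  case (Suc k)
  have "mv n (mpow n A (Suc k)) v i = (\<Sum>j<n. \<Sum>u<n. A i u * mpow n A k u j * v j)"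
    by (simp add: mv_def sum_distrib_right)
  also have "\<dots> = (\<Sum>u<n. A i u * mv n (mpow n A k) v u)"
    by (subst sum.swap) (simp add: mv_def sum_distrib_left mult.assoc)
  also have "\<dots> = (\<Sum>u<n. A i u * (complex_of_real l ^ k * v u))"
    using Suc.IH by simp
  also have "\<dots> = complex_of_real l ^ k * mv n A v i"
    by (simp add: mv_def sum_distrib_left mult_ac)
  also have "\<dots> = complex_of_real l ^ Suc k * v i"
    using assms(1)[OF Suc.prems] by simp
  finally show ?case .
qed

text \<open>For the largest eigenvalue \<open>l\<close> with unit eigenvector \<open>v\<close>, the
  number \<open>l^(2 k)\<close> is the squared norm of \<open>A^k v\<close>, hence at most the
  squared Frobenius norm of \<open>A^k\<close>.\<close>

lemma form_le_frobenius:
  assumes A: "herm n A" and n: "n > 0" and k: "k > 0" and B: "B \<ge> 0"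
    and le: "(\<Sum>i<n. \<Sum>j<n. (cmod (mpow n A k i j))\<^sup>2) \<le> B ^ (2 * k)"
  shows "form n A x \<le> B * qn n x"
proof -
  obtain l v where v: "qn n v = 1" and ev: "\<And>i. i < n \<Longrightarrow> mv n A v i = complex_of_real l * v i"
    and max: "\<And>x. form n A x \<le> l * qn n x"
    using max_eigenvector[OF A n] by (metis (no_types))
  have row: "(cmod (mv n (mpow n A k) v i))\<^sup>2 \<le> (\<Sum>j<n. (cmod (mpow n A k i j))\<^sup>2)" for i
  proof -
    have "mv n (mpow n A k) v i = ip n (\<lambda>j. cnj (mpow n A k i j)) v" by (simp add: mv_def ip_def)
    then show ?thesis using cauchy_schwarz[of n "\<lambda>j. cnj (mpow n A k i j)" v] v by (simp add: qn_def)
  qed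
  have "\<bar>l\<bar> ^ (2 * k) = qn n (\<lambda>i. complex_of_real l ^ k * v i)"
    by (simp add: qn_scale v norm_power power_even_eq)
  also have "\<dots> = qn n (mv n (mpow n A k) v)"
    using mpow_eigenvector[OF ev] by (intro qn_cong) auto
  also have "\<dots> \<le> (\<Sum>i<n. \<Sum>j<n. (cmod (mpow n A k i j))\<^sup>2)"
    unfolding qn_def by (intro sum_mono row)
  also have "\<dots> \<le> B ^ (2 * k)" by (rule le)
  finally have "\<bar>l\<bar> \<le> B" using power_mono_iff[of "\<bar>l\<bar>" B "2 * k"] B k by simp
  then have "l * qn n x \<le> B * qn n x" using qn_nonneg by (intro mult_right_mono) auto
  with max[of x] show ?thesis by linarith
qed

lemma mpow_add:
  assumes "i < n"
  shows "mpow n A (k + l) i j = (\<Sum>u<n. mpow n A k i u * mpow n A l u j)"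
  using assms
proof (induction k arbitrary: i)
  case 0
  have "(\<Sum>u<n. (if i = u then 1 else 0) * mpow n A l u j) = (\<Sum>u<n. if u = i then mpow n A l u j else 0)"
    by (intro sum.cong) auto
  with 0 show ?case by simp
next
  case (Suc k)
  have "mpow n A (Suc k + l) i j = (\<Sum>v<n. A i v * (\<Sum>u<n. mpow n A k v u * mpow n A l u j))"
    using Suc.IH by simp
  also have "\<dots> = (\<Sum>v<n. \<Sum>u<n. A i v * mpow n A k v u * mpow n A l u j)"
    by (simp add: sum_distrib_left mult.assoc)
  also have "\<dots> = (\<Sum>u<n. \<Sum>v<n. A i v * mpow n A k v u * mpow n A l u j)"
    by (rule sum.swap)
  also have "\<dots> = (\<Sum>u<n. mpow n A (Suc k) i u * mpow n A l u j)"
    by (simp add: sum_distrib_right)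
  finally show ?case .
qed

lemma mpow_skew:
  assumes skew: "\<And>i j. i < n \<Longrightarrow> j < n \<Longrightarrow> A j i = - A i j" and "i < n" "j < n"
  shows "mpow n A k j i = (- 1) ^ k * mpow n A k i j"
  using assms(2,3)
proof (induction k arbitrary: i j)
  case 0
  then show ?case by auto
next
  case (Suc k)
  have one: "mpow n A 1 i j = A i j" if "i < n" "j < n" for i j
  proof -
    have "(\<Sum>u<n. A i u * (if u = j then 1 else 0)) = (\<Sum>u<n. if u = j then A i u else 0)"
      by (intro sum.cong) auto
    with that show ?thesis by simp
  qed
  have "mpow n A (Suc k) i j = mpow n A (k + 1) i j" by simp
  also have "\<dots> = (\<Sum>u<n. mpow n A k i u * A u j)"
    unfolding mpow_add[OF Suc.prems(1)] using one Suc.prems by (intro sum.cong refl) auto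
  also have "\<dots> = (\<Sum>u<n. (- 1) ^ Suc k * (A j u * mpow n A k u i))"
  proof (intro sum.cong refl)
    fix u assume "u \<in> {..<n}"
    then have u: "u < n" by simp
    have "(- 1) ^ Suc k * (A j u * mpow n A k u i) = (- 1) ^ Suc k * (- A u j * ((- 1) ^ k * mpow n A k i u))"
      using skew[OF u Suc.prems(2)] Suc.IH[OF Suc.prems(1) u] by simp
    also have "\<dots> = ((- 1) ^ k * (- 1) ^ k) * (mpow n A k i u * A u j)"
      by (simp add: mult_ac)
    also have "(- 1) ^ k * (- 1) ^ k = (1 :: 'a)" by (simp flip: power_mult_distrib)
    finally show "mpow n A k i u * A u j = (- 1) ^ Suc k * (A j u * mpow n A k u i)" by simp
  qed
  also have "\<dots> = (- 1) ^ Suc k * mpow n A (Suc k) j i"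
    by (simp add: sum_distrib_left)
  finally have "(- 1) ^ Suc k * mpow n A (Suc k) i j = ((- 1) ^ Suc k * (- 1) ^ Suc k) * mpow n A (Suc k) j i"
    by (simp add: mult.assoc)
  then show ?case by (simp flip: power_mult_distrib)
qed

lemma mpow_scale: "mpow n (\<lambda>i j. c * A i j) k i j = c ^ k * mpow n A k i j"
  by (induction k arbitrary: i) (simp_all add: sum_distrib_left mult_ac)

lemma mpow_of_real: "mpow n (\<lambda>i j. complex_of_real (A i j)) k i j = complex_of_real (mpow n A k i j)"
  by (induction k arbitrary: i) simp_all

lemma herm_skew:
  assumes "\<And>i j. i < n \<Longrightarrow> j < n \<Longrightarrow> A j i = - A i j"
  shows "herm n (\<lambda>i j. \<i> * complex_of_real (A i j))"
  unfolding herm_def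
proof (intro allI impI)
  fix i j assume "i < n" "j < n"
  from assms[OF this(2,1)] show "\<i> * complex_of_real (A i j) = cnj (\<i> * complex_of_real (A j i))" by simp
qed

text \<open>By this symmetry an upper bound on the form, valid for all vectors, is automatically
  two-sided.\<close>

lemma form_cnj: "form n (\<lambda>i j. \<i> * complex_of_real (A i j)) (\<lambda>i. cnj (x i))
    = - form n (\<lambda>i j. \<i> * complex_of_real (A i j)) x"
proof -
  have "ip n (\<lambda>i. cnj (x i)) (mv n (\<lambda>i j. \<i> * complex_of_real (A i j)) (\<lambda>i. cnj (x i)))
     = - cnj (ip n x (mv n (\<lambda>i j. \<i> * complex_of_real (A i j)) x))"
    by (simp add: ip_def mv_def sum_distrib_left sum_negf mult_ac)
  then show ?thesis by (simp add: form_def)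
qed

lemma qn_cnj: "qn n (\<lambda>i. cnj (x i)) = qn n x"
  by (simp add: qn_def)

section \<open>Moment bounds turned into probabilities\<close>

context edge_chaos
begin

text \<open>The trace method: for skew-symmetric \<open>W\<close> the squared Frobenius norm of
  \<open>W^k\<close> is \<open>(- 1)^k\<close> times the trace of \<open>W^(2 k)\<close>, whose
  expectation is a sum over closed walks. Markov's inequality does the rest.\<close>

lemma prob_form_gt:
  assumes skew: "\<And>u v. u \<noteq> v \<Longrightarrow> s u v = - s v u"
    and k: "k > 0" and n: "n > 0" and B: "B > 0"
    and b: "\<And>a. a < n \<Longrightarrow> norm (ev {} (\<lambda>x. complex_of_real (mpow n (W x) (2 * k) a a))) \<le> b"
  shows "measure_pmf.prob M {x. \<exists>v. form n (\<lambda>i j. \<i> * complex_of_real (W x i j)) v > B * qn n v}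
    \<le> real n * b / B ^ (2 * k)"
proof -
  have Wskew: "W x j i = - W x i j" for x i j
    using skew[of j i] unfolding W_def by (cases "i = j") (simp_all add: insert_commute)
  define fr where "fr x = (\<Sum>i<n. \<Sum>j<n. (mpow n (W x) k i j)\<^sup>2)" for x
  have fr0: "fr x \<ge> 0" for x unfolding fr_def by (intro sum_nonneg) auto
  have fr: "fr x = (- 1) ^ k * (\<Sum>a<n. mpow n (W x) (2 * k) a a)" for x
  proof -
    have "(\<Sum>j<n. (mpow n (W x) k i j)\<^sup>2) = (- 1) ^ k * mpow n (W x) (2 * k) i i" if i: "i < n" for i
    proof -
      have "mpow n (W x) (2 * k) i i = (\<Sum>j<n. mpow n (W x) k i j * mpow n (W x) k j i)"
        using mpow_add[OF i, of "W x" k k i] by (simp add: mult_2)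
      also have "\<dots> = (\<Sum>j<n. mpow n (W x) k i j * ((- 1) ^ k * mpow n (W x) k i j))"
      proof (intro sum.cong refl)
        fix j assume "j \<in> {..<n}"
        then have "j < n" by simp
        from mpow_skew[of n "W x", OF Wskew i this]
        show "mpow n (W x) k i j * mpow n (W x) k j i = mpow n (W x) k i j * ((- 1) ^ k * mpow n (W x) k i j)"
          by (simp only:)
      qed
      also have "\<dots> = (- 1) ^ k * (\<Sum>j<n. (mpow n (W x) k i j)\<^sup>2)"
        by (simp add: sum_distrib_left power2_eq_square mult_ac)
      finally have "(- 1) ^ k * mpow n (W x) (2 * k) i i = ((- 1) ^ k * (- 1) ^ k) * (\<Sum>j<n. (mpow n (W x) k i j)\<^sup>2)"
        by (simp add: mult.assoc)
      then show ?thesis by (simp flip: power_mult_distrib)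
    qed
    then show ?thesis by (simp add: fr_def sum_distrib_left)
  qed
  have "complex_of_real (measure_pmf.expectation M fr) = ev {} (\<lambda>x. complex_of_real (fr x))"
    unfolding ev_def by (simp only: prod.empty of_real_1 mult_1_left integral_complex_of_real)
  also have "\<dots> = ev {} (\<lambda>x. (- 1) ^ k * (\<Sum>a<n. complex_of_real (mpow n (W x) (2 * k) a a)))"
    unfolding fr by simp
  also have "\<dots> = (- 1) ^ k * (\<Sum>a<n. ev {} (\<lambda>x. complex_of_real (mpow n (W x) (2 * k) a a)))"
    by (simp only: ev_cmult ev_sum)
  finally have "norm (complex_of_real (measure_pmf.expectation M fr))
     = norm (\<Sum>a<n. ev {} (\<lambda>x. complex_of_real (mpow n (W x) (2 * k) a a)))"
    by (simp only: norm_mult norm_power norm_minus_cancel norm_one power_one mult_1_left)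
  also have "\<dots> \<le> (\<Sum>a<n. b)"
    by (rule sum_norm_le) (use b in auto)
  finally have E: "measure_pmf.expectation M fr \<le> real n * b"
    by simp
  have sub: "{x. \<exists>v. form n (\<lambda>i j. \<i> * complex_of_real (W x i j)) v > B * qn n v} \<subseteq> {x. fr x \<ge> B ^ (2 * k)}"
  proof (rule subsetI, rule CollectI, rule ccontr)
    fix x assume "x \<in> {x. \<exists>v. form n (\<lambda>i j. \<i> * complex_of_real (W x i j)) v > B * qn n v}"
    then obtain v where v: "form n (\<lambda>i j. \<i> * complex_of_real (W x i j)) v > B * qn n v" by blast
    assume "\<not> B ^ (2 * k) \<le> fr x"
    then have "(\<Sum>i<n. \<Sum>j<n. (cmod (mpow n (\<lambda>i j. \<i> * complex_of_real (W x i j)) k i j))\<^sup>2) \<le> B ^ (2 * k)"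
      by (simp add: mpow_scale mpow_of_real norm_mult norm_power fr_def)
    from form_le_frobenius[OF herm_skew[of n "W x", OF Wskew] n k _ this, of v] B v
    show False by simp
  qed
  have "measure_pmf.prob M {x. \<exists>v. form n (\<lambda>i j. \<i> * complex_of_real (W x i j)) v > B * qn n v}
      \<le> measure_pmf.prob M {x. fr x \<ge> B ^ (2 * k)}"
    by (rule measure_pmf.finite_measure_mono[OF sub]) simp
  also have "\<dots> \<le> measure_pmf.expectation M fr / B ^ (2 * k)"
    using integral_Markov_inequality_measure[of "measure_pmf M" fr "{}" "B ^ (2 * k)"] fr0 B
    by (simp add: integrable_M)
  also have "\<dots> \<le> real n * b / B ^ (2 * k)"
    using E B by (intro divide_right_mono) auto
  finally show ?thesis .
qed

text \<open>The scaled second moment is \<open>O(1 / n)\<close>. The threshold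
  \<open>n^(-1/4)\<close> splits it evenly: its square is \<open>n^(-1/2)\<close>, which leaves
  \<open>O(n^(-1/2))\<close> for the probability.\<close>

lemma prob_nb_gt:
  fixes w z :: "nat \<Rightarrow> complex"
  assumes "\<alpha> = 1" "\<beta> = 0" "n > 0" "m \<ge> 1"
    and "\<And>v. v < n \<Longrightarrow> norm (w v) \<le> 1 / sqrt (real n)"
    and "\<And>v. v < n \<Longrightarrow> norm (z v) \<le> 1 / sqrt (real n)"
  shows "measure_pmf.prob M {x. norm (\<Sum>a<n. cnj (z a) * nb n (W x) w m a a)
      \<ge> real n powr (- 1 / 4) * sqrt (real n) ^ m}
    \<le> nb_const m * real n powr (- 1 / 2)"
proof -
  let ?F = "\<lambda>x. norm (\<Sum>a<n. cnj (z a) * nb n (W x) w m a a)"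
  let ?C = "nb_const m"
  define t where "t = real n powr (- 1 / 4) * sqrt (real n) ^ m"
  have t: "t > 0" using assms(3) by (simp add: t_def)
  have t2: "t\<^sup>2 = real n powr (- 1 / 2) * real n ^ m"
  proof -
    have "(real n powr (- 1 / 4))\<^sup>2 = real n powr (- 1 / 2)"
      by (simp add: power2_eq_square flip: powr_add)
    moreover have "(sqrt (real n) ^ m)\<^sup>2 = real n ^ m"
      by (simp flip: power_mult add: mult.commute[of m]) (simp add: power_mult)
    ultimately show ?thesis by (simp add: t_def power_mult_distrib)
  qed
  have "measure_pmf.prob M {x. ?F x \<ge> t} \<le> measure_pmf.prob M {x. (?F x)\<^sup>2 \<ge> t\<^sup>2}"
    by (rule measure_pmf.finite_measure_mono) (use t in \<open>auto intro: power_mono\<close>)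
  also have "\<dots> \<le> measure_pmf.expectation M (\<lambda>x. (?F x)\<^sup>2) / t\<^sup>2"
    using integral_Markov_inequality_measure[of "measure_pmf M" "\<lambda>x. (?F x)\<^sup>2" "{}" "t\<^sup>2"] t
    by (simp add: integrable_M)
  also have "\<dots> \<le> (?C * real n ^ m / real n) / t\<^sup>2"
    by (intro divide_right_mono nb_second_moment assms) auto
  also have "\<dots> = ?C * (1 / (real n * real n powr (- 1 / 2)))"
    using assms(3) by (simp add: t2)
  also have "real n * real n powr (- 1 / 2) = real n powr (1 / 2)"
    using assms(3) powr_add[of "real n" 1 "- 1 / 2"] by simp
  also have "1 / real n powr (1 / 2) = real n powr (- 1 / 2)"
    by (simp add: powr_minus_divide)
  finally show ?thesis by (simp add: t_def)
qed

end

section \<open>Coupling the planted and the uniform model\<close>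

lemma expectation_pair_pmf_mult:
  fixes f :: "'a \<Rightarrow> real" and h :: "'b \<Rightarrow> real"
  assumes "finite (set_pmf p)" "finite (set_pmf q)"
  shows "measure_pmf.expectation (pair_pmf p q) (\<lambda>(x, y). f x * h y)
    = measure_pmf.expectation p f * measure_pmf.expectation q h"
proof -
  have "measure_pmf.expectation (pair_pmf p q) (\<lambda>(x, y). f x * h y)
    = (\<Sum>z\<in>set_pmf p \<times> set_pmf q. (case z of (x, y) \<Rightarrow> f x * h y) * pmf (pair_pmf p q) z)"
    by (rule integral_measure_pmf_real) (use assms in auto)
  also have "\<dots> = (\<Sum>x\<in>set_pmf p. \<Sum>y\<in>set_pmf q. (f x * pmf p x) * (h y * pmf q y))"
    unfolding sum.cartesian_product by (intro sum.cong) (auto simp: pmf_pair)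
  also have "\<dots> = (\<Sum>x\<in>set_pmf p. f x * pmf p x) * (\<Sum>y\<in>set_pmf q. h y * pmf q y)"
    by (simp add: sum_product)
  also have "(\<Sum>x\<in>set_pmf p. f x * pmf p x) = measure_pmf.expectation p f"
    by (rule integral_measure_pmf_real[symmetric]) (use assms in auto)
  also have "(\<Sum>y\<in>set_pmf q. h y * pmf q y) = measure_pmf.expectation q h"
    by (rule integral_measure_pmf_real[symmetric]) (use assms in auto)
  finally show ?thesis .
qed

lemma finite_set_Pi_pmf:
  assumes "finite A" "\<And>x. x \<in> A \<Longrightarrow> finite (set_pmf (p x))"
  shows "finite (set_pmf (Pi_pmf A d p))"
  using assms by (subst set_Pi_pmf) auto

text \<open>The coordinate \<open>e\<close> is split off as an independent factor, and its mean is
  0.\<close>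

lemma Pi_pmf_prod_mean_zero:
  fixes f :: "'a \<Rightarrow> 'b \<Rightarrow> real"
  assumes A: "finite A" and fin: "\<And>x. x \<in> A \<Longrightarrow> finite (set_pmf (p x))"
    and B: "B \<subseteq> A" "e \<in> B" and zero: "measure_pmf.expectation (p e) (f e) = 0"
  shows "measure_pmf.expectation (Pi_pmf A d p) (\<lambda>x. \<Prod>b\<in>B. f b (x b)) = 0"
proof -
  let ?A = "A - {e}"
  have AI: "A = insert e ?A" using B by auto
  have finB: "finite B" using A B finite_subset by auto
  have "Pi_pmf A d p = map_pmf (\<lambda>(y, h). h(e := y)) (pair_pmf (p e) (Pi_pmf ?A d p))"
    by (subst AI, rule Pi_pmf_insert) (use A in auto)
  then have "measure_pmf.expectation (Pi_pmf A d p) (\<lambda>x. \<Prod>b\<in>B. f b (x b))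
     = measure_pmf.expectation (pair_pmf (p e) (Pi_pmf ?A d p)) (\<lambda>(y, h). \<Prod>b\<in>B. f b ((h(e := y)) b))"
    by (simp add: case_prod_unfold)
  also have "(\<lambda>(y, h). \<Prod>b\<in>B. f b ((h(e := y)) b)) = (\<lambda>(y, h). f e y * (\<Prod>b\<in>B - {e}. f b (h b)))"
  proof -
    have "(\<Prod>b\<in>B. f b ((h(e := y)) b)) = f e y * (\<Prod>b\<in>B - {e}. f b (h b))" for y h
    proof -
      have "(\<Prod>b\<in>B - {e}. f b ((h(e := y)) b)) = (\<Prod>b\<in>B - {e}. f b (h b))"
        by (intro prod.cong) auto
      then show ?thesis using prod.remove[OF finB B(2), of "\<lambda>b. f b ((h(e := y)) b)"] by simp
    qed
    then show ?thesis by (simp only:)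
  qed
  also have "measure_pmf.expectation (pair_pmf (p e) (Pi_pmf ?A d p)) \<dots>
     = measure_pmf.expectation (p e) (f e) * measure_pmf.expectation (Pi_pmf ?A d p) (\<lambda>h. \<Prod>b\<in>B - {e}. f b (h b))"
    by (rule expectation_pair_pmf_mult) (use A fin B in \<open>auto intro!: finite_set_Pi_pmf\<close>)
  finally show ?thesis using zero by simp
qed

text \<open>
  The planted sign \<open>t\<close> of a pair is coupled with a fair sign \<open>r\<close> so that the two differ
  with probability \<open>\<gamma>\<close> only.
\<close>

definition coupled_signs :: "real \<Rightarrow> (int \<times> int) pmf" where
  "coupled_signs \<gamma> = do {
     b \<leftarrow> bernoulli_pmf (1 / 2);
     f \<leftarrow> bernoulli_pmf (2 * \<gamma>);
     return_pmf (if b then (1, 1) else if f then (1, - 1) else (- 1, - 1))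
   }"

lemma set_coupled_signs: "set_pmf (coupled_signs \<gamma>) \<subseteq> {(1, 1), (1, - 1), (- 1, - 1)}"
  by (auto simp: coupled_signs_def split: if_splits)

lemma expectation_bernoulli_bind:
  fixes h :: "'a \<Rightarrow> real"
  assumes "0 \<le> p" "p \<le> 1" "\<And>b. finite (set_pmf (f b))"
  shows "measure_pmf.expectation (bernoulli_pmf p \<bind> f) h
    = p * measure_pmf.expectation (f True) h + (1 - p) * measure_pmf.expectation (f False) h"
  using assms by (subst pmf_expectation_bind[of UNIV]) (auto simp: UNIV_bool)

lemma expectation_coupled_signs:
  fixes h :: "int \<times> int \<Rightarrow> real"
  assumes "0 \<le> \<gamma>" "\<gamma> \<le> 1 / 2"
  shows "measure_pmf.expectation (coupled_signs \<gamma>) h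
    = h (1, 1) / 2 + h (1, - 1) * \<gamma> + h (- 1, - 1) * (1 / 2 - \<gamma>)"
proof -
  have inner: "measure_pmf.expectation (bernoulli_pmf (2 * \<gamma>) \<bind> (\<lambda>f. return_pmf (c f))) h
     = 2 * \<gamma> * h (c True) + (1 - 2 * \<gamma>) * h (c False)" for c
    using assms by (subst expectation_bernoulli_bind) auto
  show ?thesis
    unfolding coupled_signs_def
    by (subst expectation_bernoulli_bind) (simp_all add: inner, (simp add: field_simps)?)
qed

lemma map_fst_coupled_signs:
  assumes "0 \<le> \<gamma>" "\<gamma> \<le> 1 / 2"
  shows "map_pmf fst (coupled_signs \<gamma>) = sign_pmf (1 / 2 + \<gamma>)"
proof (rule pmf_eqI)
  fix i :: int
  have sign: "sign_pmf p = bernoulli_pmf p \<bind> (\<lambda>b. return_pmf (if b then 1 else - 1))" for p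
    by (simp only: sign_pmf_def map_pmf_def)
  have "pmf (bernoulli_pmf (2 * \<gamma>) \<bind> (\<lambda>f. return_pmf (c f))) i
     = 2 * \<gamma> * indicator {i} (c True) + (1 - 2 * \<gamma>) * indicator {i} (c False)" for c :: "bool \<Rightarrow> int"
    using assms by (simp add: pmf_bind indicator_def)
  note inner = this[of "\<lambda>f. if f then 1 else - 1"]
  have "map_pmf fst (coupled_signs \<gamma>) = bernoulli_pmf (1 / 2) \<bind>
      (\<lambda>b. if b then return_pmf 1 else bernoulli_pmf (2 * \<gamma>) \<bind> (\<lambda>f. return_pmf (if f then 1 else - 1)))"
    unfolding coupled_signs_def map_bind_pmf map_return_pmf
    by (intro bind_pmf_cong refl) (auto intro!: bind_pmf_cong)
  then have "pmf (map_pmf fst (coupled_signs \<gamma>)) i = 1 / 2 * pmf (return_pmf 1) i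
      + 1 / 2 * pmf (bernoulli_pmf (2 * \<gamma>) \<bind> (\<lambda>f. return_pmf (if f then 1 else - 1))) i"
    by (subst (asm) pmf_eq_iff) (simp add: pmf_bind[of "bernoulli_pmf (1 / 2)"])
  also have "\<dots> = pmf (sign_pmf (1 / 2 + \<gamma>)) i"
    unfolding inner sign using assms by (simp add: pmf_bind indicator_def field_simps)
  finally show "pmf (map_pmf fst (coupled_signs \<gamma>)) i = pmf (sign_pmf (1 / 2 + \<gamma>)) i" .
qed

definition rank_sign :: "(nat \<Rightarrow> nat) \<Rightarrow> nat \<Rightarrow> nat \<Rightarrow> real" where
  "rank_sign \<sigma> u v = (if \<sigma> u < \<sigma> v then 1 else - 1)"

text \<open>Edges are unordered, while the model draws one sign per ranked pair. The choice is
  unique as soon as the two ranks differ (\<open>ranked_eq\<close>).\<close>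

definition ranked :: "(nat \<Rightarrow> nat) \<Rightarrow> nat set \<Rightarrow> nat \<times> nat" where
  "ranked \<sigma> e = (SOME p. e = {fst p, snd p} \<and> \<sigma> (fst p) < \<sigma> (snd p))"

lemma ranked_eq: "\<sigma> u < \<sigma> v \<Longrightarrow> ranked \<sigma> {u, v} = (u, v)"
  unfolding ranked_def by (rule some_equality) (auto simp: doubleton_eq_iff)

lemma ranked_eq': "\<sigma> u < \<sigma> v \<Longrightarrow> ranked \<sigma> {v, u} = (u, v)"
  using ranked_eq[of \<sigma> u v] by (simp add: insert_commute)

locale coupled_model =
  fixes n :: nat and \<sigma> :: "nat \<Rightarrow> nat" and \<gamma> :: real
  assumes n: "n > 0" and perm: "\<sigma> permutes {..<n}" and \<gamma>: "0 \<le> \<gamma>" "\<gamma> \<le> 1 / 2"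
begin

lemma edges_ranked:
  assumes "e \<in> edges n"
  obtains u v where "e = {u, v}" "u < n" "v < n" "\<sigma> u < \<sigma> v" "ranked \<sigma> e = (u, v)"
proof -
  obtain a b where e: "e = {a, b}" "a < n" "b < n" "a \<noteq> b"
    using assms by (auto simp: edges_def)
  have "\<sigma> a \<noteq> \<sigma> b" using e(4) permutes_inj[OF perm] by (auto dest: injD)
  then consider "\<sigma> a < \<sigma> b" | "\<sigma> b < \<sigma> a" by linarith
  then show ?thesis
  proof cases
    case 1
    show ?thesis by (rule that[of a b]) (use e 1 ranked_eq[of \<sigma> a b, OF 1] in auto)
  next
    case 2
    show ?thesis by (rule that[of b a]) (use e 2 ranked_eq'[of \<sigma> b a, OF 2] in auto)
  qed
qed

lemma ranked_in: "e \<in> edges n \<Longrightarrow> ranked \<sigma> e \<in> ranked_pairs n \<sigma>"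
  by (erule edges_ranked) (auto simp: ranked_pairs_def)

lemma inj_on_ranked: "inj_on (ranked \<sigma>) (edges n)"
proof (rule inj_onI)
  fix e e' assume "e \<in> edges n" "e' \<in> edges n" "ranked \<sigma> e = ranked \<sigma> e'"
  then show "e = e'" by (elim edges_ranked) auto
qed

definition M :: "(nat \<times> nat \<Rightarrow> int \<times> int) pmf" where
  "M = Pi_pmf (ranked_pairs n \<sigma>) (0, 0) (\<lambda>_. coupled_signs \<gamma>)"

lemma finite_coupled: "finite (set_pmf (coupled_signs \<gamma>))"
  by (rule finite_subset[OF set_coupled_signs]) auto

lemma finite_M: "finite (set_pmf M)"
  unfolding M_def by (intro finite_set_Pi_pmf finite_ranked_pairs finite_coupled)

lemma in_M:
  assumes "x \<in> set_pmf M" "e \<in> edges n"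
  shows "x (ranked \<sigma> e) \<in> {(1, 1), (1, - 1), (- 1, - 1)}"
proof -
  have "x \<in> PiE_dflt (ranked_pairs n \<sigma>) (0, 0) (\<lambda>_. set_pmf (coupled_signs \<gamma>))"
    using assms(1) by (simp add: M_def set_Pi_pmf finite_ranked_pairs comp_def)
  then have "\<forall>p. p \<in> ranked_pairs n \<sigma> \<longrightarrow> x p \<in> set_pmf (coupled_signs \<gamma>)"
    unfolding PiE_dflt_def by blast
  then have "x (ranked \<sigma> e) \<in> set_pmf (coupled_signs \<gamma>)"
    using ranked_in[OF assms(2)] by blast
  then show ?thesis using set_coupled_signs by blast
qed

lemma chaos_mean_zero:
  fixes h :: "int \<times> int \<Rightarrow> real"
  assumes zero: "measure_pmf.expectation (coupled_signs \<gamma>) h = 0" and H: "H \<subseteq> edges n" "H \<noteq> {}"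
  shows "measure_pmf.expectation M (\<lambda>x. \<Prod>e\<in>H. h (x (ranked \<sigma> e))) = 0"
proof -
  obtain e where e: "e \<in> H" using H(2) by blast
  have "(\<Prod>e\<in>H. h (x (ranked \<sigma> e))) = (\<Prod>p\<in>ranked \<sigma> ` H. h (x p))" for x :: "nat \<times> nat \<Rightarrow> int \<times> int"
    by (subst prod.reindex) (use inj_on_subset[OF inj_on_ranked H(1)] in auto)
  then show ?thesis
    unfolding M_def using ranked_in H e
    by (simp only:)
      (rule Pi_pmf_prod_mean_zero[OF finite_ranked_pairs finite_coupled, where e = "ranked \<sigma> e"],
        use zero in auto)
qed

sublocale R: edge_chaos n M "\<lambda>e x. real_of_int (snd (x (ranked \<sigma> e)))" "rank_sign \<sigma>" 1 0
proof
  show "measure_pmf.expectation M (\<lambda>x. \<Prod>e\<in>H. real_of_int (snd (x (ranked \<sigma> e)))) = 0"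
    if "H \<subseteq> edges n" "H \<noteq> {}" for H
    using that \<gamma> by (intro chaos_mean_zero[of "\<lambda>p. real_of_int (snd p)"]) (auto simp: expectation_coupled_signs)
  show "real_of_int (snd (x (ranked \<sigma> e))) * real_of_int (snd (x (ranked \<sigma> e))) = 1 + 0 * real_of_int (snd (x (ranked \<sigma> e)))"
    if "x \<in> set_pmf M" "e \<in> edges n" for x e
    using in_M[OF that] by auto
qed (auto simp: finite_M rank_sign_def)

text \<open>Half the difference of the coupled signs is a Bernoulli variable \<open>b\<close> with
  mean \<open>\<gamma>\<close>, and \<open>b^2 = b\<close> yields \<open>(b - \<gamma>)^2 = \<gamma>
  (1 - \<gamma>) + (1 - 2 \<gamma>) (b - \<gamma>)\<close>.\<close>

sublocale D: edge_chaos n M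
  "\<lambda>e x. (real_of_int (fst (x (ranked \<sigma> e))) - real_of_int (snd (x (ranked \<sigma> e)))) / 2 - \<gamma>"
  "rank_sign \<sigma>" "\<gamma> * (1 - \<gamma>)" "1 - 2 * \<gamma>"
proof
  show "measure_pmf.expectation M (\<lambda>x. \<Prod>e\<in>H. (real_of_int (fst (x (ranked \<sigma> e))) - real_of_int (snd (x (ranked \<sigma> e)))) / 2 - \<gamma>) = 0"
    if "H \<subseteq> edges n" "H \<noteq> {}" for H
    using that \<gamma>
    by (intro chaos_mean_zero[of "\<lambda>p. (real_of_int (fst p) - real_of_int (snd p)) / 2 - \<gamma>"])
      (auto simp: expectation_coupled_signs algebra_simps)
  show "((real_of_int (fst (x (ranked \<sigma> e))) - real_of_int (snd (x (ranked \<sigma> e)))) / 2 - \<gamma>)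
       * ((real_of_int (fst (x (ranked \<sigma> e))) - real_of_int (snd (x (ranked \<sigma> e)))) / 2 - \<gamma>)
     = \<gamma> * (1 - \<gamma>) + (1 - 2 * \<gamma>) * ((real_of_int (fst (x (ranked \<sigma> e))) - real_of_int (snd (x (ranked \<sigma> e)))) / 2 - \<gamma>)"
    if "x \<in> set_pmf M" "e \<in> edges n" for x e
    using in_M[OF that] by (auto simp: field_simps)
qed (use \<gamma> in \<open>auto simp: finite_M rank_sign_def\<close>)

definition S :: "nat \<Rightarrow> nat \<Rightarrow> real" where
  "S u v = (if u = v then 0 else rank_sign \<sigma> u v)"

definition tour :: "(nat \<times> nat \<Rightarrow> int \<times> int) \<Rightarrow> int mat" where
  "tour x = tournament_of n \<sigma> (\<lambda>p. fst (x p))"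

lemma map_tour: "map_pmf tour M =
    do {X \<leftarrow> Pi_pmf (ranked_pairs n \<sigma>) 0 (\<lambda>_. sign_pmf (1 / 2 + \<gamma>)); return_pmf (tournament_of n \<sigma> X)}"
proof -
  have "Pi_pmf (ranked_pairs n \<sigma>) 0 (\<lambda>_. sign_pmf (1 / 2 + \<gamma>)) = map_pmf (\<lambda>h. fst \<circ> h) M"
    unfolding M_def map_fst_coupled_signs[OF \<gamma>, symmetric]
    by (rule Pi_pmf_map) (auto simp: finite_ranked_pairs)
  then show ?thesis
    by (simp add: bind_map_pmf tour_def[abs_def] comp_def pmf.map_comp flip: map_pmf_def)
qed

text \<open>The signal is twice the mean \<open>\<gamma>\<close> that was subtracted in order to
  centre \<open>D\<close>.\<close>

lemma tour_decomp:
  assumes "i < n" "j < n"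
  shows "real_of_int (tour x $$ (i, j)) = R.W x i j + 2 * D.W x i j + 2 * \<gamma> * S i j"
proof (cases "i = j")
  case True
  with assms show ?thesis by (simp add: tour_def tournament_of_def R.W_def D.W_def S_def)
next
  case False
  then have "\<sigma> i \<noteq> \<sigma> j" using permutes_inj[OF perm] by (auto dest: injD)
  then consider "\<sigma> i < \<sigma> j" | "\<sigma> j < \<sigma> i" by linarith
  then show ?thesis
  proof cases
    case 1
    with assms False ranked_eq[of \<sigma> i j, OF 1] show ?thesis
      by (simp add: tour_def tournament_of_def R.W_def D.W_def S_def rank_sign_def) (simp add: field_simps)
  next
    case 2
    with assms False ranked_eq'[of \<sigma> j i, OF 2] show ?thesis
      by (simp add: tour_def tournament_of_def R.W_def D.W_def S_def rank_sign_def) (simp add: field_simps)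
  qed
qed

lemma rank_sign_skew:
  assumes "u \<noteq> v"
  shows "rank_sign \<sigma> u v = - rank_sign \<sigma> v u"
proof -
  have "\<sigma> u \<noteq> \<sigma> v" using assms permutes_inj[OF perm] by (auto dest: injD)
  then show ?thesis by (auto simp: rank_sign_def)
qed

end

section \<open>Probability bounds for the scaled noise, error and Chebyshev vectors\<close>

abbreviation trace_bound :: "nat \<Rightarrow> nat \<Rightarrow> real \<Rightarrow> real" where
  "trace_bound n k z \<equiv>
    real n * ((2 + (2 * real (2 * k) + 1) * real (2 * k) ^ 4 / real n + 1 / real (2 * k)) / z) ^ (2 * k)"

context coupled_model
begin

definition Hm :: "(nat \<times> nat \<Rightarrow> int \<times> int) \<Rightarrow> nat \<Rightarrow> nat \<Rightarrow> complex" where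
  "Hm x i j = complex_of_real (1 / sqrt (real n)) * (\<i> * complex_of_real (R.W x i j))"

definition Dm :: "(nat \<times> nat \<Rightarrow> int \<times> int) \<Rightarrow> nat \<Rightarrow> nat \<Rightarrow> complex" where
  "Dm x i j = complex_of_real (2 / sqrt (real n)) * (\<i> * complex_of_real (D.W x i j))"

text \<open>The stand-in for \<open>U_m(H) w\<close>: the prefactor turns the recursion of the
  non-backtracking sums into the Chebyshev recursion, up to coefficients that tend to 1.\<close>

definition xv :: "(nat \<times> nat \<Rightarrow> int \<times> int) \<Rightarrow> (nat \<Rightarrow> complex) \<Rightarrow> nat \<Rightarrow> nat \<Rightarrow> complex" where
  "xv x w m a = \<i> ^ m / complex_of_real (sqrt (real n) ^ m) * nb n (R.W x) w m a a"

lemma prob_Hm_form: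
  assumes k: "k > 0" and z: "z > 0"
  shows "measure_pmf.prob M {x. \<exists>v. form n (Hm x) v > z * qn n v}
    \<le> trace_bound n k z"
proof -
  let ?r = "sqrt (real n)"
  let ?K = "2 * k"
  define \<rho> where "\<rho> = 2 + (2 * real ?K + 1) * real ?K ^ 4 / real n + 1 / real ?K"
  have r: "?r > 0" "?r * ?r = real n" using n by auto
  have ev: "norm (R.ev {} (\<lambda>x. complex_of_real (mpow n (R.W x) ?K a a))) \<le> (\<rho> * ?r) ^ ?K" if a: "a < n" for a
  proof -
    have "norm (R.ev {} (\<lambda>x. complex_of_real (mpow n (R.W x) ?K a a)))
      \<le> (\<rho> * ?r) ^ ?K * (1 / ?r) ^ card ({} :: nat set set) * real (?K\<^sup>2) ^ R.phi {} a a"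
    \<comment> \<open>\<open>Y = K^2\<close> makes both error terms small relative to
      \<open>sqrt n\<close>: one becomes \<open>1 / K\<close>, the other
      \<open>(2 * K + 1) * K^4 / n\<close>.\<close>
    proof (rule R.sharp_bound[where K = ?K])
      show "1 \<le> real (?K\<^sup>2)" using one_le_power[of "real ?K" 2] k by simp
      have "real n * (1 / ?r) = ?r" using r by (simp add: field_simps)
      moreover have "(2 * real ?K + 1) * ((1 / ?r) * (real (?K\<^sup>2))\<^sup>2) = ((2 * real ?K + 1) * real ?K ^ 4 / real n) * ?r"
      proof -
        have q: "1 / ?r = ?r / real n" using r by (simp add: field_simps)
        show ?thesis unfolding q by (simp flip: power_mult)
      qed
      moreover have "real ?K / ((1 / ?r) * real (?K\<^sup>2)) = (1 / real ?K) * ?r"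
        using k r by (simp add: power2_eq_square)
      ultimately show "real n * (1 / ?r) + 1 / (1 / ?r) + (2 * real ?K + 1) * ((1 / ?r) * (real (?K\<^sup>2))\<^sup>2)
          + real ?K / ((1 / ?r) * real (?K\<^sup>2)) \<le> \<rho> * ?r"
        by (simp add: \<rho>_def algebra_simps)
    qed (use a r in auto)
    moreover have "R.phi {} a a = 0" by (simp add: R.phi_def deg_def)
    ultimately show ?thesis by simp
  qed
  have "measure_pmf.prob M {x. \<exists>v. form n (Hm x) v > z * qn n v}
     = measure_pmf.prob M {x. \<exists>v. form n (\<lambda>i j. \<i> * complex_of_real (R.W x i j)) v > (z * ?r) * qn n v}"
    unfolding Hm_def[abs_def] form_scale_mat using r by (simp add: field_simps)
  also have "\<dots> \<le> real n * (\<rho> * ?r) ^ ?K / (z * ?r) ^ (2 * k)"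
    by (rule R.prob_form_gt[OF rank_sign_skew k n _ ev]) (use z r in auto)
  also have "\<dots> = real n * (\<rho> / z) ^ ?K"
    using r by (simp add: power_mult_distrib power_divide)
  finally show ?thesis by (simp only: \<rho>_def)
qed

lemma prob_Dm_form:
  assumes c: "c \<ge> 0" "\<gamma> \<le> c * real n powr (- 1 / 2)" and \<delta>: "\<delta> > 0"
  shows "measure_pmf.prob M {x. \<exists>v. form n (Dm x) v > \<delta> * qn n v}
    \<le> real n * (((1 + 8 * c) * real n powr (1 / 4) + 8) / (\<delta> * sqrt (real n) / 2)) ^ 8"
proof -
  let ?r = "sqrt (real n)"
  define X where "X = (1 + 8 * c) * real n powr (1 / 4) + 8"
  \<comment> \<open>Since \<open>\<gamma>\<close> is at most of order \<open>n^(-1/2)\<close>, this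
    value balances \<open>n * y\<close> against \<open>\<gamma> / y\<close>: both have order
    \<open>n^(1/4)\<close>.\<close>
  define y where "y = real n powr (- 3 / 4)"
  have r: "?r > 0" using n by auto
  have y: "y > 0" using n by (simp add: y_def)
  \<comment> \<open>Length 8 suffices: \<open>n * X^8\<close> has order \<open>n^3\<close>, against
    \<open>(sqrt n)^8 = n^4\<close>.\<close>
  have ev: "norm (D.ev {} (\<lambda>x. complex_of_real (mpow n (D.W x) (2 * 4) a a))) \<le> X ^ 8" if a: "a < n" for a
  proof -
    have "norm (D.ev {} (\<lambda>x. complex_of_real (mpow n (D.W x) 8 a a))) \<le> 1 * X ^ 8 * y ^ card ({} :: nat set set)"
    proof (rule D.crude_bound[where K = 8 and S = "\<lambda>p v. {..<n} - {v}" and p = a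
          and f = "\<lambda>l p v x. complex_of_real (mpow n (D.W x) l v a)"])
      show "norm (D.ev H (\<lambda>x. complex_of_real (mpow n (D.W x) 0 v a))) \<le> 1 * y ^ card H"
        if "H \<subseteq> edges n" for H v
        using y by (simp add: D.ev_const[OF that])
      have ny: "real n * y = real n powr (1 / 4)"
        using n powr_add[of "real n" 1 "- 3 / 4"] by (simp add: y_def)
      have "\<gamma> * (1 - \<gamma>) \<le> \<gamma> * 1" using \<gamma> by (intro mult_left_mono) auto
      also have "\<dots> \<le> c * real n powr (- 1 / 2)" using c by simp
      finally have "\<gamma> * (1 - \<gamma>) / y \<le> c * real n powr (- 1 / 2) / y"
        using y by (intro divide_right_mono) auto
      also have "\<dots> = c * real n powr (1 / 4)"
        using powr_diff[of "real n" "- 1 / 2" "- 3 / 4"] by (simp add: y_def flip: times_divide_eq_right)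
      finally have A: "\<gamma> * (1 - \<gamma>) / y \<le> c * real n powr (1 / 4)" .
      have "X = real n powr (1 / 4) + 8 * (c * real n powr (1 / 4)) + 8"
        by (simp add: X_def algebra_simps)
      moreover have "a + real 8 * (b + (1 - 2 * g)) \<le> a + 8 * d + 8" if "b \<le> d" "0 \<le> g" for a b d g :: real
        using that by simp
      ultimately show "real n * y + real 8 * (\<gamma> * (1 - \<gamma>) / y + (1 - 2 * \<gamma>)) \<le> X"
        using A \<gamma>(1) unfolding ny by (simp only:)
    qed (use a y D.mpow_W_rec in auto)
    then show ?thesis by simp
  qed
  have "measure_pmf.prob M {x. \<exists>v. form n (Dm x) v > \<delta> * qn n v}
     = measure_pmf.prob M {x. \<exists>v. form n (\<lambda>i j. \<i> * complex_of_real (D.W x i j)) v > (\<delta> * ?r / 2) * qn n v}"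
    unfolding Dm_def[abs_def] form_scale_mat using r by (simp add: field_simps)
  also have "\<dots> \<le> real n * X ^ 8 / (\<delta> * ?r / 2) ^ (2 * 4)"
    by (rule D.prob_form_gt[OF rank_sign_skew _ n _ ev]) (use \<delta> r in auto)
  also have "\<dots> = real n * (X / (\<delta> * ?r / 2)) ^ 8"
    by (simp add: power_divide)
  finally show ?thesis by (simp only: X_def)
qed

lemma prob_xv:
  assumes m: "m \<ge> 1"
    and "\<And>v. v < n \<Longrightarrow> norm (w v) \<le> 1 / sqrt (real n)"
    and "\<And>v. v < n \<Longrightarrow> norm (z v) \<le> 1 / sqrt (real n)"
  shows "measure_pmf.prob M {x. norm (ip n z (xv x w m)) \<ge> real n powr (- 1 / 4)}
    \<le> nb_const m * real n powr (- 1 / 2)"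
proof -
  have "norm (ip n z (xv x w m)) = norm (\<Sum>a<n. cnj (z a) * nb n (R.W x) w m a a) / sqrt (real n) ^ m" for x
  proof -
    have "ip n z (xv x w m) = \<i> ^ m / complex_of_real (sqrt (real n) ^ m) * (\<Sum>a<n. cnj (z a) * nb n (R.W x) w m a a)"
      unfolding xv_def[abs_def] ip_scale_right by (simp add: ip_def)
    then show ?thesis by (simp add: norm_mult norm_divide norm_power)
  qed
  then have "{x. norm (ip n z (xv x w m)) \<ge> real n powr (- 1 / 4)} =
     {x. norm (\<Sum>a<n. cnj (z a) * nb n (R.W x) w m a a) \<ge> real n powr (- 1 / 4) * sqrt (real n) ^ m}"
    using n by (simp only:) (simp add: pos_le_divide_eq)
  then show ?thesis using R.prob_nb_gt[OF refl refl n m assms(2,3)] by simp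
qed

lemma form_Dm_ge:
  assumes "\<And>v. form n (Dm x) v \<le> \<delta> * qn n v"
  shows "\<bar>form n (Dm x) v\<bar> \<le> \<delta> * qn n v"
proof -
  have "form n (Dm x) (\<lambda>i. cnj (v i)) = - form n (Dm x) v"
    unfolding Dm_def[abs_def] form_scale_mat form_cnj by simp
  with assms[of "\<lambda>i. cnj (v i)"] assms[of v] show ?thesis by (simp add: qn_cnj)
qed

lemma herm_Hm: "herm n (Hm x)"
proof -
  have "R.W x j i = - R.W x i j" for i j
    using rank_sign_skew[of j i] unfolding R.W_def by (cases "i = j") (simp_all add: insert_commute)
  from herm_skew[of n "R.W x", OF this]
  have *: "\<i> * complex_of_real (R.W x i j) = cnj (\<i> * complex_of_real (R.W x j i))" if "i < n" "j < n" for i j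
    using that by (rule hermD)
  show ?thesis
    unfolding herm_def Hm_def
    by (intro allI impI) (simp only: complex_cnj_mult[of "complex_of_real _"] complex_cnj_complex_of_real *[symmetric])
qed

lemma xv_0: "xv x w 0 = w"
  by (simp add: xv_def fun_eq_iff)

end

section \<open>Three-term recursion of the non-backtracking sums\<close>

lemma nb_split:
  assumes "u < n" "u \<noteq> v" "v < n"
  shows "nb n A w (Suc l) u u = nb n A w (Suc l) v u + complex_of_real (A u v) * nb n A w l u v"
proof -
  have "{..<n} - {u, u} = insert v ({..<n} - {u, v})" using assms by auto
  then show ?thesis by (simp add: add.commute)
qed

text \<open>A free step followed by a non-backtracking walk either remains non-backtracking or
  returns to \<open>v\<close> at once, and each return contributes
  \<open>A v u * A u v = - 1\<close>. The rest of a returning walk, if it has positive length,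
  occurs for every \<open>u\<close> except its own first target, hence \<open>n - 2\<close>; for
  length 0 no \<open>u\<close> is excluded, hence \<open>n - 1\<close>.\<close>

lemma nb_recursion:
  assumes A: "\<And>i j. i < n \<Longrightarrow> j < n \<Longrightarrow> i \<noteq> j \<Longrightarrow> A i j * A j i = - 1" "\<And>i. A i i = 0" and v: "v < n"
  shows "(\<Sum>u<n. complex_of_real (A v u) * nb n A w (Suc l) u u)
    = nb n A w (Suc (Suc l)) v v - (if l = 0 then of_nat n - 1 else of_nat n - 2) * nb n A w l v v"
proof -
  let ?S = "{..<n} - {v}"
  have card: "complex_of_nat (card ?S) = of_nat n - 1" using v by (simp add: of_nat_diff)
  have sumS: "(\<Sum>u<n. complex_of_real (A v u) * f u) = (\<Sum>u\<in>?S. complex_of_real (A v u) * f u)" for f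
    by (rule sum.mono_neutral_right) (auto simp: A(2))
  have inv: "complex_of_real (A v u) * complex_of_real (A u v) = - 1" if "u \<in> ?S" for u
    using A(1)[of v u] that v by (auto simp flip: of_real_mult)
  have "(\<Sum>u<n. complex_of_real (A v u) * nb n A w (Suc l) u u)
     = (\<Sum>u\<in>?S. complex_of_real (A v u) * nb n A w (Suc l) v u - nb n A w l u v)"
    unfolding sumS
  proof (rule sum.cong[OF refl])
    fix u assume u: "u \<in> ?S"
    have "complex_of_real (A v u) * nb n A w (Suc l) u u = complex_of_real (A v u) * nb n A w (Suc l) v u
        + (complex_of_real (A v u) * complex_of_real (A u v)) * nb n A w l u v"
      using u v by (subst nb_split[of u n v]) (auto simp: algebra_simps)
    then show "complex_of_real (A v u) * nb n A w (Suc l) u u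
        = complex_of_real (A v u) * nb n A w (Suc l) v u - nb n A w l u v"
      by (simp add: inv[OF u])
  qed
  also have "\<dots> = nb n A w (Suc (Suc l)) v v - (\<Sum>u\<in>?S. nb n A w l u v)"
    by (simp add: sum_subtractf)
  also have "(\<Sum>u\<in>?S. nb n A w l u v) = (if l = 0 then of_nat n - 1 else of_nat n - 2) * nb n A w l v v"
  proof (cases l)
    case 0
    then show ?thesis using card by simp
  next
    case (Suc k)
    have "(\<Sum>u\<in>?S. nb n A w (Suc k) u v) = (\<Sum>u\<in>?S. nb n A w (Suc k) v v - complex_of_real (A v u) * nb n A w k v u)"
    proof (rule sum.cong[OF refl])
      fix u assume "u \<in> ?S"
      then have "u < n" "v \<noteq> u" by auto
      from nb_split[OF v this(2,1), of A w k]
      show "nb n A w (Suc k) u v = nb n A w (Suc k) v v - complex_of_real (A v u) * nb n A w k v u"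
        by (simp only: add_diff_cancel_right')
    qed
    also have "\<dots> = (of_nat n - 1) * nb n A w (Suc k) v v - nb n A w (Suc k) v v"
      using card by (simp add: sum_subtractf)
    finally show ?thesis using Suc by (simp add: algebra_simps)
  qed
  finally show ?thesis .
qed

context coupled_model
begin

lemma Hm_xv_0:
  assumes "v < n"
  shows "mv n (Hm x) (xv x w 0) v = xv x w 1 v"
proof -
  have "(\<Sum>u<n. complex_of_real (R.W x v u) * w u) = (\<Sum>u\<in>{..<n} - {v}. complex_of_real (R.W x v u) * w u)"
    by (rule sum.mono_neutral_right) (auto simp: R.W_def)
  then have "(\<i> / complex_of_real (sqrt (real n))) * (\<Sum>u<n. complex_of_real (R.W x v u) * w u)
     = (\<i> / complex_of_real (sqrt (real n))) * (\<Sum>u\<in>{..<n} - {v}. complex_of_real (R.W x v u) * w u)"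
    by simp
  then show ?thesis by (simp add: mv_def Hm_def xv_def sum_divide_distrib sum_distrib_left mult_ac)
qed

text \<open>Two factors \<open>\<i>\<close> turn the minus sign of \<open>nb_recursion\<close> into
  a plus: \<open>H U_(l+1) = U_(l+2) + U_l\<close>, up to the coefficient.\<close>

lemma Hm_xv_Suc:
  assumes v: "v < n" and x: "x \<in> set_pmf M"
  shows "mv n (Hm x) (xv x w (Suc l)) v
    = xv x w (Suc (Suc l)) v + complex_of_real ((if l = 0 then real n - 1 else real n - 2) / real n) * xv x w l v"
proof -
  let ?r = "complex_of_real (sqrt (real n))"
  have r: "?r \<noteq> 0" "?r * ?r = of_nat n" using n by (auto simp flip: of_real_mult)
  have "R.W x i j * R.W x j i = - 1" if "i < n" "j < n" "i \<noteq> j" for i j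
    using in_M[OF x edgesI[OF that]] rank_sign_skew[OF that(3)] that
    by (auto simp: R.W_def insert_commute rank_sign_def)
  from nb_recursion[of n "R.W x" v w l, OF this _ v]
  have rec: "(\<Sum>u<n. complex_of_real (R.W x v u) * nb n (R.W x) w (Suc l) u u)
    = nb n (R.W x) w (Suc (Suc l)) v v - (if l = 0 then of_nat n - 1 else of_nat n - 2) * nb n (R.W x) w l v v"
    by (simp add: R.W_def)
  have "mv n (Hm x) (xv x w (Suc l)) v
     = \<i> ^ Suc (Suc l) / ?r ^ Suc (Suc l) * (\<Sum>u<n. complex_of_real (R.W x v u) * nb n (R.W x) w (Suc l) u u)"
    unfolding mv_def Hm_def xv_def sum_distrib_left by (intro sum.cong refl) (simp add: field_simps)
  also have "\<dots> = xv x w (Suc (Suc l)) v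
      + (if l = 0 then of_nat n - 1 else of_nat n - 2) / (?r * ?r) * xv x w l v"
  proof -
    have alg: "\<i> ^ Suc (Suc l) / c ^ Suc (Suc l) * (P - \<kappa> * Q)
        = \<i> ^ Suc (Suc l) / c ^ Suc (Suc l) * P + \<kappa> / (c * c) * (\<i> ^ l / c ^ l * Q)" for c P Q \<kappa>
      by (simp add: right_diff_distrib diff_divide_distrib mult_ac)
    show ?thesis unfolding rec xv_def of_real_power by (rule alg)
  qed
  finally show ?thesis unfolding r(2) by simp
qed

end

section \<open>Spectrum of the transitive tournament\<close>

lemma sum_cis_power_eq_0:
  fixes d :: int
  assumes "\<bar>d\<bar> < int n" "d \<noteq> 0"
  shows "(\<Sum>k<n. cis (2 * pi * of_int d / real n) ^ k) = 0"
proof -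
  let ?w = "cis (2 * pi * of_int d / real n)"
  have n: "n > 0" using assms by auto
  have "?w \<noteq> 1"
  proof
    assume "?w = 1"
    then obtain j :: int where "2 * pi * of_int d / real n = 2 * pi * of_int j"
      by (auto simp: cis_conv_exp exp_eq_1)
    then have "real_of_int d = real_of_int (j * int n)" using n by (simp add: field_simps)
    then have "d = j * int n" by linarith
    with assms have "int n dvd d" "\<bar>d\<bar> < int n" "d \<noteq> 0" by auto
    then show False using zdvd_not_zless[of "\<bar>d\<bar>" "int n"] by auto
  qed
  moreover have "?w ^ n = 1"
  proof -
    have "?w ^ n = cis (2 * pi * of_int d)" using n by (simp add: Complex.DeMoivre)
    also have "\<dots> = 1" by (simp add: cis_conv_exp exp_eq_1)
    finally show ?thesis .
  qed
  ultimately show ?thesis by (simp add: geometric_sum)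
qed

context coupled_model
begin

text \<open>In terms of ranks the signal is the sign of a difference, which extends antiperiodically
  with period \<open>n\<close>; hence the odd multiples of \<open>pi / n\<close>. The index
  \<open>k\<close> ranges over all integers, and any \<open>n\<close> consecutive values give an
  orthonormal basis.\<close>

definition uv :: "int \<Rightarrow> nat \<Rightarrow> complex" where
  "uv k a = cis (- (2 * of_int k + 1) * pi * real (\<sigma> a) / real n) / complex_of_real (sqrt (real n))"

definition mu :: "int \<Rightarrow> real" where
  "mu k = cot ((2 * of_int k + 1) * pi / (2 * real n))"

lemma norm_uv: "norm (uv k a) = 1 / sqrt (real n)"
  by (simp add: uv_def norm_divide)

lemma sin_half_angle: "sin ((2 * of_int k + 1) * pi / (2 * real n)) \<noteq> 0" for k :: int
proof
  assume "sin ((2 * of_int k + 1) * pi / (2 * real n)) = 0"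
  then obtain j :: int where "(2 * of_int k + 1) * pi / (2 * real n) = of_int j * pi"
    unfolding sin_zero_iff_int2 by blast
  then have "pi * ((2 * of_int k + 1) / (2 * real n)) = pi * of_int j" by (simp add: mult_ac)
  then have "(2 * of_int k + 1) / (2 * real n) = real_of_int j"
    by (simp only: mult_left_cancel[OF pi_neq_zero])
  then have "real_of_int (2 * k + 1) = real_of_int (2 * (j * int n))"
    using n by (simp add: field_simps)
  then have "2 * k + 1 = 2 * (j * int n)" by (simp only: of_int_eq_iff)
  then show False by presburger
qed

lemma S_uv:
  assumes a: "a < n"
  shows "mv n (\<lambda>i j. \<i> * complex_of_real (S i j)) (uv k) a = complex_of_real (mu k) * uv k a"
proof -
  let ?h = "(2 * of_int k + 1) * pi / (2 * real n)"
  let ?r = "complex_of_real (sqrt (real n))"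
  define c where "c = complex_of_real (cos ?h)"
  define s where "s = complex_of_real (sin ?h)"
  define z where "z = cis (- (2 * of_int k + 1) * pi / real n)"
  have s0: "s \<noteq> 0" using sin_half_angle[of k] by (simp add: s_def)
  have z_half: "z = cis (- ?h) * cis (- ?h)"
    unfolding z_def cis_mult by (rule arg_cong[where f = cis]) (use n in \<open>simp add: field_simps\<close>)
  have cis_h: "cis (- ?h) = c - \<i> * s"
    by (simp add: complex_eq_iff c_def s_def)
  have cs: "c * c + s * s = 1"
  proof -
    have "complex_of_real (cos ?h * cos ?h + sin ?h * sin ?h) = 1"
      using sin_cos_squared_add[of ?h] by (simp add: power2_eq_square add.commute)
    then show ?thesis by (simp only: c_def s_def of_real_add of_real_mult)
  qed
  have z1: "1 + z = 2 * c * (c - \<i> * s)"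
    unfolding z_half cis_h cs[symmetric] by (simp add: algebra_simps)
  have z2: "1 - z = 2 * \<i> * s * (c - \<i> * s)"
    unfolding z_half cis_h cs[symmetric] by (simp add: algebra_simps)
  have e0: "c - \<i> * s \<noteq> 0" using cis_h cis_neq_zero by metis
  have z_ne: "1 - z \<noteq> 0" using s0 e0 by (simp add: z2)
  have mu: "complex_of_real (mu k) = c / s" by (simp add: mu_def cot_def c_def s_def)
  \<comment> \<open>With \<open>z = exp(- 2 \<i> h)\<close> the quotient
    \<open>\<i> (1 + z) / (1 - z)\<close> is \<open>cot h\<close>.\<close>
  have ratio: "\<i> * (1 + z) = complex_of_real (mu k) * (1 - z)"
    unfolding z1 z2 mu using s0 by (simp add: field_simps)
  have zn: "z ^ n = - 1"
  proof -
    have "z ^ n = cis (real n * (- (2 * of_int k + 1) * pi / real n))" unfolding z_def by (rule Complex.DeMoivre)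
    also have "real n * (- (2 * of_int k + 1) * pi / real n) = - (2 * of_int k + 1) * pi" using n by simp
    also have "cis (- (2 * of_int k + 1) * pi) = cis (2 * pi * of_int (- k)) * cis (- pi)"
      unfolding cis_mult by (rule arg_cong[where f = cis]) (simp add: algebra_simps)
    also have "cis (2 * pi * of_int (- k)) = 1"
      by (simp only: cis_conv_exp exp_eq_1) (auto intro!: exI[of _ "- k"])
    finally show ?thesis by (simp add: cis_minus_pi_half complex_eq_iff)
  qed
  have uv: "uv k j = z ^ \<sigma> j / ?r" for j
    unfolding uv_def z_def Complex.DeMoivre by (simp add: mult_ac)
  define p where "p = \<sigma> a"
  have p: "p < n" using a permutes_in_image[OF perm, of a] by (simp add: p_def)
  have "(\<Sum>j<n. complex_of_real (S a j) * z ^ \<sigma> j)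
     = (\<Sum>j<n. (\<lambda>b. (if b = p then 0 else if p < b then 1 else - 1) * z ^ b) (\<sigma> j))"
    using permutes_inj[OF perm] by (intro sum.cong refl) (auto simp: S_def rank_sign_def p_def dest: injD)
  also have "\<dots> = (\<Sum>b<n. (if b = p then 0 else if p < b then 1 else - 1) * z ^ b)"
    using sum.permute[OF perm, of "\<lambda>b. (if b = p then 0 else if p < b then 1 else - 1) * z ^ b"]
    by (simp add: comp_def)
  also have "\<dots> = (\<Sum>b<n. z ^ b) - 2 * (\<Sum>b<p. z ^ b) - z ^ p"
  proof -
    have "(\<Sum>b<n. (if b = p then 0 else if p < b then 1 else - 1) * z ^ b)
        = (\<Sum>b<n. z ^ b - (if b < p then 2 * z ^ b else 0) - (if b = p then z ^ b else 0))"
      by (intro sum.cong) auto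
    also have "\<dots> = (\<Sum>b<n. z ^ b) - (\<Sum>b<n. if b < p then 2 * z ^ b else 0) - z ^ p"
      using p by (simp add: sum_subtractf)
    also have "(\<Sum>b<n. if b < p then 2 * z ^ b else 0) = (\<Sum>b<p. 2 * z ^ b)"
      using p by (intro sum.mono_neutral_cong_right) auto
    finally show ?thesis by (simp add: sum_distrib_left)
  qed
  finally have sum: "(\<Sum>j<n. complex_of_real (S a j) * z ^ \<sigma> j) = (\<Sum>b<n. z ^ b) - 2 * (\<Sum>b<p. z ^ b) - z ^ p" .
  \<comment> \<open>The factor \<open>1 - z\<close> telescopes both geometric sums; then
    \<open>z ^ n = - 1\<close> makes the constants cancel, which leaves a multiple of
    \<open>z ^ p\<close>.\<close>
  have "(1 - z) * (\<Sum>j<n. complex_of_real (S a j) * z ^ \<sigma> j)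
      = (1 - z ^ n) - 2 * (1 - z ^ p) - (1 - z) * z ^ p"
    unfolding sum right_diff_distrib mult.left_commute[of "1 - z" 2]
    by (simp only: one_diff_power_eq[symmetric] right_diff_distrib mult_1_right)
  then have S_sum: "(1 - z) * (\<Sum>j<n. complex_of_real (S a j) * z ^ \<sigma> j) = (1 + z) * z ^ p"
    by (simp add: zn algebra_simps)
  have "(1 - z) * (\<i> * (\<Sum>j<n. complex_of_real (S a j) * z ^ \<sigma> j)) = (\<i> * (1 + z)) * z ^ p"
    using arg_cong[OF S_sum, of "\<lambda>x. \<i> * x"] by (simp add: mult_ac)
  also have "\<dots> = (1 - z) * (complex_of_real (mu k) * z ^ p)"
    unfolding ratio by (simp add: mult_ac)
  finally have "\<i> * (\<Sum>j<n. complex_of_real (S a j) * z ^ \<sigma> j) = complex_of_real (mu k) * z ^ p"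
    using z_ne by (simp only: mult_cancel_left) simp
  then have "(\<i> * (\<Sum>j<n. complex_of_real (S a j) * z ^ \<sigma> j)) / ?r = complex_of_real (mu k) * (z ^ p / ?r)"
    by simp
  then show ?thesis
    by (simp add: mv_def uv p_def sum_distrib_left sum_divide_distrib mult_ac)
qed

lemma uv_mult: "cnj (uv k a) * uv l b
    = cis ((2 * of_int k + 1) * pi * real (\<sigma> a) / real n - (2 * of_int l + 1) * pi * real (\<sigma> b) / real n) / of_nat n"
proof -
  have r: "complex_of_real (sqrt (real n)) * complex_of_real (sqrt (real n)) = of_nat n"
    by (simp flip: of_real_mult)
  have m: "- (- (2 * of_int k + 1) * pi * real (\<sigma> a) / real n) = (2 * of_int k + 1) * pi * real (\<sigma> a) / real n"
    by (simp only: mult_minus_left minus_divide_left[symmetric] minus_minus)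
  have "cnj (uv k a) * uv l b = cis ((2 * of_int k + 1) * pi * real (\<sigma> a) / real n)
      * cis (- (2 * of_int l + 1) * pi * real (\<sigma> b) / real n) / of_nat n"
    unfolding uv_def complex_cnj_divide cis_cnj complex_cnj_complex_of_real m times_divide_times_eq r ..
  also have "- (2 * of_int l + 1) * pi * real (\<sigma> b) / real n = - ((2 * of_int l + 1) * pi * real (\<sigma> b) / real n)"
    by (simp only: mult_minus_left minus_divide_left)
  finally show ?thesis by (simp only: cis_mult add_uminus_conv_diff)
qed

lemma uv_orthonormal:
  assumes "\<bar>k - l\<bar> < int n"
  shows "ip n (uv k) (uv l) = (if k = l then 1 else 0)"
proof -
  have "ip n (uv k) (uv l) = (\<Sum>a<n. (\<lambda>b. cis (2 * pi * of_int (k - l) / real n) ^ b / of_nat n) (\<sigma> a))"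
    unfolding ip_def uv_mult Complex.DeMoivre
    by (intro sum.cong refl arg_cong[where f = "\<lambda>x. cis x / _"]) (simp add: field_simps)
  also have "\<dots> = (\<Sum>b<n. cis (2 * pi * of_int (k - l) / real n) ^ b / of_nat n)"
    using sum.permute[OF perm, of "\<lambda>b. cis (2 * pi * of_int (k - l) / real n) ^ b / of_nat n"]
    by (simp add: comp_def)
  also have "\<dots> = (\<Sum>b<n. cis (2 * pi * of_int (k - l) / real n) ^ b) / of_nat n"
    by (simp add: sum_divide_distrib)
  also have "\<dots> = (if k = l then 1 else 0)"
  proof (cases "k = l")
    case False
    then show ?thesis using sum_cis_power_eq_0[of "k - l" n] assms by simp
  qed (use n in simp)
  finally show ?thesis .
qed

text \<open>The shift \<open>K\<close> selects which \<open>n\<close> consecutive modes form the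
  basis. A positive shift puts finitely many negative modes at the front, as the lower bound on the
  largest eigenvalue requires.\<close>

lemma uv_complete:
  assumes "a < n" "b < n"
  shows "(\<Sum>k<n. cnj (uv (int k - K) a) * uv (int k - K) b) = (if a = b then 1 else 0)"
proof -
  define d where "d = int (\<sigma> a) - int (\<sigma> b)"
  have \<sigma>: "\<sigma> a < n" "\<sigma> b < n" using assms permutes_in_image[OF perm] by auto
  have "(\<Sum>k<n. cnj (uv (int k - K) a) * uv (int k - K) b)
      = (\<Sum>k<n. cis ((1 - 2 * of_int K) * pi * of_int d / real n) * cis (2 * pi * of_int d / real n) ^ k / of_nat n)"
    unfolding uv_mult Complex.DeMoivre cis_mult
    by (intro sum.cong refl arg_cong[where f = "\<lambda>x. cis x / _"]) (simp add: d_def field_simps)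
  also have "\<dots> = cis ((1 - 2 * of_int K) * pi * of_int d / real n) * (\<Sum>k<n. cis (2 * pi * of_int d / real n) ^ k) / of_nat n"
    by (simp add: sum_distrib_left sum_divide_distrib)
  also have "\<dots> = (if a = b then 1 else 0)"
  proof (cases "a = b")
    case True
    then show ?thesis using n by (simp add: d_def)
  next
    case False
    then have "d \<noteq> 0" using permutes_inj[OF perm] by (auto simp: d_def dest: injD)
    then show ?thesis using False \<sigma> sum_cis_power_eq_0[of d n] by (simp add: d_def)
  qed
  finally show ?thesis .
qed

lemma uv_expansion:
  assumes "a < n"
  shows "v a = (\<Sum>k<n. ip n (uv (int k - K)) v * uv (int k - K) a)"
proof -
  have "(\<Sum>k<n. ip n (uv (int k - K)) v * uv (int k - K) a)
      = (\<Sum>b<n. (\<Sum>k<n. cnj (uv (int k - K) b) * uv (int k - K) a) * v b)"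
    unfolding ip_def sum_distrib_right by (subst sum.swap) (simp add: mult_ac)
  also have "\<dots> = (\<Sum>b<n. if b = a then v b else 0)"
    using assms by (intro sum.cong refl, subst uv_complete) auto
  also have "\<dots> = v a" using assms by simp
  finally show ?thesis ..
qed

lemma parseval: "qn n v = (\<Sum>k<n. (cmod (ip n (uv (int k - K)) v))\<^sup>2)"
proof -
  have "complex_of_real (qn n v) = ip n v (\<lambda>a. \<Sum>k<n. ip n (uv (int k - K)) v * uv (int k - K) a)"
    unfolding ip_self[symmetric] by (intro ip_cong refl uv_expansion)
  also have "\<dots> = (\<Sum>k<n. ip n (uv (int k - K)) v * cnj (ip n (uv (int k - K)) v))"
    unfolding ip_sum_right ip_scale_right by (simp add: ip_commute[of n v])
  also have "\<dots> = complex_of_real (\<Sum>k<n. (cmod (ip n (uv (int k - K)) v))\<^sup>2)"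
    by (simp only: of_real_sum complex_norm_square)
  finally show ?thesis by (simp only: of_real_eq_iff)
qed

lemma form_S: "form n (\<lambda>i j. \<i> * complex_of_real (S i j)) v
    = (\<Sum>k<n. mu (int k - K) * (cmod (ip n (uv (int k - K)) v))\<^sup>2)"
proof -
  let ?A = "\<lambda>i j. \<i> * complex_of_real (S i j)"
  let ?c = "\<lambda>k. ip n (uv (int k - K)) v"
  have "mv n ?A v a = (\<Sum>k<n. ?c k * (complex_of_real (mu (int k - K)) * uv (int k - K) a))" if "a < n" for a
  proof -
    have "mv n ?A v a = mv n ?A (\<lambda>a. \<Sum>k<n. ?c k * uv (int k - K) a) a"
      unfolding mv_def using uv_expansion by (intro sum.cong refl) auto
    also have "\<dots> = (\<Sum>k<n. ?c k * mv n ?A (uv (int k - K)) a)"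
      by (simp only: mv_sum mv_scale)
    finally show ?thesis using S_uv[OF that] by simp
  qed
  then have "ip n v (mv n ?A v) = ip n v (\<lambda>a. \<Sum>k<n. ?c k * (complex_of_real (mu (int k - K)) * uv (int k - K) a))"
    by (intro ip_cong refl)
  also have "\<dots> = (\<Sum>k<n. complex_of_real (mu (int k - K)) * (?c k * cnj (?c k)))"
    unfolding ip_sum_right ip_scale_right by (simp add: ip_commute[of n v] mult_ac)
  also have "\<dots> = complex_of_real (\<Sum>k<n. mu (int k - K) * (cmod (?c k))\<^sup>2)"
    by (simp only: of_real_sum of_real_mult complex_norm_square)
  finally show ?thesis by (simp only: form_def Re_complex_of_real)
qed

end

section \<open>Chebyshev vectors\<close>

text \<open>What remains of the model once the random estimates are made. The filter is abstract, so
  that limits can be uniform over all good outcomes. Orthonormality is assumed only against the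
  initial vectors \<open>xs i k 0\<close>, but up to length \<open>2 * m0\<close>: moving all of
  \<open>p\<close> to the other side of an inner product produces lengths up to
  \<open>p + m\<close>.\<close>

locale chebyshev_frame =
  fixes F :: "'i filter" and N :: "'i \<Rightarrow> nat" and H :: "'i \<Rightarrow> nat \<Rightarrow> nat \<Rightarrow> complex"
    and xs :: "'i \<Rightarrow> 'k \<Rightarrow> nat \<Rightarrow> nat \<Rightarrow> complex" and al :: "'i \<Rightarrow> nat \<Rightarrow> real"
    and Q :: "'k set" and m0 :: nat
  assumes finite_Q: "finite Q"
    and herm_H: "\<forall>\<^sub>F i in F. herm (N i) (H i)"
    and H_0: "\<forall>\<^sub>F i in F. \<forall>k. \<forall>a<N i. mv (N i) (H i) (xs i k 0) a = xs i k 1 a"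
    and H_Suc: "\<forall>\<^sub>F i in F. \<forall>k l. \<forall>a<N i. mv (N i) (H i) (xs i k (Suc l)) a
      = xs i k (Suc (Suc l)) a + complex_of_real (al i l) * xs i k l a"
    and al: "\<And>l. ((\<lambda>i. al i l) \<longlongrightarrow> 1) F"
    and gram_0: "\<And>k k' m. k \<in> Q \<Longrightarrow> k' \<in> Q \<Longrightarrow> m \<le> 2 * m0 \<Longrightarrow>
      ((\<lambda>i. ip (N i) (xs i k 0) (xs i k' m)) \<longlongrightarrow> (if k = k' \<and> m = 0 then 1 else 0)) F"
begin

text \<open>The value 0 at \<open>p = 0\<close> makes the truncated \<open>p - 1\<close> harmless
  and merges the two cases of the recursion.\<close>

definition alm :: "'i \<Rightarrow> nat \<Rightarrow> real" where
  "alm i p = (if p = 0 then 0 else al i (p - 1))"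

lemma alm_lim: "((\<lambda>i. alm i p) \<longlongrightarrow> (if p = 0 then 0 else 1)) F"
  by (cases p) (simp_all add: alm_def al)

lemma H_xs: "\<forall>\<^sub>F i in F. \<forall>k p. \<forall>a<N i. mv (N i) (H i) (xs i k p) a
    = xs i k (Suc p) a + complex_of_real (alm i p) * xs i k (p - 1) a"
  using H_0 H_Suc
proof eventually_elim
  case (elim i)
  show ?case
  proof (intro allI impI)
    fix k p a assume "a < N i"
    with elim show "mv (N i) (H i) (xs i k p) a = xs i k (Suc p) a + complex_of_real (alm i p) * xs i k (p - 1) a"
      by (cases p) (simp_all add: alm_def)
  qed
qed

text \<open>\<open>H\<close> is Hermitian and can be moved across the inner product, which trades a
  unit of \<open>p\<close> for a unit of \<open>m\<close>.\<close>

lemma gram_rec: "\<forall>\<^sub>F i in F. \<forall>k k' p m.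
    ip (N i) (xs i k (Suc p)) (xs i k' m) =
    ip (N i) (xs i k p) (xs i k' (Suc m)) + complex_of_real (alm i m) * ip (N i) (xs i k p) (xs i k' (m - 1))
    - complex_of_real (alm i p) * ip (N i) (xs i k (p - 1)) (xs i k' m)"
  using herm_H H_xs
proof eventually_elim
  case (elim i)
  show ?case
  proof (intro allI)
    fix k k' p m
    have "ip (N i) (xs i k p) (mv (N i) (H i) (xs i k' m))
        = ip (N i) (xs i k p) (\<lambda>a. xs i k' (Suc m) a + complex_of_real (alm i m) * xs i k' (m - 1) a)"
      using elim(2) by (intro ip_cong) auto
    moreover have "ip (N i) (mv (N i) (H i) (xs i k p)) (xs i k' m)
        = ip (N i) (\<lambda>a. xs i k (Suc p) a + complex_of_real (alm i p) * xs i k (p - 1) a) (xs i k' m)"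
      using elim(2) by (intro ip_cong) auto
    ultimately have "ip (N i) (\<lambda>a. xs i k (Suc p) a + complex_of_real (alm i p) * xs i k (p - 1) a) (xs i k' m)
        = ip (N i) (xs i k p) (\<lambda>a. xs i k' (Suc m) a + complex_of_real (alm i m) * xs i k' (m - 1) a)"
      using herm_ip[OF elim(1)] by metis
    then show "ip (N i) (xs i k (Suc p)) (xs i k' m) =
      ip (N i) (xs i k p) (xs i k' (Suc m)) + complex_of_real (alm i m) * ip (N i) (xs i k p) (xs i k' (m - 1))
      - complex_of_real (alm i p) * ip (N i) (xs i k (p - 1)) (xs i k' m)"
      by (simp add: ip_add_left ip_add_right ip_scale_left ip_scale_right algebra_simps)
  qed
qed

lemma gram:
  assumes "k \<in> Q" "k' \<in> Q"
  shows "p + m \<le> 2 * m0 \<Longrightarrow>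
    ((\<lambda>i. ip (N i) (xs i k p) (xs i k' m)) \<longlongrightarrow> (if k = k' \<and> p = m then 1 else 0)) F"
proof (induction p arbitrary: m rule: less_induct)
  case (less p)
  show ?case
  proof (cases p)
    case 0
    then show ?thesis using gram_0[OF assms, of m] less.prems by (cases m) simp_all
  next
    case (Suc q)
    have 1: "((\<lambda>i. ip (N i) (xs i k q) (xs i k' (Suc m))) \<longlongrightarrow> (if k = k' \<and> q = Suc m then 1 else 0)) F"
      using Suc less.prems by (intro less.IH) auto
    have 2: "((\<lambda>i. complex_of_real (alm i m) * ip (N i) (xs i k q) (xs i k' (m - 1)))
        \<longlongrightarrow> complex_of_real (if m = 0 then 0 else 1) * (if k = k' \<and> q = m - 1 then 1 else 0)) F"
      using Suc less.prems by (intro tendsto_mult tendsto_of_real alm_lim less.IH) auto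
    have 3: "((\<lambda>i. complex_of_real (alm i q) * ip (N i) (xs i k (q - 1)) (xs i k' m))
        \<longlongrightarrow> complex_of_real (if q = 0 then 0 else 1) * (if k = k' \<and> q - 1 = m then 1 else 0)) F"
      using Suc less.prems by (intro tendsto_mult tendsto_of_real alm_lim less.IH) auto
    have lim: "((\<lambda>i. ip (N i) (xs i k q) (xs i k' (Suc m)) + complex_of_real (alm i m) * ip (N i) (xs i k q) (xs i k' (m - 1))
        - complex_of_real (alm i q) * ip (N i) (xs i k (q - 1)) (xs i k' m)) \<longlongrightarrow>
        (if k = k' \<and> q = Suc m then 1 else 0)
        + complex_of_real (if m = 0 then 0 else 1) * (if k = k' \<and> q = m - 1 then 1 else 0)
        - complex_of_real (if q = 0 then 0 else 1) * (if k = k' \<and> q - 1 = m then 1 else 0)) F"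
      by (intro tendsto_add tendsto_diff 1 2 3)
    have eq: "(if k = k' \<and> q = Suc m then 1 else 0)
        + complex_of_real (if m = 0 then 0 else 1) * (if k = k' \<and> q = m - 1 then 1 else 0)
        - complex_of_real (if q = 0 then 0 else 1) * (if k = k' \<and> q - 1 = m then 1 else 0)
        = (if k = k' \<and> p = m then 1 else 0)"
      using Suc by auto
    show ?thesis
    proof (rule Lim_transform_eventually[OF lim[unfolded eq]])
      show "\<forall>\<^sub>F i in F. ip (N i) (xs i k q) (xs i k' (Suc m)) + complex_of_real (alm i m) * ip (N i) (xs i k q) (xs i k' (m - 1))
        - complex_of_real (alm i q) * ip (N i) (xs i k (q - 1)) (xs i k' m) = ip (N i) (xs i k p) (xs i k' m)"
        unfolding Suc using gram_rec by eventually_elim simp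
    qed
  qed
qed

definition comb :: "'i \<Rightarrow> 'k \<Rightarrow> (nat \<Rightarrow> real) \<Rightarrow> nat \<Rightarrow> complex" where
  "comb i k c a = (\<Sum>m\<le>m0. complex_of_real (c m) * xs i k m a)"

text \<open>The action of \<open>H\<close> on coefficient sequences: a Jacobi matrix that becomes
  the free one in the limit.\<close>

definition shift :: "'i \<Rightarrow> (nat \<Rightarrow> real) \<Rightarrow> nat \<Rightarrow> real" where
  "shift i c m = (if m = 0 then 0 else c (m - 1)) + al i m * c (Suc m)"

lemma shift_lim: "((\<lambda>i. shift i c m) \<longlongrightarrow> (if m = 0 then 0 else c (m - 1)) + c (Suc m)) F"
  unfolding shift_def using tendsto_mult[OF al[of m] tendsto_const[of "c (Suc m)"]]
  by (intro tendsto_add tendsto_const) simp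

lemma comb_ip:
  assumes "k \<in> Q" "k' \<in> Q"
    and "\<And>m. ((\<lambda>i. c i m) \<longlongrightarrow> C m) F" "\<And>m. ((\<lambda>i. d i m) \<longlongrightarrow> D m) F"
  shows "((\<lambda>i. ip (N i) (comb i k (c i)) (comb i k' (d i))) \<longlongrightarrow>
    (if k = k' then complex_of_real (\<Sum>m\<le>m0. C m * D m) else 0)) F"
proof -
  have lim: "((\<lambda>i. \<Sum>m'\<le>m0. complex_of_real (d i m') * (\<Sum>m\<le>m0. complex_of_real (c i m) * ip (N i) (xs i k m) (xs i k' m')))
     \<longlongrightarrow> (\<Sum>m'\<le>m0. complex_of_real (D m') * (\<Sum>m\<le>m0. complex_of_real (C m) * (if k = k' \<and> m = m' then 1 else 0)))) F"
    using assms by (intro tendsto_sum tendsto_mult tendsto_of_real gram) auto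
  have lhs: "(\<Sum>m'\<le>m0. complex_of_real (d i m') * (\<Sum>m\<le>m0. complex_of_real (c i m) * ip (N i) (xs i k m) (xs i k' m')))
     = ip (N i) (comb i k (c i)) (comb i k' (d i))" for i
    by (simp only: comb_def[abs_def] ip_sum_right ip_scale_right)
      (simp only: ip_sum_left ip_scale_left complex_cnj_complex_of_real)
  have rhs: "(\<Sum>m'\<le>m0. complex_of_real (D m') * (\<Sum>m\<le>m0. complex_of_real (C m) * (if k = k' \<and> m = m' then 1 else 0)))
     = (if k = k' then complex_of_real (\<Sum>m\<le>m0. C m * D m) else 0)"
    by (auto simp: mult_ac if_distrib cong: if_cong)
  show ?thesis using lim unfolding lhs rhs .
qed

text \<open>Coefficients that vanish from \<open>m0\<close> on leave room for the shift: the image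
  is again a combination of lengths up to \<open>m0\<close>.\<close>

lemma comb_H: "\<forall>\<^sub>F i in F. \<forall>k c. (\<forall>m\<ge>m0. c m = 0) \<longrightarrow>
    (\<forall>a<N i. mv (N i) (H i) (comb i k c) a = comb i k (shift i c) a)"
  using H_xs
proof eventually_elim
  case (elim i)
  show ?case
  proof (intro allI impI)
    fix k a and c :: "nat \<Rightarrow> real" assume c: "\<forall>m\<ge>m0. c m = 0" and a: "a < N i"
    let ?x = "\<lambda>m. xs i k m a"
    let ?c = "\<lambda>m. complex_of_real (c m)"
    have "mv (N i) (H i) (comb i k c) a = (\<Sum>m\<le>m0. ?c m * mv (N i) (H i) (xs i k m) a)"
      unfolding comb_def[abs_def] mv_sum mv_scale ..
    also have "\<dots> = (\<Sum>m\<le>m0. ?c m * ?x (Suc m)) + (\<Sum>m\<le>m0. ?c m * complex_of_real (alm i m) * ?x (m - 1))"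
      using elim a by (simp add: distrib_left sum.distrib mult.assoc)
    also have "(\<Sum>m\<le>m0. ?c m * ?x (Suc m)) = (\<Sum>m<m0. ?c m * ?x (Suc m))"
      using c by (intro sum.mono_neutral_right) auto
    also have "\<dots> = (\<Sum>m\<le>m0. complex_of_real (if m = 0 then 0 else c (m - 1)) * ?x m)"
      by (simp add: sum.atMost_shift)
    also have "(\<Sum>m\<le>m0. ?c m * complex_of_real (alm i m) * ?x (m - 1)) = (\<Sum>m<m0. ?c (Suc m) * complex_of_real (al i m) * ?x m)"
      by (simp add: sum.atMost_shift alm_def)
    also have "\<dots> = (\<Sum>m\<le>m0. complex_of_real (al i m * c (Suc m)) * ?x m)"
      using c by (intro sum.mono_neutral_cong_left) auto
    finally show "mv (N i) (H i) (comb i k c) a = comb i k (shift i c) a"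
      by (simp add: comb_def[abs_def] shift_def distrib_right sum.distrib)
  qed
qed

end

text \<open>
  If \<open>z - A\<close> is nonnegative and \<open>(z - A) y \<approx> u\<close>, then expanding \<open>z - A\<close> at
  \<open>v - (\<Sum>\<langle>u, v\<rangle> y)\<close> shows that adding the rank-one projections onto the vectors \<open>u\<close>
  does not push the form beyond \<open>z\<close>.
\<close>

lemma form_plus_projections_le:
  fixes u y r :: "'k \<Rightarrow> nat \<Rightarrow> complex"
  assumes A: "herm n A" and le: "\<And>x. form n A x \<le> z * qn n x" and Q: "finite Q"
    and inv: "\<And>k a. k \<in> Q \<Longrightarrow> a < n \<Longrightarrow> complex_of_real z * y k a - mv n A (y k) a = u k a + r k a"
    and gram: "\<And>k k'. k \<in> Q \<Longrightarrow> k' \<in> Q \<Longrightarrow>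
      cmod (ip n (y k) (\<lambda>a. u k' a + r k' a) - (if k = k' then complex_of_real g else 0)) \<le> \<eta>"
    and g: "g \<le> 1" and R: "R \<ge> 0" "\<And>k. k \<in> Q \<Longrightarrow> qn n (r k) \<le> R\<^sup>2"
    and u: "\<And>k. k \<in> Q \<Longrightarrow> qn n (u k) \<le> 1" and v: "qn n v = 1"
  shows "form n A v + (\<Sum>k\<in>Q. (cmod (ip n (u k) v))\<^sup>2) \<le> z + 2 * (real (card Q) * R) + (real (card Q))\<^sup>2 * \<eta>"
proof -
  define b where "b k = ip n (u k) v" for k
  define Y where "Y a = (\<Sum>k\<in>Q. b k * y k a)" for a
  define L where "L x = (\<lambda>a. complex_of_real z * x a - mv n A x a)" for x
  define LY where "LY a = (\<Sum>k\<in>Q. b k * (u k a + r k a))" for a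
  define B where "B = (\<Sum>k\<in>Q. (cmod (b k))\<^sup>2)"
  have b1: "cmod (b k) \<le> 1" if "k \<in> Q" for k
  proof -
    have "(cmod (b k))\<^sup>2 \<le> qn n (u k) * qn n v" unfolding b_def by (rule cauchy_schwarz)
    also have "\<dots> \<le> 1" using u[OF that] v by simp
    finally show ?thesis using power2_le_imp_le[of "cmod (b k)" 1] by simp
  qed
  have L_sym: "ip n x (L w) = ip n (L x) w" for x w
    by (simp add: L_def ip_diff_left ip_diff_right ip_scale_left ip_scale_right herm_ip[OF A])
  have L_diff: "L (\<lambda>a. x a - w a) = (\<lambda>a. L x a - L w a)" for x w
    by (simp add: L_def mv_diff fun_eq_iff algebra_simps)
  have L_form: "Re (ip n x (L x)) = z * qn n x - form n A x" for x
    by (simp add: L_def form_def ip_diff_right ip_scale_right ip_self)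
  have LY: "L Y a = LY a" if a: "a < n" for a
  proof -
    have "mv n A Y a = (\<Sum>k\<in>Q. b k * mv n A (y k) a)"
      unfolding Y_def[abs_def] by (simp only: mv_sum mv_scale)
    then have "L Y a = (\<Sum>k\<in>Q. b k * (complex_of_real z * y k a - mv n A (y k) a))"
      by (simp add: L_def Y_def sum_distrib_left sum_subtractf right_diff_distrib mult_ac)
    also have "\<dots> = LY a" unfolding LY_def using inv a by (intro sum.cong refl) simp
    finally show ?thesis .
  qed
  have "0 \<le> Re (ip n (\<lambda>a. v a - Y a) (L (\<lambda>a. v a - Y a)))"
    unfolding L_form using le[of "\<lambda>a. v a - Y a"] by simp
  also have "ip n (\<lambda>a. v a - Y a) (L (\<lambda>a. v a - Y a)) = ip n v (L v) - ip n v (L Y) - ip n Y (L v) + ip n Y (L Y)"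
    unfolding L_diff by (simp only: ip_diff_left ip_diff_right) simp
  also have "ip n v (L Y) = cnj (ip n LY v)"
    using LY by (subst ip_commute[symmetric]) (intro ip_cong refl, auto)
  also have "ip n Y (L v) = ip n LY v"
    unfolding L_sym using LY by (intro ip_cong refl) auto
  also have "ip n Y (L Y) = ip n Y LY"
    using LY by (intro ip_cong refl) auto
  finally have main: "0 \<le> z - form n A v - 2 * Re (ip n LY v) + Re (ip n Y LY)"
    using L_form[of v] v by simp
  have "ip n LY v = (\<Sum>k\<in>Q. cnj (b k) * (b k + ip n (r k) v))"
    unfolding LY_def[abs_def] by (simp only: ip_sum_left ip_scale_left ip_add_left b_def)
  also have "\<dots> = complex_of_real B + (\<Sum>k\<in>Q. cnj (b k) * ip n (r k) v)"
    unfolding B_def of_real_sum complex_norm_square by (simp add: distrib_left sum.distrib mult_ac)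
  finally have LYv: "Re (ip n LY v) = B + Re (\<Sum>k\<in>Q. cnj (b k) * ip n (r k) v)" by simp
  have "cmod (\<Sum>k\<in>Q. cnj (b k) * ip n (r k) v) \<le> (\<Sum>k\<in>Q. 1 * R)"
  proof (rule sum_norm_le)
    fix k assume k: "k \<in> Q"
    have "(cmod (ip n (r k) v))\<^sup>2 \<le> qn n (r k) * qn n v" by (rule cauchy_schwarz)
    also have "\<dots> \<le> R\<^sup>2" using R(2)[OF k] v by simp
    finally have "cmod (ip n (r k) v) \<le> R" using R(1) by (rule power2_le_imp_le)
    then show "cmod (cnj (b k) * ip n (r k) v) \<le> 1 * R"
      unfolding norm_mult complex_mod_cnj using b1[OF k] by (intro mult_mono) auto
  qed
  then have e1: "Re (\<Sum>k\<in>Q. cnj (b k) * ip n (r k) v) \<ge> - (real (card Q) * R)"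
    using abs_Re_le_cmod[of "\<Sum>k\<in>Q. cnj (b k) * ip n (r k) v"] by simp
  have YLY: "ip n Y LY = (\<Sum>k'\<in>Q. b k' * (\<Sum>k\<in>Q. cnj (b k) * ip n (y k) (\<lambda>a. u k' a + r k' a)))"
    unfolding LY_def[abs_def] Y_def[abs_def]
    by (simp only: ip_sum_right ip_scale_right) (simp only: ip_sum_left ip_scale_left)
  have "complex_of_real (g * B) = (\<Sum>k'\<in>Q. b k' * (\<Sum>k\<in>Q. cnj (b k) * (if k = k' then complex_of_real g else 0)))"
  proof -
    have "(\<Sum>k\<in>Q. cnj (b k) * (if k = k' then complex_of_real g else 0)) = cnj (b k') * complex_of_real g"
      if "k' \<in> Q" for k'
    proof -
      have "(\<Sum>k\<in>Q. cnj (b k) * (if k = k' then complex_of_real g else 0))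
          = (\<Sum>k\<in>Q. if k = k' then cnj (b k) * complex_of_real g else 0)"
        by (intro sum.cong) auto
      then show ?thesis using Q that by simp
    qed
    note delta = this
    have "complex_of_real (g * B) = (\<Sum>k'\<in>Q. complex_of_real g * (b k' * cnj (b k')))"
      by (simp only: B_def sum_distrib_left of_real_sum of_real_mult complex_norm_square)
    also have "\<dots> = (\<Sum>k'\<in>Q. b k' * (\<Sum>k\<in>Q. cnj (b k) * (if k = k' then complex_of_real g else 0)))"
      by (intro sum.cong refl) (simp only: delta mult_ac)
    finally show ?thesis .
  qed
  then have "ip n Y LY - complex_of_real (g * B)
      = (\<Sum>k'\<in>Q. b k' * (\<Sum>k\<in>Q. cnj (b k) * (ip n (y k) (\<lambda>a. u k' a + r k' a) - (if k = k' then complex_of_real g else 0))))"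
    by (simp only: YLY right_diff_distrib sum_subtractf)
  also have "cmod \<dots> \<le> (\<Sum>k'\<in>Q. 1 * (\<Sum>k\<in>Q. 1 * \<eta>))"
  proof (rule sum_norm_le)
    fix k' assume k': "k' \<in> Q"
    have "cmod (\<Sum>k\<in>Q. cnj (b k) * (ip n (y k) (\<lambda>a. u k' a + r k' a) - (if k = k' then complex_of_real g else 0))) \<le> (\<Sum>k\<in>Q. 1 * \<eta>)"
    proof (rule sum_norm_le)
      fix k assume k: "k \<in> Q"
      show "cmod (cnj (b k) * (ip n (y k) (\<lambda>a. u k' a + r k' a) - (if k = k' then complex_of_real g else 0))) \<le> 1 * \<eta>"
        unfolding norm_mult complex_mod_cnj using b1[OF k] gram[OF k k'] by (intro mult_mono) auto
    qed
    then show "cmod (b k' * (\<Sum>k\<in>Q. cnj (b k) * (ip n (y k) (\<lambda>a. u k' a + r k' a) - (if k = k' then complex_of_real g else 0))))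
        \<le> 1 * (\<Sum>k\<in>Q. 1 * \<eta>)"
      unfolding norm_mult using b1[OF k'] by (intro mult_mono) auto
  qed
  also have "\<dots> = (real (card Q))\<^sup>2 * \<eta>" by (simp add: power2_eq_square)
  finally have "Re (ip n Y LY) - g * B \<le> (real (card Q))\<^sup>2 * \<eta>"
    using complex_Re_le_cmod[of "ip n Y LY - complex_of_real (g * B)"] by simp
  \<comment> \<open>As \<open>g \<le> 1\<close>, the quadratic term gives back at most half of the
    cross term \<open>2 * B\<close>; the remaining \<open>B\<close> is the sum of the squared
    projections.\<close>
  moreover have "g * B \<le> 1 * B" unfolding B_def using g by (intro mult_right_mono sum_nonneg) auto
  ultimately show ?thesis
    using main e1 unfolding LYv by (simp add: B_def b_def)
qed

context chebyshev_frame
begin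

lemma comb_qn_lim:
  assumes "k \<in> Q" "\<And>m. ((\<lambda>i. c i m) \<longlongrightarrow> C m) F"
  shows "((\<lambda>i. qn (N i) (comb i k (c i))) \<longlongrightarrow> (\<Sum>m\<le>m0. C m * C m)) F"
  using tendsto_Re[OF comb_ip[of k k c C c C, OF assms(1,1) assms(2) assms(2)]] by (simp add: ip_self)

lemma comb_form_lim:
  assumes "k \<in> Q" "\<And>m. m \<ge> m0 \<Longrightarrow> c m = 0"
  shows "((\<lambda>i. form (N i) (H i) (comb i k c)) \<longlongrightarrow>
    (\<Sum>m\<le>m0. c m * ((if m = 0 then 0 else c (m - 1)) + c (Suc m)))) F"
proof (rule Lim_transform_eventually)
  show "((\<lambda>i. Re (ip (N i) (comb i k c) (comb i k (shift i c)))) \<longlongrightarrow>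
    (\<Sum>m\<le>m0. c m * ((if m = 0 then 0 else c (m - 1)) + c (Suc m)))) F"
    using tendsto_Re[OF comb_ip[of k k "\<lambda>_. c" c "\<lambda>i. shift i c"
      "\<lambda>m. (if m = 0 then 0 else c (m - 1)) + c (Suc m)", OF assms(1,1) tendsto_const shift_lim]] by simp
  show "\<forall>\<^sub>F i in F. Re (ip (N i) (comb i k c) (comb i k (shift i c))) = form (N i) (H i) (comb i k c)"
    using comb_H
  proof eventually_elim
    case (elim i)
    show ?case unfolding form_def
      by (intro arg_cong[where f = Re] ip_cong refl) (use elim assms(2) in auto)
  qed
qed

lemma xs_eq_comb: "xs i k 0 = comb i k (\<lambda>m. if m = 0 then 1 else 0)"
  by (simp add: comb_def fun_eq_iff if_distrib if_distribR cong: if_cong)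

lemma xs_comb_ip_lim:
  assumes "k \<in> Q" "k' \<in> Q"
  shows "((\<lambda>i. ip (N i) (xs i k' 0) (comb i k c)) \<longlongrightarrow> (if k' = k then complex_of_real (c 0) else 0)) F"
  unfolding xs_eq_comb
  using comb_ip[of k' k "\<lambda>_ m. if m = 0 then 1 else 0" "\<lambda>m. if m = 0 then 1 else 0" "\<lambda>_. c" c,
    OF assms(2,1) tendsto_const tendsto_const]
  by (simp add: if_distrib if_distribR cong: if_cong)

text \<open>The numbers \<open>t^(m+1)\<close> form the first column of the resolvent of the free
  Jacobi matrix at \<open>t + 1 / t\<close>. Cutting them off at \<open>m0\<close> leaves defects in
  the last two coefficients only. The corner entry of the resolvent is close to
  \<open>t < 1\<close>, and this is what allows projections of weight 1.\<close>

lemma upper_bound: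
  assumes t: "0 < t" "t < 1" and m0: "m0 \<ge> 2" "t + t ^ (2 * m0 + 1) \<le> 1"
    and le: "\<forall>\<^sub>F i in F. \<forall>x. form (N i) (H i) x \<le> (t + 1 / t) * qn (N i) x"
    and unit: "\<forall>\<^sub>F i in F. \<forall>k. qn (N i) (xs i k 0) = 1"
    and e: "e > 0"
  shows "\<forall>\<^sub>F i in F. \<forall>v. qn (N i) v = 1 \<longrightarrow>
    form (N i) (H i) v + (\<Sum>k\<in>Q. (cmod (ip (N i) (xs i k 0) v))\<^sup>2)
      \<le> t + 1 / t + 4 * real (card Q) * t ^ m0 + e"
proof -
  define z where "z = t + 1 / t"
  define c where "c m = (if m < m0 then t ^ Suc m else 0)" for m
  define w where "w i m = z * c m - shift i c m" for i m
  define \<rho> where "\<rho> i m = w i m - (if m = 0 then 1 else 0)" for i m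
  \<comment> \<open>The coefficients of \<open>(z - H) y\<close> in the limit: the first unit vector
    plus the two defects of the cutoff. \<open>m0 \<ge> 2\<close> keeps the positions
    \<open>0\<close> and \<open>m0 - 1\<close> apart.\<close>
  define W where "W m = (if m = 0 then 1 else if m = m0 - 1 then t ^ Suc m0 else if m = m0 then - (t ^ m0) else 0)" for m
  define g where "g = t + t ^ (2 * m0 + 1)"
  have zt: "z * t ^ Suc m = t ^ Suc (Suc m) + t ^ m" for m
    using t by (simp add: z_def field_simps)
  have W_eq: "z * c m - ((if m = 0 then 0 else c (m - 1)) + c (Suc m)) = W m" for m
  proof -
    consider "m = 0" | "0 < m" "Suc m < m0" | "0 < m" "Suc m = m0" | "m = m0" | "m > m0" by linarith
    then show ?thesis
    proof cases
      case 1
      then show ?thesis using m0 zt[of 0] by (simp add: c_def W_def)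
    next
      case 2
      then show ?thesis using zt[of m] by (cases m) (auto simp: c_def W_def)
    next
      case 3
      then show ?thesis using zt[of m] by (cases m) (auto simp: c_def W_def)
    next
      case 4
      then show ?thesis using m0 by (auto simp: c_def W_def)
    next
      case 5
      then show ?thesis using m0 by (auto simp: c_def W_def)
    qed
  qed
  have w_lim: "((\<lambda>i. w i m) \<longlongrightarrow> W m) F" for m
    unfolding w_def W_eq[symmetric] by (intro tendsto_diff tendsto_const shift_lim)
  have \<rho>_lim: "((\<lambda>i. \<rho> i m) \<longlongrightarrow> W m - (if m = 0 then 1 else 0)) F" for m
    unfolding \<rho>_def by (intro tendsto_diff tendsto_const w_lim)
  have m0_split: "(\<Sum>m\<le>m0. f m) = f 0 + f (m0 - 1) + f m0"
    if "\<And>m. m \<noteq> 0 \<Longrightarrow> m \<noteq> m0 - 1 \<Longrightarrow> m \<noteq> m0 \<Longrightarrow> f m = 0" for f :: "nat \<Rightarrow> real"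
  proof -
    have "(\<Sum>m\<le>m0. f m) = (\<Sum>m\<in>{0, m0 - 1, m0}. f m)"
      using that by (intro sum.mono_neutral_right) auto
    then show ?thesis using m0 by simp
  qed
  have cW: "(\<Sum>m\<le>m0. c m * W m) = g"
    using m0 by (subst m0_split) (auto simp: c_def W_def g_def mult_2 simp flip: power_add)
  have WW: "(\<Sum>m\<le>m0. (W m - (if m = 0 then 1 else 0)) * (W m - (if m = 0 then 1 else 0))) < (2 * t ^ m0)\<^sup>2"
  proof -
    have "(\<Sum>m\<le>m0. (W m - (if m = 0 then 1 else 0)) * (W m - (if m = 0 then 1 else 0)))
        = t ^ Suc m0 * t ^ Suc m0 + t ^ m0 * t ^ m0"
      using m0 by (subst m0_split) (auto simp: W_def)
    also have "\<dots> = (t ^ m0)\<^sup>2 * (t * t + 1)" by (simp add: power2_eq_square algebra_simps)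
    also have "\<dots> < (t ^ m0)\<^sup>2 * 4"
      using t mult_strict_mono[of t 1 t 1] by (intro mult_strict_left_mono) auto
    finally show ?thesis by (simp add: power_mult_distrib)
  qed
  define \<eta> where "\<eta> = e / (1 + (real (card Q))\<^sup>2)"
  have \<eta>: "\<eta> > 0" using e by (simp add: \<eta>_def add_pos_nonneg)
  have \<eta>_le: "(real (card Q))\<^sup>2 * \<eta> \<le> e"
    using e by (simp add: \<eta>_def field_simps add_pos_nonneg)
  have r_ev: "\<forall>\<^sub>F i in F. \<forall>k\<in>Q. qn (N i) (comb i k (\<rho> i)) \<le> (2 * t ^ m0)\<^sup>2"
  proof (rule eventually_ball_finite[OF finite_Q], rule ballI)
    fix k assume "k \<in> Q"
    from order_tendstoD(2)[OF comb_qn_lim[OF this \<rho>_lim] WW]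
    show "\<forall>\<^sub>F i in F. qn (N i) (comb i k (\<rho> i)) \<le> (2 * t ^ m0)\<^sup>2"
      by eventually_elim simp
  qed
  have gram_ev: "\<forall>\<^sub>F i in F. \<forall>k\<in>Q. \<forall>k'\<in>Q.
      cmod (ip (N i) (comb i k c) (comb i k' (w i)) - (if k = k' then complex_of_real g else 0)) \<le> \<eta>"
  proof (intro eventually_ball_finite[OF finite_Q] ballI)
    fix k k' assume "k \<in> Q" "k' \<in> Q"
    from tendstoD[OF comb_ip[of k k' "\<lambda>_. c" c w W, OF this tendsto_const w_lim] \<eta>]
    show "\<forall>\<^sub>F i in F. cmod (ip (N i) (comb i k c) (comb i k' (w i)) - (if k = k' then complex_of_real g else 0)) \<le> \<eta>"
      unfolding cW dist_norm by eventually_elim simp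
  qed
  have comb_w: "comb i k (w i) a = xs i k 0 a + comb i k (\<rho> i) a" for i k a
    unfolding xs_eq_comb by (simp add: comb_def \<rho>_def flip: sum.distrib distrib_right of_real_add)
  show ?thesis
    using le unit herm_H comb_H r_ev gram_ev
  proof eventually_elim
    case (elim i)
    show ?case
    proof (intro allI impI)
      fix v assume v: "qn (N i) v = 1"
      have "form (N i) (H i) v + (\<Sum>k\<in>Q. (cmod (ip (N i) (xs i k 0) v))\<^sup>2)
          \<le> z + 2 * (real (card Q) * (2 * t ^ m0)) + (real (card Q))\<^sup>2 * \<eta>"
      proof (rule form_plus_projections_le[where y = "\<lambda>k. comb i k c" and r = "\<lambda>k. comb i k (\<rho> i)" and g = g])
        show "form (N i) (H i) x \<le> z * qn (N i) x" for x using elim(1) by (simp add: z_def)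
        fix k a assume "k \<in> Q" "a < N i"
        then have "mv (N i) (H i) (comb i k c) a = comb i k (shift i c) a"
          using elim(4) by (simp add: c_def)
        then have "complex_of_real z * comb i k c a - mv (N i) (H i) (comb i k c) a = comb i k (w i) a"
          by (simp add: comb_def w_def sum_distrib_left left_diff_distrib sum_subtractf mult.assoc)
        then show "complex_of_real z * comb i k c a - mv (N i) (H i) (comb i k c) a = xs i k 0 a + comb i k (\<rho> i) a"
          unfolding comb_w .
      next
        fix k k' assume "k \<in> Q" "k' \<in> Q"
        then show "cmod (ip (N i) (comb i k c) (\<lambda>a. xs i k' 0 a + comb i k' (\<rho> i) a)
            - (if k = k' then complex_of_real g else 0)) \<le> \<eta>"
          using elim(6) by (simp flip: comb_w)
      qed (use elim v finite_Q t m0 in \<open>auto simp: g_def\<close>)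
      with \<eta>_le show "form (N i) (H i) v + (\<Sum>k\<in>Q. (cmod (ip (N i) (xs i k 0) v))\<^sup>2)
          \<le> t + 1 / t + 4 * real (card Q) * t ^ m0 + e"
        by (simp add: z_def)
    qed
  qed
qed

end

section \<open>Largest eigenvalue\<close>

lemma mult_mat_vec_eq_mv:
  assumes "A \<in> carrier_mat n n" "v \<in> carrier_vec n" "i < n"
  shows "(A *\<^sub>v v) $ i = mv n (\<lambda>i j. A $$ (i, j)) (\<lambda>i. v $ i) i"
  using assms by (auto simp: mv_def scalar_prod_def intro!: sum.cong)

lemma eigenvalue_iff_mv:
  assumes A: "A \<in> carrier_mat n n"
  shows "eigenvalue A l \<longleftrightarrow>
    (\<exists>v. qn n v = 1 \<and> (\<forall>i<n. mv n (\<lambda>i j. A $$ (i, j)) v i = l * v i))"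
proof
  assume "eigenvalue A l"
  then obtain v where v: "v \<in> carrier_vec n" "v \<noteq> 0\<^sub>v n" "A *\<^sub>v v = l \<cdot>\<^sub>v v"
    using A unfolding eigenvalue_def eigenvector_def by auto
  let ?v = "\<lambda>i. v $ i"
  obtain k where k: "k < n" "v $ k \<noteq> 0"
    using v(1,2) by (metis carrier_vecD eq_vecI index_zero_vec(1) index_zero_vec(2))
  have "qn n ?v \<noteq> 0" using k by (auto simp: qn_def sum_nonneg_eq_0_iff)
  then have pos: "qn n ?v > 0" using qn_nonneg[of n ?v] by linarith
  define c where "c = complex_of_real (1 / sqrt (qn n ?v))"
  have c: "(cmod c)\<^sup>2 = 1 / qn n ?v" using pos by (simp add: c_def norm_divide power_divide)
  have "mv n (\<lambda>i j. A $$ (i, j)) (\<lambda>i. c * v $ i) i = l * (c * v $ i)" if "i < n" for i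
    unfolding mv_scale mult_mat_vec_eq_mv[OF A v(1) that, symmetric] v(3) using that v(1) by simp
  moreover have "qn n (\<lambda>i. c * v $ i) = 1" using pos by (simp add: qn_scale c)
  ultimately show "\<exists>v. qn n v = 1 \<and> (\<forall>i<n. mv n (\<lambda>i j. A $$ (i, j)) v i = l * v i)"
    by (intro exI[of _ "\<lambda>i. c * v $ i"]) auto
next
  assume "\<exists>v. qn n v = 1 \<and> (\<forall>i<n. mv n (\<lambda>i j. A $$ (i, j)) v i = l * v i)"
  then obtain v where v: "qn n v = 1" "\<And>i. i < n \<Longrightarrow> mv n (\<lambda>i j. A $$ (i, j)) v i = l * v i" by blast
  let ?v = "vec n v"
  have "A *\<^sub>v ?v = l \<cdot>\<^sub>v ?v"
  proof (rule eq_vecI)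
    fix i assume "i < dim_vec (l \<cdot>\<^sub>v ?v)"
    then have i: "i < n" by simp
    have "(A *\<^sub>v ?v) $ i = mv n (\<lambda>i j. A $$ (i, j)) (\<lambda>i. ?v $ i) i"
      by (rule mult_mat_vec_eq_mv[OF A _ i]) simp
    also have "\<dots> = mv n (\<lambda>i j. A $$ (i, j)) v i" unfolding mv_def by (intro sum.cong) auto
    finally show "(A *\<^sub>v ?v) $ i = (l \<cdot>\<^sub>v ?v) $ i" using v(2) i by simp
  qed (use A in simp)
  moreover have "?v \<noteq> 0\<^sub>v n"
  proof
    assume "?v = 0\<^sub>v n"
    then have "v i = 0" if "i < n" for i using that by (metis index_vec index_zero_vec(1))
    then have "qn n v = 0" by (simp add: qn_def)
    with v(1) show False by simp
  qed
  ultimately show "eigenvalue A l" using A unfolding eigenvalue_def eigenvector_def by (intro exI[of _ ?v]) auto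
qed

text \<open>\<open>Max\<close> is meaningful because the set is finite and nonempty: real
  eigenvalues are roots of the characteristic polynomial, and \<open>max_eigenvector\<close>
  supplies one.\<close>

lemma
  assumes A: "A \<in> carrier_mat n n" and n: "n > 0" and herm: "herm n (\<lambda>i j. A $$ (i, j))"
  shows form_le_lambda_max: "form n (\<lambda>i j. A $$ (i, j)) v \<le> lambda_max A * qn n v"
    and lambda_max_le: "(\<And>v. qn n v = 1 \<Longrightarrow> form n (\<lambda>i j. A $$ (i, j)) v \<le> b) \<Longrightarrow> lambda_max A \<le> b"
proof -
  let ?E = "{x. eigenvalue A (complex_of_real x)}"
  have "?E = {x. poly (char_poly A) (complex_of_real x) = 0}"
    using eigenvalue_root_char_poly[OF A] by simp
  moreover have "finite (complex_of_real -` {z. poly (char_poly A) z = 0})"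
  proof (rule finite_vimageI)
    have "char_poly A \<noteq> 0" using degree_monic_char_poly[OF A] by auto
    then show "finite {z. poly (char_poly A) z = 0}" by (rule poly_roots_finite)
  qed (simp add: inj_on_def)
  ultimately have fin: "finite ?E" by (simp add: vimage_def)
  obtain l v0 where l: "qn n v0 = 1" "\<And>i. i < n \<Longrightarrow> mv n (\<lambda>i j. A $$ (i, j)) v0 i = complex_of_real l * v0 i"
    "\<And>x. form n (\<lambda>i j. A $$ (i, j)) x \<le> l * qn n x"
    using max_eigenvector[OF herm n] by (metis (no_types, lifting))
  have lE: "l \<in> ?E" using eigenvalue_iff_mv[OF A] l(1,2) by auto
  then have "l \<le> lambda_max A" unfolding lambda_max_def using fin by (intro Max_ge) auto
  then have "l * qn n v \<le> lambda_max A * qn n v" using qn_nonneg by (intro mult_right_mono)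
  with l(3)[of v] show "form n (\<lambda>i j. A $$ (i, j)) v \<le> lambda_max A * qn n v" by linarith
  assume b: "\<And>v. qn n v = 1 \<Longrightarrow> form n (\<lambda>i j. A $$ (i, j)) v \<le> b"
  have "lambda_max A \<in> ?E" unfolding lambda_max_def using fin lE by (intro Max_in) auto
  then obtain v1 where v1: "qn n v1 = 1"
    "\<And>i. i < n \<Longrightarrow> mv n (\<lambda>i j. A $$ (i, j)) v1 i = complex_of_real (lambda_max A) * v1 i"
    using eigenvalue_iff_mv[OF A] by auto
  from form_eigenvector[OF v1(2)] b[OF v1(1)] v1(1) show "lambda_max A \<le> b" by simp
qed

lemma cot_le_inverse:
  assumes "0 < x" "x < pi"
  shows "cot x \<le> 1 / x"
proof (cases "x < pi / 2")
  case True
  have "x * cos x \<le> sin x"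
  proof -
    have "x \<le> tan x"
    proof -
      have "arctan (tan x) \<le> tan x"
        using arctan_le_self[of "tan x"] tan_gt_zero[of x] assms True by simp
      then show ?thesis using assms True by (simp add: arctan_tan)
    qed
    then show ?thesis using cos_gt_zero_pi[of x] assms True by (simp add: tan_def pos_le_divide_eq)
  qed
  then show ?thesis using assms sin_gt_zero[of x] by (simp add: cot_def field_simps)
next
  case False
  have "cos x \<le> cos (pi / 2)" using False assms by (intro cos_monotone_0_pi_le) auto
  then have "cos x \<le> 0" by simp
  then have "cot x \<le> 0" using sin_gt_zero[of x] assms by (simp add: cot_def divide_nonpos_pos)
  also have "0 \<le> 1 / x" using assms by simp
  finally show ?thesis .
qed

section \<open>The tournament matrix as noise, error and signal\<close>

context coupled_model
begin

definition Tm :: "(nat \<times> nat \<Rightarrow> int \<times> int) \<Rightarrow> nat \<Rightarrow> nat \<Rightarrow> complex" where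
  "Tm x i j = i_times (tour x) $$ (i, j)"

definition \<theta> :: "int \<Rightarrow> real" where
  "\<theta> k = 2 * \<gamma> * mu k / sqrt (real n)"

lemma tour_carrier: "tour x \<in> carrier_mat n n"
  by (simp add: tour_def tournament_of_def)

lemma i_times_carrier: "i_times (tour x) \<in> carrier_mat n n"
  using tour_carrier by (simp add: i_times_def)

lemma Tm_eq:
  assumes "i < n" "j < n"
  shows "Tm x i j = complex_of_real (sqrt (real n)) *
    ((Hm x i j + Dm x i j) + complex_of_real (2 * \<gamma> / sqrt (real n)) * (\<i> * complex_of_real (S i j)))"
proof -
  have r: "complex_of_real (sqrt (real n)) \<noteq> 0" using n by simp
  have "Tm x i j = \<i> * complex_of_real (real_of_int (tour x $$ (i, j)))"
    using assms carrier_matD[OF tour_carrier[of x]] by (simp add: Tm_def i_times_def)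
  then show ?thesis unfolding tour_decomp[OF assms] Hm_def Dm_def using r by (simp add: field_simps)
qed

lemma herm_Tm: "herm n (Tm x)"
proof -
  have skew: "real_of_int (tour x $$ (j, i)) = - real_of_int (tour x $$ (i, j))" if "i < n" "j < n" for i j
  proof (cases "i = j")
    case True
    with that show ?thesis by (simp add: tour_def tournament_of_def)
  next
    case False
    then have "\<sigma> i \<noteq> \<sigma> j" using permutes_inj[OF perm] by (auto dest: injD)
    with that False show ?thesis by (simp add: tour_def tournament_of_def)
  qed
  have Tm: "Tm x i j = \<i> * complex_of_real (real_of_int (tour x $$ (i, j)))" if "i < n" "j < n" for i j
    using that carrier_matD[OF tour_carrier[of x]] by (simp add: Tm_def i_times_def)
  show ?thesis unfolding herm_def
  proof (intro allI impI)
    fix i j assume "i < n" "j < n"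
    then show "Tm x i j = cnj (Tm x j i)"
      unfolding Tm[OF \<open>i < n\<close> \<open>j < n\<close>] Tm[OF \<open>j < n\<close> \<open>i < n\<close>] by (subst skew[OF \<open>j < n\<close> \<open>i < n\<close>]) simp
  qed
qed

lemma form_Tm: "form n (Tm x) v = sqrt (real n) *
    (form n (Hm x) v + form n (Dm x) v + (\<Sum>k<n. \<theta> (int k - K) * (cmod (ip n (uv (int k - K)) v))\<^sup>2))"
proof -
  have "form n (Tm x) v = form n (\<lambda>i j. complex_of_real (sqrt (real n)) *
    ((Hm x i j + Dm x i j) + complex_of_real (2 * \<gamma> / sqrt (real n)) * (\<i> * complex_of_real (S i j)))) v"
    by (rule form_cong) (simp_all add: Tm_eq)
  then show ?thesis
    unfolding form_scale_mat form_add form_S[of v K]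
    by (simp add: \<theta>_def sum_distrib_left mult_ac)
qed

lemma lambda_max_tour_ge: "form n (Tm x) v \<le> lambda_max (i_times (tour x)) * qn n v"
  using form_le_lambda_max[OF i_times_carrier n herm_Tm[unfolded Tm_def[abs_def]]]
  unfolding Tm_def[abs_def] .

lemma lambda_max_tour_le: "(\<And>v. qn n v = 1 \<Longrightarrow> form n (Tm x) v \<le> b) \<Longrightarrow> lambda_max (i_times (tour x)) \<le> b"
  using lambda_max_le[OF i_times_carrier n herm_Tm[unfolded Tm_def[abs_def]]]
  unfolding Tm_def[abs_def] .

lemma mu_le:
  assumes "0 \<le> k" "k < int n"
  shows "mu k \<le> 2 * real n / ((2 * of_int k + 1) * pi)"
proof -
  let ?h = "(2 * of_int k + 1) * pi / (2 * real n)"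
  have "real_of_int (2 * k + 1) < real_of_int (2 * int n)" using assms by (subst of_int_less_iff) linarith
  then have "(2 * of_int k + 1) * pi < (2 * real n) * pi" by (intro mult_strict_right_mono) simp_all
  then have "?h < pi" using n by (simp add: pos_divide_less_eq mult_ac)
  moreover have "?h > 0" using assms n by simp
  ultimately have "cot ?h \<le> 1 / ?h" by (intro cot_le_inverse) auto
  then show ?thesis by (simp add: mu_def)
qed

lemma mu_minus: "mu (- k - 1) = - mu k"
proof -
  have "(2 * real_of_int (- k - 1) + 1) * pi / (2 * real n) = - ((2 * of_int k + 1) * pi / (2 * real n))"
  proof -
    have "2 * real_of_int (- k - 1) + 1 = - (2 * of_int k + 1)" by simp
    then show ?thesis by (simp only: mult_minus_left minus_divide_left)
  qed
  then show ?thesis unfolding mu_def by (simp only: cot_minus)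
qed

lemma mu_reflect: "mu (int n - 1 - k) = - mu k"
proof -
  let ?h = "(2 * of_int k + 1) * pi / (2 * real n)"
  have "(2 * real_of_int (int n - 1 - k) + 1) * pi / (2 * real n) = pi - ?h"
    using n by (simp add: field_simps)
  then show ?thesis unfolding mu_def by (simp add: cot_def)
qed

text \<open>The scaling \<open>2 * \<gamma> / sqrt n = 2 * c / n\<close> cancels the
  \<open>n\<close> in \<open>mu_le\<close>. The reflections \<open>mu_minus\<close> and
  \<open>mu_reflect\<close> turn this upper bound into the lower bounds at both ends of the index
  range.\<close>

lemma
  assumes c: "c \<ge> 0" "\<gamma> = c * real n powr (- 1 / 2)"
  shows \<theta>_le: "0 \<le> k \<Longrightarrow> k < int n \<Longrightarrow> \<theta> k \<le> 4 * c / pi / (2 * of_int k + 1)"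
    and \<theta>_ge_neg: "k < 0 \<Longrightarrow> - int n \<le> k \<Longrightarrow> \<theta> k \<ge> - (4 * c / pi)"
    and \<theta>_ge_pos: "0 \<le> k \<Longrightarrow> k < int n - int K \<Longrightarrow> \<theta> k \<ge> - (4 * c / pi / (2 * real K + 1))"
    and \<theta>_0: "\<theta> 0 = 2 * c / real n * cot (pi / (2 * real n))"
proof -
  have \<theta>: "\<theta> k = 2 * c / real n * mu k" for k
  proof -
    have "real n powr (- 1 / 2) / sqrt (real n) = 1 / real n"
      using n by (simp add: powr_minus_divide powr_half_sqrt real_sqrt_mult_self flip: real_sqrt_mult)
    moreover have "\<theta> k = 2 * c * mu k * (real n powr (- 1 / 2) / sqrt (real n))"
      unfolding \<theta>_def unfolding c(2) by simp
    ultimately show ?thesis by simp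
  qed
  have le: "\<theta> k \<le> 4 * c / pi / (2 * of_int k + 1)" if "0 \<le> k" "k < int n" for k
  proof -
    have "\<theta> k \<le> 2 * c / real n * (2 * real n / ((2 * of_int k + 1) * pi))"
      unfolding \<theta> using mu_le[OF that] c by (intro mult_left_mono) auto
    also have "\<dots> = 4 * c / pi / (2 * of_int k + 1)" using n by (simp add: field_simps)
    finally show ?thesis .
  qed
  then show "0 \<le> k \<Longrightarrow> k < int n \<Longrightarrow> \<theta> k \<le> 4 * c / pi / (2 * of_int k + 1)" .
  have mono: "4 * c / pi / (2 * of_int k + 1) \<le> 4 * c / pi / (2 * real K + 1)" if "int K \<le> k" for k K
  proof (rule divide_left_mono)
    have "real K \<le> of_int k" using that by linarith
    then show "2 * real K + 1 \<le> 2 * real_of_int k + 1" by simp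
    have "0 \<le> real_of_int k" using that by linarith
    then show "0 < (2 * real_of_int k + 1) * (2 * real K + 1)" by (intro mult_pos_pos) auto
  qed (use c in auto)
  show "k < 0 \<Longrightarrow> - int n \<le> k \<Longrightarrow> \<theta> k \<ge> - (4 * c / pi)"
    using le[of "- k - 1"] mono[of 0 "- k - 1"] by (simp add: \<theta> mu_minus[of k])
  show "0 \<le> k \<Longrightarrow> k < int n - int K \<Longrightarrow> \<theta> k \<ge> - (4 * c / pi / (2 * real K + 1))"
    using le[of "int n - 1 - k"] mono[of K "int n - 1 - k"] by (simp add: \<theta> mu_reflect[of k])
  show "\<theta> 0 = 2 * c / real n * cot (pi / (2 * real n))"
    by (simp add: \<theta> mu_def)
qed

end

section \<open>The good event\<close>

context coupled_model
begin

text \<open>All that is used of the randomness. The range of \<open>m\<close> starts at 1, since for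
  length 0 the inner products are exact (\<open>uv_orthonormal\<close>).\<close>

definition good :: "real \<Rightarrow> real \<Rightarrow> nat \<Rightarrow> nat \<Rightarrow> (nat \<times> nat \<Rightarrow> int \<times> int) set" where
  "good z \<delta> K m0 = {x \<in> set_pmf M.
     (\<forall>v. form n (Hm x) v \<le> z * qn n v) \<and> (\<forall>v. form n (Dm x) v \<le> \<delta> * qn n v) \<and>
     (\<forall>k \<in> {- int K..<int K}. \<forall>k' \<in> {- int K..<int K}. \<forall>m \<in> {1..2 * m0}.
        norm (ip n (uv k) (xv x (uv k') m)) < real n powr (- 1 / 4))}"

lemma prob_not_good:
  assumes k: "k > 0" and z: "z > 0" and c: "c \<ge> 0" "\<gamma> \<le> c * real n powr (- 1 / 2)" and \<delta>: "\<delta> > 0"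
  shows "measure_pmf.prob M (- good z \<delta> K m0)
    \<le> trace_bound n k z
      + real n * (((1 + 8 * c) * real n powr (1 / 4) + 8) / (\<delta> * sqrt (real n) / 2)) ^ 8
      + (\<Sum>j \<in> {- int K..<int K} \<times> {- int K..<int K} \<times> {1..2 * m0}.
          nb_const (snd (snd j)) * real n powr (- 1 / 2))"
    (is "_ \<le> ?a + ?b + (\<Sum>j\<in>?I. ?c j)")
proof -
  let ?A = "{x. \<exists>v. form n (Hm x) v > z * qn n v}"
  let ?B = "{x. \<exists>v. form n (Dm x) v > \<delta> * qn n v}"
  let ?C = "\<lambda>j. {x. norm (ip n (uv (fst j)) (xv x (uv (fst (snd j))) (snd (snd j)))) \<ge> real n powr (- 1 / 4)}"
  have "measure_pmf.prob M (- good z \<delta> K m0) = measure_pmf.prob M (- good z \<delta> K m0 \<inter> set_pmf M)"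
    by (rule measure_Int_set_pmf[symmetric])
  also have "\<dots> \<le> measure_pmf.prob M ((?A \<union> ?B) \<union> (\<Union>j\<in>?I. ?C j))"
  proof (rule measure_pmf.finite_measure_mono)
    show "- good z \<delta> K m0 \<inter> set_pmf M \<subseteq> (?A \<union> ?B) \<union> (\<Union>j\<in>?I. ?C j)"
    proof
      fix x assume x: "x \<in> - good z \<delta> K m0 \<inter> set_pmf M"
      show "x \<in> (?A \<union> ?B) \<union> (\<Union>j\<in>?I. ?C j)"
      proof (rule ccontr)
        assume "x \<notin> (?A \<union> ?B) \<union> (\<Union>j\<in>?I. ?C j)"
        then have 1: "\<And>v. form n (Hm x) v \<le> z * qn n v" and 2: "\<And>v. form n (Dm x) v \<le> \<delta> * qn n v"
          and 3: "\<And>j. j \<in> ?I \<Longrightarrow> x \<notin> ?C j"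
          by (auto simp: not_less)
        have "norm (ip n (uv k) (xv x (uv k') m)) < real n powr (- 1 / 4)"
          if "k \<in> {- int K..<int K}" "k' \<in> {- int K..<int K}" "m \<in> {1..2 * m0}" for k k' m
          using 3[of "(k, k', m)"] that by simp
        with 1 2 x show False by (auto simp: good_def)
      qed
    qed
  qed simp
  also have "\<dots> \<le> measure_pmf.prob M (?A \<union> ?B) + measure_pmf.prob M (\<Union>j\<in>?I. ?C j)"
    by (rule measure_Un_le) auto
  also have "\<dots> \<le> (measure_pmf.prob M ?A + measure_pmf.prob M ?B) + (\<Sum>j\<in>?I. measure_pmf.prob M (?C j))"
    by (intro add_mono measure_Un_le measure_pmf.finite_measure_subadditive_finite) auto
  also have "\<dots> \<le> ?a + ?b + (\<Sum>j\<in>?I. ?c j)"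
  proof (intro add_mono sum_mono)
    show "measure_pmf.prob M ?A \<le> ?a" by (rule prob_Hm_form[OF k z])
    show "measure_pmf.prob M ?B \<le> ?b" by (rule prob_Dm_form[OF c \<delta>])
    fix j assume "j \<in> ?I"
    then have "snd (snd j) \<ge> 1" by auto
    then show "measure_pmf.prob M (?C j) \<le> ?c j"
      by (intro prob_xv) (simp_all add: norm_uv)
  qed
  finally show ?thesis .
qed

end

section \<open>Limits\<close>

abbreviation gam :: "real \<Rightarrow> nat \<Rightarrow> real" where
  "gam c n \<equiv> c * real n powr (- 1 / 2)"

abbreviation planted_prob :: "real \<Rightarrow> nat \<Rightarrow> int mat set \<Rightarrow> real" where
  "planted_prob c n \<equiv> measure_pmf.prob (planted_model n (gam c n))"

abbreviation scaled_max :: "nat \<Rightarrow> int mat \<Rightarrow> real" where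
  "scaled_max n T \<equiv> 1 / sqrt (real n) * lambda_max (i_times T)"

text \<open>The exponent must outgrow \<open>log n\<close>, so that geometric decay absorbs the
  factor \<open>n\<close> of the trace, while its fifth power must be small against
  \<open>n\<close>; the power \<open>1 / 10\<close> does both.\<close>

definition half_exponent :: "nat \<Rightarrow> nat" where
  "half_exponent n = nat \<lceil>real n powr (1 / 10)\<rceil>"

lemma trace_bound_tendsto:
  assumes z: "z > 2"
  shows "(\<lambda>n. trace_bound n (half_exponent n) z) \<longlonglongrightarrow> 0"
proof -
  define q where "q = (2 / z + 1) / 2"
  have q: "0 < q" "q < 1" "2 / z < q" using z by (auto simp: q_def field_simps)
  define \<rho> where "\<rho> n = (2 + (2 * real (2 * half_exponent n) + 1) * real (2 * half_exponent n) ^ 4 / real n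
     + 1 / real (2 * half_exponent n)) / z" for n
  \<comment> \<open>A majorant of \<open>\<rho>\<close> in which the rounding is replaced by
    explicit powers of \<open>n\<close>.\<close>
  define \<rho>' where "\<rho>' n = (2 + (2 * (2 * (real n powr (1 / 10) + 1)) + 1) * (2 * (real n powr (1 / 10) + 1)) ^ 4 / real n
     + 1 / (2 * real n powr (1 / 10))) / z" for n
  have k: "real n powr (1 / 10) \<le> real (half_exponent n)" "real (half_exponent n) \<le> real n powr (1 / 10) + 1" for n
  proof -
    have "0 \<le> \<lceil>real n powr (1 / 10)\<rceil>" using powr_ge_zero[of "real n" "1 / 10"] by linarith
    then have "real (half_exponent n) = of_int \<lceil>real n powr (1 / 10)\<rceil>" by (simp add: half_exponent_def)
    then show "real n powr (1 / 10) \<le> real (half_exponent n)" "real (half_exponent n) \<le> real n powr (1 / 10) + 1"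
      by linarith+
  qed
  have "\<rho>' \<longlonglongrightarrow> 2 / z" unfolding \<rho>'_def using z by real_asymp (simp add: divide_inverse)
  from order_tendstoD(2)[OF this q(3)] have ev: "\<forall>\<^sub>F n in sequentially. \<rho>' n < q" .
  have lim: "(\<lambda>n. real n * q powr (2 * real n powr (1 / 10))) \<longlonglongrightarrow> 0"
    using q by real_asymp
  show ?thesis
  proof (rule tendsto_sandwich[OF _ _ tendsto_const lim])
    show "\<forall>\<^sub>F n in sequentially. 0 \<le> trace_bound n (half_exponent n) z"
      using z by (intro always_eventually allI) simp
    show "\<forall>\<^sub>F n in sequentially. trace_bound n (half_exponent n) z \<le> real n * q powr (2 * real n powr (1 / 10))"
      using ev eventually_gt_at_top[of 0]
    proof eventually_elim
      case (elim n)
      have x: "real n powr (1 / 10) > 0" using elim by simp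
      have "0 < real (half_exponent n)" using k(1)[of n] x by linarith
      then have h0: "half_exponent n > 0" by simp
      have "\<rho> n \<le> \<rho>' n"
        unfolding \<rho>_def \<rho>'_def
      proof (intro divide_right_mono add_mono mult_mono power_mono divide_left_mono)
        show "0 < real (2 * half_exponent n) * (2 * real n powr (1 / 10))"
          using h0 x by (intro mult_pos_pos) auto
      qed (use k[of n] z in auto)
      then have "\<rho> n \<le> q" using elim by simp
      moreover have "0 \<le> \<rho> n" unfolding \<rho>_def using z by simp
      ultimately have "\<rho> n ^ (2 * half_exponent n) \<le> q ^ (2 * half_exponent n)" by (intro power_mono)
      also have "\<dots> = q powr (2 * real (half_exponent n))"
        using q by (simp flip: powr_realpow)
      also have "\<dots> \<le> q powr (2 * real n powr (1 / 10))"
        using q k(1)[of n] by (intro powr_mono') auto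
      finally show ?case unfolding \<rho>_def by (intro mult_left_mono) auto
    qed
  qed
qed

text \<open>Eventually along this filter means: for all large \<open>n\<close>, uniformly over all
  permutations and all good outcomes. Limits of random quantities thus become ordinary
  limits.\<close>

definition good_filter :: "real \<Rightarrow> real \<Rightarrow> real \<Rightarrow> nat \<Rightarrow> nat \<Rightarrow>
    (nat \<times> (nat \<Rightarrow> nat) \<times> (nat \<times> nat \<Rightarrow> int \<times> int)) filter" where
  "good_filter c z \<delta> K m0 = inf (filtercomap fst sequentially)
     (principal {(n, \<sigma>, x). coupled_model n \<sigma> (gam c n) \<and>
        x \<in> coupled_model.good n \<sigma> (gam c n) z \<delta> K m0})"

lemma eventually_good_filter:
  "eventually P (good_filter c z \<delta> K m0) \<longleftrightarrow> (\<exists>n0. \<forall>n\<ge>n0. \<forall>\<sigma> x.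
     coupled_model n \<sigma> (gam c n) \<longrightarrow>
     x \<in> coupled_model.good n \<sigma> (gam c n) z \<delta> K m0 \<longrightarrow> P (n, \<sigma>, x))"
  unfolding good_filter_def eventually_inf_principal eventually_filtercomap_at_top_linorder by auto

lemma good_filterI:
  assumes "\<And>n \<sigma> x. coupled_model n \<sigma> (gam c n) \<Longrightarrow>
     x \<in> coupled_model.good n \<sigma> (gam c n) z \<delta> K m0 \<Longrightarrow> P (n, \<sigma>, x)"
  shows "eventually P (good_filter c z \<delta> K m0)"
  unfolding eventually_good_filter using assms by blast

lemma tendsto_good_filter:
  assumes "g \<longlonglongrightarrow> l"
  shows "((\<lambda>i. g (fst i)) \<longlongrightarrow> l) (good_filter c z \<delta> K m0)"
proof (rule filterlim_compose[OF assms])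
  have "filterlim fst sequentially (filtercomap fst sequentially)" by (rule filterlim_filtercomap)
  then show "filterlim fst sequentially (good_filter c z \<delta> K m0)"
    unfolding good_filter_def by (rule filterlim_mono) auto
qed

text \<open>The planted model is a mixture over \<open>\<sigma>\<close>, and given
  \<open>\<sigma>\<close> it is the image of the coupling under \<open>tour\<close>; a bound uniform
  in \<open>\<sigma>\<close> passes to the mixture.\<close>

lemma planted_prob_le:
  assumes n: "n > 0" and \<gamma>: "0 \<le> \<gamma>" "\<gamma> \<le> 1 / 2"
    and le: "\<And>\<sigma>. \<sigma> permutes {..<n} \<Longrightarrow>
      measure_pmf.prob (coupled_model.M n \<sigma> \<gamma>) {x. coupled_model.tour n \<sigma> x \<in> A} \<le> p"
  shows "measure_pmf.prob (planted_model n \<gamma>) A \<le> p"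
proof -
  have p0: "p \<ge> 0" using le[OF permutes_id] measure_nonneg order_trans by blast
  have fin: "finite {\<sigma>. \<sigma> permutes {..<n}}" by (rule finite_permutations) simp
  have ne: "{\<sigma>. \<sigma> permutes {..<n}} \<noteq> {}" using permutes_id by blast
  have model: "coupled_model n \<sigma> \<gamma>" if "\<sigma> permutes {..<n}" for \<sigma>
    using that n \<gamma> by unfold_locales auto
  have "planted_model n \<gamma> = pmf_of_set {\<sigma>. \<sigma> permutes {..<n}} \<bind>
      (\<lambda>\<sigma>. map_pmf (coupled_model.tour n \<sigma>) (coupled_model.M n \<sigma> \<gamma>))"
    unfolding planted_model_def
    by (rule bind_pmf_cong[OF refl]) (use fin ne coupled_model.map_tour[OF model] in auto)
  then have "emeasure (planted_model n \<gamma>) A = (\<integral>\<^sup>+\<sigma>. emeasure (map_pmf (coupled_model.tour n \<sigma>) (coupled_model.M n \<sigma> \<gamma>)) A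
      \<partial>measure_pmf (pmf_of_set {\<sigma>. \<sigma> permutes {..<n}}))"
    by simp
  also have "\<dots> \<le> (\<integral>\<^sup>+\<sigma>. ennreal p \<partial>measure_pmf (pmf_of_set {\<sigma>. \<sigma> permutes {..<n}}))"
  proof (rule nn_integral_mono_AE, unfold AE_measure_pmf_iff, rule ballI)
    fix \<sigma> assume "\<sigma> \<in> set_pmf (pmf_of_set {\<sigma>. \<sigma> permutes {..<n}})"
    then have "\<sigma> permutes {..<n}" using fin ne by simp
    from le[OF this] show "emeasure (map_pmf (coupled_model.tour n \<sigma>) (coupled_model.M n \<sigma> \<gamma>)) A \<le> ennreal p"
      by (simp add: measure_pmf.emeasure_eq_measure vimage_def ennreal_leI)
  qed
  also have "\<dots> = ennreal p" by simp
  finally show ?thesis using p0 by (simp add: measure_pmf.emeasure_eq_measure)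
qed

text \<open>The way back to probabilities: for large \<open>n\<close> failures of \<open>P\<close>
  lie outside \<open>good\<close>, which is uniformly rare. Large \<open>n\<close> also brings
  \<open>\<gamma>\<close> below \<open>1 / 2\<close>.\<close>

lemma good_filter_whp:
  assumes c: "c \<ge> 0" and z: "z > 2" and \<delta>: "\<delta> > 0"
    and ev: "\<forall>\<^sub>F i in good_filter c z \<delta> K m0. P (fst i) (coupled_model.tour (fst i) (fst (snd i)) (snd (snd i)))"
  shows "(\<lambda>n. planted_prob c n {T. \<not> P n T}) \<longlonglongrightarrow> 0"
proof -
  define a where "a n = trace_bound n (half_exponent n) z" for n
  define b where "b n = real n * (((1 + 8 * c) * real n powr (1 / 4) + 8) / (\<delta> * sqrt (real n) / 2)) ^ 8" for n
  let ?I = "{- int K..<int K} \<times> {- int K..<int K} \<times> {1..2 * m0}"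
  define d where "d n = (\<Sum>j \<in> ?I. nb_const (snd (snd j)) * real n powr (- 1 / 2))" for n
  have a: "a \<longlonglongrightarrow> 0" unfolding a_def using trace_bound_tendsto[OF z] .
  have b: "b \<longlonglongrightarrow> 0" unfolding b_def using c \<delta> by real_asymp
  have d: "d \<longlonglongrightarrow> 0"
    unfolding d_def
  proof (rule tendsto_null_sum)
    fix j :: "int \<times> int \<times> nat"
    have "(\<lambda>n. real n powr (- 1 / 2)) \<longlonglongrightarrow> 0" by real_asymp
    then show "(\<lambda>n. nb_const (snd (snd j)) * real n powr (- 1 / 2)) \<longlonglongrightarrow> 0"
      by (rule tendsto_mult_right_zero)
  qed
  obtain n0 where n0: "\<And>n \<sigma> x. n \<ge> n0 \<Longrightarrow> coupled_model n \<sigma> (gam c n) \<Longrightarrow>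
     x \<in> coupled_model.good n \<sigma> (gam c n) z \<delta> K m0 \<Longrightarrow> P n (coupled_model.tour n \<sigma> x)"
    using ev unfolding eventually_good_filter by auto
  have "(\<lambda>n. gam c n) \<longlonglongrightarrow> 0" by real_asymp
  then have small: "\<forall>\<^sub>F n in sequentially. gam c n < 1 / 2"
    by (rule order_tendstoD) simp
  show ?thesis
  proof (rule tendsto_sandwich[OF _ _ tendsto_const])
    show "(\<lambda>n. a n + b n + d n) \<longlonglongrightarrow> 0" using tendsto_add[OF tendsto_add[OF a b] d] by simp
    show "\<forall>\<^sub>F n in sequentially. planted_prob c n {T. \<not> P n T} \<le> a n + b n + d n"
      using small eventually_ge_at_top[of n0] eventually_gt_at_top[of 0]
    proof eventually_elim
      case (elim n)
      show ?case
      proof (rule planted_prob_le)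
        fix \<sigma> assume \<sigma>: "\<sigma> permutes {..<n}"
        interpret coupled_model n \<sigma> "gam c n"
          using \<sigma> elim c by unfold_locales auto
        have "measure_pmf.prob M {x. tour x \<in> {T. \<not> P n T}} \<le> measure_pmf.prob M (- good z \<delta> K m0)"
          using n0[OF elim(2)] coupled_model_axioms
          by (intro measure_pmf.finite_measure_mono) auto
        also have "\<dots> \<le> a n + b n + d n"
          unfolding a_def b_def d_def
          by (rule prob_not_good) (use z c \<delta> elim in \<open>auto simp: half_exponent_def\<close>)
        finally show "measure_pmf.prob M {x. tour x \<in> {T. \<not> P n T}} \<le> a n + b n + d n" .
      qed (use elim c in auto)
    qed
  qed simp
qed

lemma good_filter_members:
  "\<forall>\<^sub>F i in good_filter c z \<delta> K m0.
     coupled_model (fst i) (fst (snd i)) (gam c (fst i)) \<and>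
     snd (snd i) \<in> coupled_model.good (fst i) (fst (snd i)) (gam c (fst i)) z \<delta> K m0"
  by (rule good_filterI) simp

lemma good_filter_ge: "\<forall>\<^sub>F i in good_filter c z \<delta> K m0. fst i \<ge> n0"
  unfolding eventually_good_filter by (intro exI[of _ n0]) simp

section \<open>The model as a Chebyshev frame\<close>

abbreviation "frame_H i \<equiv> coupled_model.Hm (fst i) (fst (snd i)) (snd (snd i))"
abbreviation "frame_al i l \<equiv> (if (l :: nat) = 0 then real (fst i) - 1 else real (fst i) - 2) / real (fst i)"
abbreviation "frame_u i \<equiv> coupled_model.uv (fst i) (fst (snd i))"
abbreviation "frame_x i k \<equiv> coupled_model.xv (fst i) (fst (snd i)) (snd (snd i)) (frame_u i k)"

lemma frame:
  assumes Q: "finite Q" "Q \<subseteq> {- int K..<int K}"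
  shows "chebyshev_frame (good_filter c z \<delta> K m0) fst frame_H frame_x
    frame_al Q m0"
proof
  let ?F = "good_filter c z \<delta> K m0"
  let ?\<gamma> = "\<lambda>n. gam c n"
  show "finite Q" by (rule Q)
  show "\<forall>\<^sub>F i in ?F. herm (fst i) (frame_H i)"
    using good_filter_members by eventually_elim (blast intro: coupled_model.herm_Hm)
  show "\<forall>\<^sub>F i in ?F. \<forall>k. \<forall>a<fst i. mv (fst i) (frame_H i) (frame_x i k 0) a = frame_x i k 1 a"
    using good_filter_members by eventually_elim (blast intro: coupled_model.Hm_xv_0)
  show "\<forall>\<^sub>F i in ?F. \<forall>k l. \<forall>a<fst i. mv (fst i) (frame_H i) (frame_x i k (Suc l)) a
      = frame_x i k (Suc (Suc l)) a
      + complex_of_real ((if l = 0 then real (fst i) - 1 else real (fst i) - 2) / real (fst i)) * frame_x i k l a"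
    using good_filter_members
  proof eventually_elim
    case (elim i)
    then interpret coupled_model "fst i" "fst (snd i)" "?\<gamma> (fst i)" by simp
    have "snd (snd i) \<in> set_pmf M" using elim unfolding good_def by blast
    then show ?case by (blast intro: Hm_xv_Suc)
  qed
  show "((\<lambda>i. (if l = 0 then real (fst i) - 1 else real (fst i) - 2) / real (fst i)) \<longlongrightarrow> 1) ?F" for l :: nat
  proof -
    have "(\<lambda>n. (if l = 0 then real n - 1 else real n - 2) / real n) \<longlonglongrightarrow> 1"
      by (cases "l = 0") (simp_all, real_asymp+)
    then show ?thesis by (rule tendsto_good_filter)
  qed
  fix k k' m assume k: "k \<in> Q" "k' \<in> Q" and m: "m \<le> 2 * m0"
  show "((\<lambda>i. ip (fst i) (frame_x i k 0) (frame_x i k' m)) \<longlongrightarrow> (if k = k' \<and> m = 0 then 1 else 0)) ?F"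
  proof (cases "m = 0")
    case True
    have "\<forall>\<^sub>F i in ?F. ip (fst i) (frame_x i k 0) (frame_x i k' m) = (if k = k' \<and> m = 0 then 1 else 0)"
      \<comment> \<open>Indices in \<open>Q\<close> differ by less than \<open>2 * K\<close>, so for
        larger \<open>n\<close> they belong to different members of an orthonormal basis.\<close>
      using good_filter_members good_filter_ge[of "Suc (2 * K)"]
    proof eventually_elim
      case (elim i)
      then interpret coupled_model "fst i" "fst (snd i)" "?\<gamma> (fst i)" by simp
      have "k \<in> {- int K..<int K}" "k' \<in> {- int K..<int K}" using k Q(2) by blast+
      then have "\<bar>k - k'\<bar> < int (fst i)" using elim(2) by auto
      with True show ?case by (simp add: xv_0 uv_orthonormal)
    qed
    then show ?thesis by (rule tendsto_eventually)
  next
    case False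
    have "((\<lambda>i. ip (fst i) (frame_x i k 0) (frame_x i k' m)) \<longlongrightarrow> 0) ?F"
    proof (rule Lim_null_comparison)
      have "(\<lambda>n. real n powr (- 1 / 4)) \<longlonglongrightarrow> 0" by real_asymp
      then show "((\<lambda>i. real (fst i) powr (- 1 / 4)) \<longlongrightarrow> 0) ?F" by (rule tendsto_good_filter)
      show "\<forall>\<^sub>F i in ?F. norm (ip (fst i) (frame_x i k 0) (frame_x i k' m)) \<le> real (fst i) powr (- 1 / 4)"
        using good_filter_members
      proof eventually_elim
        case (elim i)
        have mem: "k \<in> {- int K..<int K}" "k' \<in> {- int K..<int K}" "m \<in> {1..2 * m0}"
          using k Q(2) m False by auto
        from elim have cm: "coupled_model (fst i) (fst (snd i)) (?\<gamma> (fst i))"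
          and x: "snd (snd i) \<in> coupled_model.good (fst i) (fst (snd i)) (?\<gamma> (fst i)) z \<delta> K m0" by auto
        have "norm (ip (fst i) (frame_u i k) (frame_x i k' m)) < real (fst i) powr (- 1 / 4)"
          using x mem unfolding coupled_model.good_def[OF cm] by blast
        then show ?case by (simp add: coupled_model.xv_0[OF cm])
      qed
    qed
    with False show ?thesis by simp
  qed
qed

text \<open>For \<open>k < K\<close> the assumption \<open>c \<le> pi / 4\<close> gives
  \<open>\<theta> k \<le> 1\<close>, so a plain projection dominates this part of the signal. All
  other modes have \<open>\<theta> k \<le> \<epsilon> / 8\<close> and cost at most
  \<open>\<epsilon> / 8\<close> together, by Parseval.\<close>

lemma upper_whp:
  assumes c: "0 \<le> c" "c \<le> pi / 4" and \<epsilon>: "\<epsilon> > 0"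
  shows "(\<lambda>n. planted_prob c n
    {T. \<not> scaled_max n T \<le> 2 + \<epsilon>}) \<longlonglongrightarrow> 0"
proof -
  \<comment> \<open>With \<open>t = 1 - d\<close> the level \<open>t + 1 / t\<close> equals
    \<open>2 + d^2 / t\<close>: strictly above 2, as the norm bound for the noise demands, but by at
    most \<open>\<epsilon> / 8\<close>.\<close>
  define d where "d = min (1 / 2) (\<epsilon> / 8)"
  define t where "t = 1 - d"
  have d: "0 < d" "d \<le> 1 / 2" "d \<le> \<epsilon> / 8" using \<epsilon> by (auto simp: d_def)
  have t: "0 < t" "t < 1" using d by (auto simp: t_def)
  have z_eq: "t + 1 / t = 2 + d * d / t" using t by (simp add: t_def field_simps)
  have "d * d / t \<le> d"
  proof -
    have "d * d \<le> d * t" using d by (intro mult_left_mono) (auto simp: t_def)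
    then show ?thesis using t by (simp add: pos_divide_le_eq)
  qed
  then have z_le: "t + 1 / t \<le> 2 + \<epsilon> / 8" using z_eq d by linarith
  have z_gt: "t + 1 / t > 2" using z_eq d t by simp
  obtain K :: nat where K: "8 / \<epsilon> < real K" using reals_Archimedean2 by blast
  have K_pos: "real K > 0" using K \<epsilon> by (meson divide_pos_pos less_trans zero_less_numeral)
  have K_small: "1 / (2 * real K + 1) \<le> \<epsilon> / 8"
    using K \<epsilon> K_pos by (simp add: field_simps)
  have pow: "(\<lambda>m. t ^ m) \<longlonglongrightarrow> 0" using t by (intro LIMSEQ_realpow_zero) auto
  have "(\<lambda>m. 4 * real K * t ^ m) \<longlonglongrightarrow> 0" by (rule tendsto_mult_right_zero[OF pow])
  then have e1: "\<forall>\<^sub>F m in sequentially. 4 * real K * t ^ m < \<epsilon> / 8" by (rule order_tendstoD) (use \<epsilon> in simp)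
  have e2: "\<forall>\<^sub>F m in sequentially. t ^ m < 1 - t" using pow by (rule order_tendstoD) (use t in simp)
  obtain m0 where m0: "m0 \<ge> 2" "4 * real K * t ^ m0 < \<epsilon> / 8" "t ^ m0 < 1 - t"
    using eventually_happens'[OF sequentially_bot eventually_conj[OF eventually_ge_at_top[of 2] eventually_conj[OF e1 e2]]]
    by auto
  have "t ^ (2 * m0 + 1) \<le> t ^ m0" using t by (intro power_decreasing) auto
  then have m0': "t + t ^ (2 * m0 + 1) \<le> 1" using m0(3) by linarith
  define Q where "Q = int ` {..<K}"
  have Q: "finite Q" "Q \<subseteq> {- int K..<int K}" "card Q = K"
    by (auto simp: Q_def card_image)
  let ?F = "good_filter c (t + 1 / t) (\<epsilon> / 8) K m0"
  interpret fr: chebyshev_frame ?F fst frame_H frame_x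
    frame_al Q m0
    by (rule frame[OF Q(1,2)])
  have le: "\<forall>\<^sub>F i in ?F. \<forall>x. form (fst i) (frame_H i) x \<le> (t + 1 / t) * qn (fst i) x"
    using good_filter_members
  proof eventually_elim
    case (elim i)
    then interpret coupled_model "fst i" "fst (snd i)" "gam c (fst i)" by simp
    show ?case using elim unfolding good_def by blast
  qed
  have unit: "\<forall>\<^sub>F i in ?F. \<forall>k. qn (fst i) (frame_x i k 0) = 1"
    using good_filter_members
  proof eventually_elim
    case (elim i)
    then interpret coupled_model "fst i" "fst (snd i)" "gam c (fst i)" by simp
    have "qn (fst i) (uv k) = 1" for k
      using ip_self[of "fst i" "uv k"] uv_orthonormal[of k k] n by simp
    then show ?case by (simp add: xv_0)
  qed
  have "\<epsilon> / 8 > 0" using \<epsilon> by simp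
  from fr.upper_bound[OF t m0(1) m0' le unit this]
  have "\<forall>\<^sub>F i in ?F. 1 / sqrt (real (fst i)) * lambda_max (i_times (coupled_model.tour (fst i) (fst (snd i)) (snd (snd i)))) \<le> 2 + \<epsilon>"
    using good_filter_members
  proof eventually_elim
    case (elim i)
    let ?n = "fst i" and ?x = "snd (snd i)"
    from elim interpret coupled_model ?n "fst (snd i)" "gam c ?n" by simp
    have x: "?x \<in> good (t + 1 / t) (\<epsilon> / 8) K m0" using elim by simp
    have "lambda_max (i_times (tour ?x)) \<le> sqrt (real ?n) * (2 + \<epsilon>)"
    proof (rule lambda_max_tour_le)
      fix v assume v: "qn ?n v = 1"
      let ?a = "\<lambda>k. (cmod (ip ?n (uv k) v))\<^sup>2"
      have H: "form ?n (Hm ?x) v + (\<Sum>k\<in>Q. ?a k) \<le> t + 1 / t + 4 * real K * t ^ m0 + \<epsilon> / 8"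
        using elim(1) v unfolding Q(3) by (simp add: xv_0)
      have "form ?n (Dm ?x) v \<le> \<epsilon> / 8 * qn ?n v" using x unfolding good_def by blast
      then have D: "form ?n (Dm ?x) v \<le> \<epsilon> / 8" by (simp add: v)
      have term_le: "\<theta> (int k - int 0) * ?a (int k - int 0) \<le> (if k < K then ?a (int k) else 0) + \<epsilon> / 8 * ?a (int k)"
        if "k < ?n" for k
      proof -
        have \<theta>: "\<theta> (int k) \<le> 4 * c / pi / (2 * real k + 1)"
          using \<theta>_le[OF c(1) refl, of "int k"] that by simp
        have "4 * c / pi \<le> 1" using c by (simp add: field_simps)
        then have "4 * c / pi / (2 * real k + 1) \<le> 1 / (2 * real k + 1)" by (intro divide_right_mono) auto
        with \<theta> have \<theta>': "\<theta> (int k) \<le> 1 / (2 * real k + 1)" by linarith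
        have "\<theta> (int k) \<le> (if k < K then 1 else 0) + \<epsilon> / 8"
        proof (cases "k < K")
          case True
          have "\<theta> (int k) \<le> 1" using \<theta>' by (rule order_trans) simp
          with True \<epsilon> show ?thesis by simp
        next
          case False
          then have "1 / (2 * real k + 1) \<le> 1 / (2 * real K + 1)" by (intro divide_left_mono) auto
          with False \<theta>' K_small show ?thesis by simp
        qed
        then have "\<theta> (int k) * ?a (int k) \<le> ((if k < K then 1 else 0) + \<epsilon> / 8) * ?a (int k)"
          by (intro mult_right_mono) auto
        then show ?thesis by (simp add: distrib_right split: if_splits)
      qed
      have "(\<Sum>k<?n. \<theta> (int k - int 0) * ?a (int k - int 0))
          \<le> (\<Sum>k<?n. (if k < K then ?a (int k) else 0) + \<epsilon> / 8 * ?a (int k))"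
        using term_le by (intro sum_mono) auto
      also have "\<dots> = (\<Sum>k<?n. if k < K then ?a (int k) else 0) + \<epsilon> / 8 * (\<Sum>k<?n. ?a (int k))"
        by (simp add: sum.distrib sum_distrib_left)
      also have "(\<Sum>k<?n. ?a (int k)) = 1" using parseval[of v 0] v by simp
      also have "(\<Sum>k<?n. if k < K then ?a (int k) else 0) \<le> (\<Sum>k<K. ?a (int k))"
      proof -
        have "(\<Sum>k<?n. if k < K then ?a (int k) else 0) = (\<Sum>k\<in>{..<?n} \<inter> {..<K}. ?a (int k))"
          by (subst sum.inter_restrict) (auto intro!: sum.cong)
        also have "\<dots> \<le> (\<Sum>k<K. ?a (int k))" by (intro sum_mono2) auto
        finally show ?thesis .
      qed
      also have "(\<Sum>k<K. ?a (int k)) = (\<Sum>k\<in>Q. ?a k)"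
        unfolding Q_def by (subst sum.reindex) auto
      finally have S: "(\<Sum>k<?n. \<theta> (int k - int 0) * ?a (int k - int 0)) \<le> (\<Sum>k\<in>Q. ?a k) + \<epsilon> / 8" by simp
      \<comment> \<open>Five errors of at most \<open>\<epsilon> / 8\<close>: the level above 2, the
        cutoff at \<open>m0\<close>, the Gram limits, the form of \<open>D\<close>, and the small
        signal modes.\<close>
      have "form ?n (Hm ?x) v + form ?n (Dm ?x) v + (\<Sum>k<?n. \<theta> (int k - int 0) * ?a (int k - int 0)) \<le> 2 + \<epsilon>"
        using H D S z_le m0(2) \<epsilon> by linarith
      then show "form ?n (Tm ?x) v \<le> sqrt (real ?n) * (2 + \<epsilon>)"
        unfolding form_Tm[of _ v "int 0"] by (intro mult_left_mono) auto
    qed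
    then show ?case using n by (simp add: field_simps)
  qed
  from good_filter_whp[where P = "\<lambda>n T. scaled_max n T \<le> 2 + \<epsilon>",
      OF c(1) z_gt \<open>\<epsilon> / 8 > 0\<close> this]
  show ?thesis .
qed

text \<open>The Rayleigh quotient of the trial vector with coefficients \<open>a\<close> over the
  top mode. In the limit \<open>H\<close> contributes the Jacobi form and the top mode
  \<open>4 * c / pi * (a 0)^2\<close>. The first \<open>K\<close> negative modes are asymptotically
  orthogonal to the trial vector, and all further eigenvalues are at least
  \<open>- \<delta>\<close>.\<close>

lemma lower_whp:
  fixes a :: "nat \<Rightarrow> real"
  assumes c: "0 \<le> c" and a: "\<And>m. m \<ge> m0 \<Longrightarrow> a m = 0" and S0: "(\<Sum>m\<le>m0. a m * a m) > 0"
    and L: "L * (\<Sum>m\<le>m0. a m * a m) <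
      (\<Sum>m\<le>m0. a m * ((if m = 0 then 0 else a (m - 1)) + a (Suc m))) + 4 * c / pi * (a 0)\<^sup>2"
  shows "(\<lambda>n. planted_prob c n
    {T. \<not> L \<le> scaled_max n T}) \<longlonglongrightarrow> 0"
proof -
  define s0 where "s0 = (\<Sum>m\<le>m0. a m * a m)"
  define s1 where "s1 = (\<Sum>m\<le>m0. a m * ((if m = 0 then 0 else a (m - 1)) + a (Suc m)))"
  define C where "C = 4 * c / pi"
  \<comment> \<open>A quarter of the gap per unit of squared norm: \<open>\<delta>\<close> is spent
    twice, on the form of \<open>D\<close> and on the signal modes that are not treated
    individually.\<close>
  define \<delta> where "\<delta> = (s1 + C * (a 0)\<^sup>2 - L * s0) / (4 * s0)"
  have s0: "s0 > 0" using S0 by (simp add: s0_def)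
  have C0: "C \<ge> 0" using c by (simp add: C_def)
  have \<delta>: "\<delta> > 0" using L s0 unfolding \<delta>_def s0_def[symmetric] s1_def[symmetric] C_def[symmetric] by simp
  have gap: "s1 + C * (a 0)\<^sup>2 - L * s0 - \<delta> * s0 - \<delta> * s0 > 0"
  proof -
    have "s1 + C * (a 0)\<^sup>2 - L * s0 = 4 * (\<delta> * s0)" using s0 by (simp add: \<delta>_def)
    then show ?thesis using mult_pos_pos[OF \<delta> s0] by linarith
  qed
  obtain K :: nat where K: "max 1 (C / \<delta>) < real K" using reals_Archimedean2 by blast
  have K_small: "C / (2 * real K + 1) \<le> \<delta>"
  proof -
    have "C \<le> \<delta> * real K" using K \<delta> by (simp add: field_simps)
    also have "\<dots> \<le> \<delta> * (2 * real K + 1)" using \<delta> by (intro mult_left_mono) auto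
    finally show ?thesis by (simp add: pos_divide_le_eq add_pos_nonneg)
  qed
  define Q where "Q = {- int K..<int K}"
  have Q: "finite Q" "Q \<subseteq> {- int K..<int K}" "0 \<in> Q" using K by (auto simp: Q_def)
  \<comment> \<open>The level \<open>3\<close> is chosen above 2, as \<open>good_filter_whp\<close>
    demands.\<close>
  let ?F = "good_filter c 3 \<delta> K m0"
  interpret fr: chebyshev_frame ?F fst frame_H frame_x
    frame_al Q m0
    by (rule frame[OF Q(1,2)])
  define y where "y i = fr.comb i 0 a" for i
  have qn_lim: "((\<lambda>i. qn (fst i) (y i)) \<longlongrightarrow> s0) ?F"
    unfolding y_def s0_def by (rule fr.comb_qn_lim[OF Q(3) tendsto_const])
  have form_lim: "((\<lambda>i. form (fst i) (frame_H i) (y i)) \<longlongrightarrow> s1) ?F"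
    unfolding y_def s1_def by (rule fr.comb_form_lim[OF Q(3) a])
  have ip_lim: "((\<lambda>i. (cmod (ip (fst i) (frame_x i k 0) (y i)))\<^sup>2) \<longlongrightarrow> (if k = 0 then (a 0)\<^sup>2 else 0)) ?F"
    if "k \<in> Q" for k
    using tendsto_power[OF tendsto_norm[OF fr.xs_comb_ip_lim[OF Q(3) that, of a]], of 2]
    by (auto simp: y_def split: if_splits)
  define th where "th n = 2 * c / real n * cot (pi / (2 * real n))" for n :: nat
  have th_lim: "((\<lambda>i. th (fst i)) \<longlongrightarrow> C) ?F"
  proof (rule tendsto_good_filter)
    have "(\<lambda>n. 2 * c / real n * (cos (pi / (2 * real n)) / sin (pi / (2 * real n)))) \<longlonglongrightarrow> 4 * c / pi"
      by real_asymp
    then show "th \<longlonglongrightarrow> C" by (simp add: th_def[abs_def] cot_def C_def)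
  qed
  let ?neg = "{- int K..<0}"
  let ?low = "\<lambda>i. form (fst i) (frame_H i) (y i) - \<delta> * qn (fst i) (y i)
      + (th (fst i) * (cmod (ip (fst i) (frame_x i 0 0) (y i)))\<^sup>2
        - C * (\<Sum>k\<in>?neg. (cmod (ip (fst i) (frame_x i k 0) (y i)))\<^sup>2) - \<delta> * qn (fst i) (y i))
      - L * qn (fst i) (y i)"
  have "(?low \<longlongrightarrow> s1 - \<delta> * s0 + (C * (if (0::int) = 0 then (a 0)\<^sup>2 else 0)
      - C * (\<Sum>k\<in>?neg. if k = 0 then (a 0)\<^sup>2 else 0) - \<delta> * s0) - L * s0) ?F"
    by (intro tendsto_intros form_lim qn_lim th_lim ip_lim) (use Q in \<open>auto simp: Q_def\<close>)
  also have "(\<Sum>k\<in>?neg. if k = 0 then (a 0)\<^sup>2 else 0) = 0" by (intro sum.neutral) auto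
  finally have low_lim: "(?low \<longlongrightarrow> s1 - \<delta> * s0 + (C * (a 0)\<^sup>2 - \<delta> * s0) - L * s0) ?F" by simp
  have "s1 - \<delta> * s0 + (C * (a 0)\<^sup>2 - \<delta> * s0) - L * s0 > 0" using gap by linarith
  from order_tendstoD(1)[OF low_lim this] order_tendstoD(1)[OF qn_lim s0]
  have "\<forall>\<^sub>F i in ?F. L \<le> 1 / sqrt (real (fst i)) * lambda_max (i_times (coupled_model.tour (fst i) (fst (snd i)) (snd (snd i))))"
    using good_filter_members good_filter_ge[of "Suc (2 * K)"]
  proof eventually_elim
    case (elim i)
    let ?n = "fst i" and ?x = "snd (snd i)"
    from elim interpret coupled_model ?n "fst (snd i)" "gam c ?n" by simp
    let ?v = "y i"
    let ?a = "\<lambda>k. (cmod (ip ?n (uv k) ?v))\<^sup>2"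
    have x: "?x \<in> good 3 \<delta> K m0" using elim by simp
    then have "\<bar>form ?n (Dm ?x) ?v\<bar> \<le> \<delta> * qn ?n ?v" unfolding good_def by (intro form_Dm_ge) blast
    then have D: "form ?n (Dm ?x) ?v \<ge> - (\<delta> * qn ?n ?v)" by linarith
    \<comment> \<open>In the window shifted by \<open>K\<close>, positions below \<open>K\<close>
      are the negative modes, position \<open>K\<close> is the top mode, and beyond it no eigenvalue
      lies below \<open>- \<delta>\<close>.\<close>
    have term_ge: "\<theta> (int k - int K) * ?a (int k - int K) \<ge>
        (if k = K then th ?n * ?a 0 else 0) - (if k < K then C * ?a (int k - int K) else 0) - \<delta> * ?a (int k - int K)"
      if k: "k < ?n" for k
    proof -
      let ?k = "int k - int K"
      consider "k < K" | "k = K" | "k > K" by linarith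
      then have "\<theta> ?k \<ge> (if k = K then th ?n else 0) - (if k < K then C else 0) - \<delta>"
      proof cases
        case 1
        then have "\<theta> ?k \<ge> - (4 * c / pi)" using elim(4) by (intro \<theta>_ge_neg[OF c refl]) auto
        with 1 \<delta> show ?thesis by (simp add: C_def)
      next
        case 2
        then show ?thesis using \<theta>_0[OF c refl] \<delta> by (simp add: th_def)
      next
        case 3
        then have "\<theta> ?k \<ge> - (4 * c / pi / (2 * real K + 1))" using k by (intro \<theta>_ge_pos[OF c refl]) auto
        with 3 K_small show ?thesis by (simp add: C_def)
      qed
      then have "\<theta> ?k * ?a ?k \<ge> ((if k = K then th ?n else 0) - (if k < K then C else 0) - \<delta>) * ?a ?k"
        by (intro mult_right_mono) auto
      then show ?thesis by (simp add: left_diff_distrib split: if_splits)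
    qed
    have "(\<Sum>k<?n. \<theta> (int k - int K) * ?a (int k - int K)) \<ge>
        (\<Sum>k<?n. (if k = K then th ?n * ?a 0 else 0) - (if k < K then C * ?a (int k - int K) else 0) - \<delta> * ?a (int k - int K))"
      using term_ge by (intro sum_mono) auto
    moreover have "(\<Sum>k<?n. (if k = K then th ?n * ?a 0 else 0) - (if k < K then C * ?a (int k - int K) else 0) - \<delta> * ?a (int k - int K))
       = th ?n * ?a 0 - C * (\<Sum>k\<in>?neg. ?a k) - \<delta> * qn ?n ?v"
    proof -
      have "(\<Sum>k<?n. if k = K then th ?n * ?a 0 else 0) = th ?n * ?a 0" using elim(4) by simp
      moreover have "(\<Sum>k<?n. if k < K then C * ?a (int k - int K) else 0) = C * (\<Sum>k\<in>?neg. ?a k)"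
      proof -
        have "(\<Sum>k<?n. if k < K then C * ?a (int k - int K) else 0) = (\<Sum>k<K. C * ?a (int k - int K))"
          using elim(4) by (intro sum.mono_neutral_cong_right) auto
        also have "\<dots> = (\<Sum>k\<in>?neg. C * ?a k)"
          by (rule sum.reindex_bij_witness[of _ "\<lambda>k. nat (k + int K)" "\<lambda>k. int k - int K"]) auto
        finally show ?thesis by (simp add: sum_distrib_left)
      qed
      moreover have "(\<Sum>k<?n. \<delta> * ?a (int k - int K)) = \<delta> * qn ?n ?v"
        unfolding parseval[of ?v "int K"] by (simp add: sum_distrib_left)
      ultimately show ?thesis by (simp add: sum_subtractf)
    qed
    ultimately have S: "(\<Sum>k<?n. \<theta> (int k - int K) * ?a (int k - int K)) \<ge> th ?n * ?a 0 - C * (\<Sum>k\<in>?neg. ?a k) - \<delta> * qn ?n ?v"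
      by linarith
    have low: "form ?n (Hm ?x) ?v - \<delta> * qn ?n ?v + (th ?n * ?a 0 - C * (\<Sum>k\<in>?neg. ?a k) - \<delta> * qn ?n ?v) - L * qn ?n ?v > 0"
      using elim(1) by (simp add: xv_0)
    have "L * qn ?n ?v \<le> form ?n (Hm ?x) ?v + form ?n (Dm ?x) ?v + (\<Sum>k<?n. \<theta> (int k - int K) * ?a (int k - int K))"
      using low S D by linarith
    then have "sqrt (real ?n) * (L * qn ?n ?v) \<le> form ?n (Tm ?x) ?v"
      unfolding form_Tm[of _ _ "int K"] by (intro mult_left_mono) auto
    also have "\<dots> \<le> lambda_max (i_times (tour ?x)) * qn ?n ?v" by (rule lambda_max_tour_ge)
    finally have "(sqrt (real ?n) * L) * qn ?n ?v \<le> lambda_max (i_times (tour ?x)) * qn ?n ?v" by (simp add: mult_ac)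
    then have "sqrt (real ?n) * L \<le> lambda_max (i_times (tour ?x))" using elim(2) by (simp add: mult_le_cancel_right)
    then show ?case using n by (simp add: field_simps)
  qed
  from good_filter_whp[where P = "\<lambda>n T. L \<le> scaled_max n T", OF c _ \<delta> this]
  show ?thesis by simp
qed

text \<open>The sequence \<open>t^m\<close> solves the eigenvalue equation of the free Jacobi matrix
  at \<open>t + 1 / t\<close>; the two subtracted terms are the defects at the corner and at the
  cutoff.\<close>

lemma geometric_coefficients:
  fixes t :: real
  assumes t: "t > 0" and m0: "m0 > 0"
  defines "a \<equiv> \<lambda>m. if m < m0 then t ^ m else 0"
  shows "(\<Sum>m\<le>m0. a m * ((if m = 0 then 0 else a (m - 1)) + a (Suc m)))
    = (t + 1 / t) * (\<Sum>m\<le>m0. a m * a m) - 1 / t - t ^ (2 * m0 - 1)"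
proof -
  have "a m * ((if m = 0 then 0 else a (m - 1)) + a (Suc m))
      = (t + 1 / t) * (a m * a m) - (if m = 0 then 1 / t else 0) - (if m = m0 - 1 then t ^ (2 * m0 - 1) else 0)"
    if "m \<le> m0" for m
  proof -
    have prev: "(if m = 0 then 0 else a (m - 1)) = t ^ m / t - (if m = 0 then 1 / t else 0)" if "m < m0"
      using that t by (cases m) (auto simp: a_def)
    have nxt: "a (Suc m) = t * t ^ m - (if m = m0 - 1 then t ^ m0 else 0)" if "m < m0"
      using that m0 by (cases "m = m0 - 1") (auto simp: a_def simp flip: power_Suc)
    have last: "t ^ (m0 - 1) * t ^ m0 = t ^ (2 * m0 - 1)" using m0 by (simp flip: power_add add: mult_2)
    show ?thesis
    proof (cases "m < m0")
      case True
      then have "a m = t ^ m" by (simp add: a_def)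
      then show ?thesis unfolding prev[OF True] nxt[OF True] using last
        by (auto simp: algebra_simps split: if_splits)
    next
      case False
      then have "m = m0" "a m = 0" "m \<noteq> m0 - 1" "m \<noteq> 0" using that m0 by (auto simp: a_def)
      then show ?thesis by simp
    qed
  qed
  then have "(\<Sum>m\<le>m0. a m * ((if m = 0 then 0 else a (m - 1)) + a (Suc m)))
     = (\<Sum>m\<le>m0. (t + 1 / t) * (a m * a m) - (if m = 0 then 1 / t else 0) - (if m = m0 - 1 then t ^ (2 * m0 - 1) else 0))"
    by (intro sum.cong) auto
  then show ?thesis using m0 by (simp add: sum_subtractf sum_distrib_left)
qed

text \<open>Constant coefficients, the case \<open>t = 1\<close>, have Jacobi quotient
  \<open>2 - 2 / m0\<close>, and the limiting contribution of the top mode is nonnegative.\<close>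

lemma lower_whp_bulk:
  assumes c: "0 \<le> c" and \<epsilon>: "\<epsilon> > 0"
  shows "(\<lambda>n. planted_prob c n
    {T. \<not> 2 - \<epsilon> \<le> scaled_max n T}) \<longlonglongrightarrow> 0"
proof -
  obtain m0 :: nat where m0: "max 1 (2 / \<epsilon>) < real m0" using reals_Archimedean2 by blast
  then have pos: "m0 > 0" by (auto intro: Nat.gr0I)
  define a where "a m = (if m < m0 then (1::real) ^ m else 0)" for m
  have s0: "(\<Sum>m\<le>m0. a m * a m) = real m0"
  proof -
    have "(\<Sum>m\<le>m0. a m * a m) = (\<Sum>m<m0. 1)"
      by (intro sum.mono_neutral_cong_right) (auto simp: a_def)
    then show ?thesis by simp
  qed
  have s1: "(\<Sum>m\<le>m0. a m * ((if m = 0 then 0 else a (m - 1)) + a (Suc m))) = 2 * real m0 - 2"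
    using geometric_coefficients[of 1 m0] pos s0 unfolding a_def by simp
  show ?thesis
  proof (rule lower_whp[of c m0 a, OF c])
    show "a m = 0" if "m \<ge> m0" for m using that by (simp add: a_def)
    show "0 < (\<Sum>m\<le>m0. a m * a m)" unfolding s0 using pos by simp
    have "\<epsilon> * real m0 > 2" using m0 \<epsilon> by (simp add: field_simps)
    moreover have "4 * c / pi * (a 0)\<^sup>2 \<ge> 0" using c by simp
    ultimately show "(2 - \<epsilon>) * (\<Sum>m\<le>m0. a m * a m) <
      (\<Sum>m\<le>m0. a m * ((if m = 0 then 0 else a (m - 1)) + a (Suc m))) + 4 * c / pi * (a 0)\<^sup>2"
      unfolding s0 s1 left_diff_distrib by linarith
  qed
qed

text \<open>For \<open>t = 1 / \<theta>\<close> the corner defect \<open>- 1 / t\<close> is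
  cancelled exactly by the signal \<open>\<theta> * (a 0)^2\<close>, so the quotient tends to
  \<open>\<theta> + 1 / \<theta>\<close> as \<open>m0\<close> grows. Claiming only half of the gap
  above 2 absorbs the defect of the cutoff.\<close>

lemma lower_whp_outlier:
  assumes c: "c > pi / 4"
  defines "\<theta> \<equiv> 4 * c / pi"
  shows "(\<lambda>n. planted_prob c n
    {T. \<not> 2 + (\<theta> + 1 / \<theta> - 2) / 2 \<le> scaled_max n T}) \<longlonglongrightarrow> 0"
    and "\<theta> + 1 / \<theta> - 2 > 0"
proof -
  have \<theta>: "\<theta> > 1" using c by (simp add: \<theta>_def field_simps)
  define t where "t = 1 / \<theta>"
  have t: "0 < t" "t < 1" "1 / t = \<theta>" using \<theta> by (auto simp: t_def)
  have "\<theta> + 1 / \<theta> - 2 = (\<theta> - 1)\<^sup>2 / \<theta>" using \<theta> by (simp add: field_simps power2_eq_square)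
  then show gap: "\<theta> + 1 / \<theta> - 2 > 0" using \<theta> by simp
  have "(\<lambda>m. t ^ m) \<longlonglongrightarrow> 0" using t by (intro LIMSEQ_realpow_zero) auto
  then have e1: "\<forall>\<^sub>F m in sequentially. t ^ m < (\<theta> + 1 / \<theta> - 2) / 2" by (rule order_tendstoD) (use gap in simp)
  obtain m0 where m0: "m0 > 0" "t ^ m0 < (\<theta> + 1 / \<theta> - 2) / 2"
    using eventually_happens'[OF sequentially_bot eventually_conj[OF eventually_gt_at_top[of 0] e1]] by auto
  define a where "a m = (if m < m0 then t ^ m else 0)" for m
  define s0 where "s0 = (\<Sum>m\<le>m0. a m * a m)"
  have "a 0 * a 0 \<le> s0" unfolding s0_def by (rule member_le_sum) auto
  then have s0: "s0 \<ge> 1" using m0 by (simp add: a_def)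
  have s1: "(\<Sum>m\<le>m0. a m * ((if m = 0 then 0 else a (m - 1)) + a (Suc m))) = (t + \<theta>) * s0 - \<theta> - t ^ (2 * m0 - 1)"
    using geometric_coefficients[OF t(1) m0(1)] unfolding a_def s0_def t(3) by simp
  have "t ^ (2 * m0 - 1) \<le> t ^ m0" using t m0(1) by (intro power_decreasing) auto
  then have small: "t ^ (2 * m0 - 1) < (\<theta> + 1 / \<theta> - 2) / 2" using m0(2) by linarith
  have c0: "0 \<le> c" using c pi_gt_zero by (meson divide_pos_pos less_imp_le less_trans zero_less_numeral)
  show "(\<lambda>n. planted_prob c n
    {T. \<not> 2 + (\<theta> + 1 / \<theta> - 2) / 2 \<le> scaled_max n T}) \<longlonglongrightarrow> 0"
  proof (rule lower_whp[of c m0 a, OF c0])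
    show "a m = 0" if "m \<ge> m0" for m using that by (simp add: a_def)
    show "0 < (\<Sum>m\<le>m0. a m * a m)" using s0 by (simp add: s0_def)
    have "(\<theta> + 1 / \<theta> - 2) / 2 * 1 \<le> (\<theta> + 1 / \<theta> - 2) / 2 * s0"
      using gap s0 by (intro mult_left_mono) auto
    moreover have "(t + \<theta>) * s0 - (2 + (\<theta> + 1 / \<theta> - 2) / 2) * s0 = (\<theta> + 1 / \<theta> - 2) / 2 * s0"
    proof -
      have "(y + x) - (2 + (x + y - 2) / 2) = (x + y - 2) / 2" for x y :: real
        by (simp add: field_simps)
      then have "(t + \<theta>) - (2 + (\<theta> + 1 / \<theta> - 2) / 2) = (\<theta> + 1 / \<theta> - 2) / 2"
        unfolding t_def .
      then show ?thesis unfolding left_diff_distrib[symmetric] by (rule arg_cong)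
    qed
    moreover have "4 * c / pi * (a 0)\<^sup>2 = \<theta>" using m0 by (simp add: a_def \<theta>_def)
    ultimately show "(2 + (\<theta> + 1 / \<theta> - 2) / 2) * (\<Sum>m\<le>m0. a m * a m) <
      (\<Sum>m\<le>m0. a m * ((if m = 0 then 0 else a (m - 1)) + a (Suc m))) + 4 * c / pi * (a 0)\<^sup>2"
      unfolding s1 s0_def[symmetric] using small by linarith
  qed
qed

section \<open>Convergence in probability and conclusion\<close>

lemma planted_tendsto_2:
  assumes c: "0 \<le> c" "c \<le> pi / 4"
  shows "tendsto_in_prob (\<lambda>n. planted_model n (gam c n))
    (\<lambda>n T. scaled_max n T) 2"
  unfolding tendsto_in_prob_def
proof (intro allI impI)
  fix \<epsilon> :: real assume \<epsilon>: "\<epsilon> > 0"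
  let ?P = "\<lambda>n. planted_prob c n"
  let ?Y = "\<lambda>n T. scaled_max n T"
  have lim: "(\<lambda>n. ?P n {T. \<not> ?Y n T \<le> 2 + \<epsilon>} + ?P n {T. \<not> 2 - \<epsilon> \<le> ?Y n T}) \<longlonglongrightarrow> 0"
    using tendsto_add[OF upper_whp[OF c \<epsilon>] lower_whp_bulk[OF c(1) \<epsilon>]] by simp
  show "(\<lambda>n. ?P n {T. \<bar>?Y n T - 2\<bar> > \<epsilon>}) \<longlonglongrightarrow> 0"
  proof (rule tendsto_sandwich[OF _ _ tendsto_const lim])
    show "\<forall>\<^sub>F n in sequentially. ?P n {T. \<bar>?Y n T - 2\<bar> > \<epsilon>}
        \<le> ?P n {T. \<not> ?Y n T \<le> 2 + \<epsilon>} + ?P n {T. \<not> 2 - \<epsilon> \<le> ?Y n T}"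
    proof (intro always_eventually allI)
      fix n
      have "?P n {T. \<bar>?Y n T - 2\<bar> > \<epsilon>} \<le> ?P n ({T. \<not> ?Y n T \<le> 2 + \<epsilon>} \<union> {T. \<not> 2 - \<epsilon> \<le> ?Y n T})"
      proof (rule measure_pmf.finite_measure_mono, rule subsetI)
        fix T assume "T \<in> {T. \<bar>?Y n T - 2\<bar> > \<epsilon>}"
        then have "\<epsilon> < \<bar>?Y n T - 2\<bar>" by (rule CollectD)
        then have "\<not> ?Y n T \<le> 2 + \<epsilon> \<or> \<not> 2 - \<epsilon> \<le> ?Y n T" by linarith
        then show "T \<in> {T. \<not> ?Y n T \<le> 2 + \<epsilon>} \<union> {T. \<not> 2 - \<epsilon> \<le> ?Y n T}" by (simp only: Un_iff mem_Collect_eq)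
      qed simp
      also have "\<dots> \<le> ?P n {T. \<not> ?Y n T \<le> 2 + \<epsilon>} + ?P n {T. \<not> 2 - \<epsilon> \<le> ?Y n T}"
        by (rule measure_Un_le) auto
      finally show "?P n {T. \<bar>?Y n T - 2\<bar> > \<epsilon>}
        \<le> ?P n {T. \<not> ?Y n T \<le> 2 + \<epsilon>} + ?P n {T. \<not> 2 - \<epsilon> \<le> ?Y n T}" .
    qed
  qed simp
qed

theorem theorem2p3:
  shows "\<exists>f :: real \<Rightarrow> real. (\<forall>c > pi / 4. f c > 0) \<and>
    (\<forall>c :: real. c > 0 \<longrightarrow>
      tendsto_in_prob null_model
        (\<lambda>n T. 1 / sqrt (real n) * lambda_max (i_times T)) 2 \<and>
      (c \<le> pi / 4 \<longrightarrow>
        tendsto_in_prob (\<lambda>n. planted_model n (c * real n powr (- 1 / 2)))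
          (\<lambda>n T. 1 / sqrt (real n) * lambda_max (i_times T)) 2) \<and>
      (c > pi / 4 \<longrightarrow>
        with_high_prob (\<lambda>n. planted_model n (c * real n powr (- 1 / 2)))
          (\<lambda>n T. 1 / sqrt (real n) * lambda_max (i_times T) \<ge> 2 + f c)))"
proof (intro exI[of _ "\<lambda>c. (4 * c / pi + 1 / (4 * c / pi) - 2) / 2"] conjI allI impI)
  fix c :: real
  show "(4 * c / pi + 1 / (4 * c / pi) - 2) / 2 > 0" if "c > pi / 4"
    using lower_whp_outlier(2)[OF that] by simp
  \<comment> \<open>The uniform model is the planted one with \<open>c = 0\<close>.\<close>
  show "tendsto_in_prob null_model (\<lambda>n T. 1 / sqrt (real n) * lambda_max (i_times T)) 2"
    using planted_tendsto_2[of 0] by (simp add: null_model_def[abs_def])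
  show "tendsto_in_prob (\<lambda>n. planted_model n (c * real n powr (- 1 / 2)))
      (\<lambda>n T. 1 / sqrt (real n) * lambda_max (i_times T)) 2" if "c > 0" "c \<le> pi / 4"
    using planted_tendsto_2[of c] that by simp
  show "with_high_prob (\<lambda>n. planted_model n (c * real n powr (- 1 / 2)))
      (\<lambda>n T. 1 / sqrt (real n) * lambda_max (i_times T) \<ge> 2 + (4 * c / pi + 1 / (4 * c / pi) - 2) / 2)"
    if "c > pi / 4"
  proof -
    let ?P = "\<lambda>n. measure_pmf.prob (planted_model n (c * real n powr (- 1 / 2)))"
    let ?A = "\<lambda>n. {T. 1 / sqrt (real n) * lambda_max (i_times T) \<ge> 2 + (4 * c / pi + 1 / (4 * c / pi) - 2) / 2}"
    have "(\<lambda>n. ?P n (- ?A n)) \<longlonglongrightarrow> 0"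
      using lower_whp_outlier(1)[OF that] by (simp only: Collect_neg_eq)
    then have "(\<lambda>n. 1 - ?P n (- ?A n)) \<longlonglongrightarrow> 1 - 0" by (intro tendsto_diff tendsto_const)
    moreover have "1 - ?P n (- ?A n) = ?P n (?A n)" for n
      using measure_pmf.prob_compl[of "?A n" "planted_model n (c * real n powr (- 1 / 2))"]
      by (simp add: Compl_eq_Diff_UNIV)
    ultimately show ?thesis unfolding with_high_prob_def by simp
  qed
qed

end
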